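(* Let $\Gamma\subset\mathbb{R}^2$ be a locally $1$-Lipschitz Jordan curve. Then, for all integers $n\ge 2$, there exists an integer $1\le k\le n-1$ such that $\Gamma$ has an inscribed rectangle with aspect ratio $\tan\left(\frac{k\pi}{2n}\right)$. In particular, $\Gamma$ has an inscribed square and an inscribed rectangle with aspect ratio $\sqrt{3}$.
   Context: A Jordan curve is the image of an injective continuous map $S^1\to\mathbb{R}^2=\mathbb{C}$. A Jordan curve $\Gamma$ is locally $1$-Lipschitz if for each $p\in\Gamma$ there exist $\epsilon>0$ and an isometry $(-\epsilon,\epsilon)\times(-\epsilon,\epsilon)\to U\subset\mathbb{C}$ centered at $p$ (i.e. sending the origin to $p$, with image $U$) such that, in these coordinates, $\Gamma\cap U$ is the graph of a $1$-Lipschitz function. A (non-degenerate) Euclidean rectangle in $\mathbb{R}^2$ is inscribed in $\Gamma$ if its four corners belong to $\Gamma$. The aspect ratio of a rectangle whose sides have lengths $a$ and $b$ is $b/a$; it is only defined up to taking reciprocals. *)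

theory Defs
  imports "HOL-Analysis.Analysis"
begin

definition Jordan_curve :: "complex set \<Rightarrow> bool" where
  "Jordan_curve \<Gamma> \<longleftrightarrow>
     (\<exists>\<gamma>. continuous_on (sphere (0::complex) 1) \<gamma> \<and> inj_on \<gamma> (sphere 0 1) \<and>
          \<Gamma> = \<gamma> ` sphere 0 1)"

(* The metric of the product type is the Euclidean one, so distance preservation on Q makes
   phi an isometry of Q onto the neighbourhood U = phi ` Q of p. The graph is compared with
   the part of Gamma in U pulled back to Q; f is thereby defined on the whole interval and
   takes its values in it. *)
definition locally_1_Lipschitz :: "complex set \<Rightarrow> bool" where
  "locally_1_Lipschitz \<Gamma> \<longleftrightarrow>
     (\<forall>p\<in>\<Gamma>. \<exists>\<epsilon>>0. \<exists>\<phi> :: real \<times> real \<Rightarrow> complex.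
        let Q = {-\<epsilon><..<\<epsilon>} \<times> {-\<epsilon><..<\<epsilon>} in
          (\<forall>z\<in>Q. \<forall>w\<in>Q. dist (\<phi> z) (\<phi> w) = dist z w) \<and> \<phi> (0, 0) = p \<and>
          (\<exists>f. 1-lipschitz_on {-\<epsilon><..<\<epsilon>} f \<and>
               {z \<in> Q. \<phi> z \<in> \<Gamma>} = {(x, f x) | x. x \<in> {-\<epsilon><..<\<epsilon>}}))"

(* A rectangle is given by its corners a, b, c, d in cyclic order. *)
definition nondegenerate_rectangle ::
    "complex \<Rightarrow> complex \<Rightarrow> complex \<Rightarrow> complex \<Rightarrow> bool" where
  "nondegenerate_rectangle a b c d \<longleftrightarrow>
     a \<noteq> b \<and> a \<noteq> d \<and> c - b = d - a \<and> orthogonal (b - a) (d - a)"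

definition inscribed_rectangle ::
    "complex set \<Rightarrow> complex \<Rightarrow> complex \<Rightarrow> complex \<Rightarrow> complex \<Rightarrow> bool" where
  "inscribed_rectangle \<Gamma> a b c d \<longleftrightarrow>
     nondegenerate_rectangle a b c d \<and> a \<in> \<Gamma> \<and> b \<in> \<Gamma> \<and> c \<in> \<Gamma> \<and> d \<in> \<Gamma>"

(* The aspect ratio is only defined up to taking reciprocals, hence a relation. *)
definition has_aspect_ratio ::
    "complex \<Rightarrow> complex \<Rightarrow> complex \<Rightarrow> complex \<Rightarrow> real \<Rightarrow> bool" where
  "has_aspect_ratio a b c d r \<longleftrightarrow>
     dist b c / dist a b = r \<or> dist a b / dist b c = r"

definition has_inscribed_rectangle_of_ratio :: "complex set \<Rightarrow> real \<Rightarrow> bool" where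
  "has_inscribed_rectangle_of_ratio \<Gamma> r \<longleftrightarrow>
     (\<exists>a b c d. inscribed_rectangle \<Gamma> a b c d \<and> has_aspect_ratio a b c d r)"

definition has_inscribed_square :: "complex set \<Rightarrow> bool" where
  "has_inscribed_square \<Gamma> \<longleftrightarrow>
     (\<exists>a b c d. inscribed_rectangle \<Gamma> a b c d \<and> dist a b = dist b c)"

end

theory Submission
  imports Defs "HOL-Complex_Analysis.Complex_Analysis"
begin

text \<open>Let \<open>\<psi>\<close> be the signed distance to the curve. Rotate a chord by an angle \<open>\<alpha>\<close> about its midpoint:
  the values of \<open>\<psi>\<close> at the two new end points form a complex number that is conjugated when the end
  points are exchanged and that vanishes iff the two chords are the diagonals of an inscribed rectangle
  of aspect ratio \<open>tan (\<alpha>/2)\<close>. If it never vanishes, then on the space of chords its argument, or its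
  argument plus \<open>\<pi>\<close>, lifts to an odd real function; this gives \<open>\<alpha>\<close> a sign, which depends on \<open>\<alpha>\<close> modulo \<open>\<pi>\<close> only.

  The chords are the zeros of a function of midpoint, direction and length, and rotating the direction
  gives further surfaces of this kind. Two or three such surfaces, after a perturbation that moves their
  phases along the lifted arguments, would have to meet by a mod \<open>2\<close> intersection argument (a
  Poincare-Miranda theorem with one antiperiodic coordinate, proved by Kuhn's labelling method),
  although their signs forbid it, unless \<open>\<alpha>\<close> and \<open>-\<alpha>\<close> have opposite signs and the angles of either
  sign are closed under addition. So if no multiple of \<open>\<pi>/n\<close> gave a rectangle, the cyclic group of
  order \<open>n\<close> would carry a translation invariant total order, which is absurd.

  The Lipschitz condition enters for short chords only: near the curve \<open>\<psi>\<close> increases in all directions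
  at angle less than \<open>\<pi>/4\<close> from some normal, so there is exactly one chord direction for a given midpoint and length,
  and Hopf's Umlaufsatz shows that the resulting normal field extends to the exterior without
  zeros.\<close>

section \<open>A Poincare-Miranda theorem with an antiperiodic coordinate\<close>

text \<open>Midpoint, direction and half-length are four real unknowns, and four equations are
  imposed: three imaginary parts vanish, and so does the largest (or the smallest) of three real
  parts. A solution lies on one of the surfaces, where another surface function has a phase that the
  signs control. The imaginary parts are odd in the direction \<open>e\<close>. Two of them,
  however, determine a plane vector, and \<open>e\<close> times that vector is even; far away it is
  the radial field, which supplies two sign conditions. The length supplies the third, and the last
  imaginary part remains as the antiperiodic equation. The obstacle is the diagonal, near which the
  lifted arguments are not controlled. Below half-length \<epsilon> the chord equations are
  therefore deformed into an artificial family that vanishes in one direction only for each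
  midpoint. Outside the curve this asks for a field without zeros; inside, beyond the collar, zeros
  do no harm, because the real parts are negative there.\<close>

text \<open>The counterpart of \<open>simplex_top_face\<close> at the other end of the cube. In
  \<open>ksimplex p n\<close> all coordinates from \<open>n\<close> on equal \<open>p\<close>, hence
  the translation by \<open>x(n := p)\<close>. A facet on \<open>x n = 0\<close> omits the top
  vertex of the chain, whose last step must be in direction \<open>n\<close>; conversely such a step
  is appended to an \<open>n\<close>-simplex.\<close>

lemma simplex_bottom_face:
  assumes "0 < p" and F: "\<forall>x\<in>F. x n = 0"
  shows "(\<exists>s a. ksimplex p (Suc n) s \<and> a \<in> s \<and> F = s - {a}) \<longleftrightarrow>
         ksimplex p n ((\<lambda>x. x(n := p)) ` F)"
proof
  assume "\<exists>s a. ksimplex p (Suc n) s \<and> a \<in> s \<and> F = s - {a}"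
  then obtain s a where s: "ksimplex p (Suc n) s" and a: "a \<in> s" and Fs: "F = s - {a}" by blast
  from s show "ksimplex p n ((\<lambda>x. x(n := p)) ` F)"
  proof cases
    case (ksimplex base upd)
    then interpret kuhn_simplex p "Suc n" base upd s .
    have "a n > 0"
      using one_step[of a n 0] F a unfolding Fs by auto
    have "x \<le> a" if "x \<in> s" for x
    proof (cases "x = a")
      case False
      then have "x n = 0" using F that unfolding Fs by auto
      then show ?thesis using less[OF that a, of n] \<open>a n > 0\<close> by (simp add: less_imp_le)
    qed simp
    then have atop: "a = enum (Suc n)"
      using a by (subst enum_n_top) auto
    have F_eq: "F = enum ` {..n}"
    proof -
      have "s = insert a (enum ` {..n})"
        unfolding s_eq atop by (simp add: atMost_Suc)
      moreover have "a \<notin> enum ` {..n}"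
        unfolding atop by (auto simp: enum_inj)
      ultimately show ?thesis unfolding Fs by auto
    qed
    have en0: "enum i n = 0" if "i \<le> n" for i
      using F that unfolding F_eq by auto
    have updn: "upd n = n"
    proof (rule ccontr)
      assume "upd n \<noteq> n"
      then have "enum (Suc n) n = enum n n"
        by (simp add: enum_Suc)
      then show False using \<open>a n > 0\<close> en0[of n] atop by simp
    qed
    have bij: "bij_betw upd {..<n} {..<n}"
    proof -
      have "bij_betw upd ({..<Suc n} - {n}) ({..<Suc n} - {n})"
        using bij_betw_DiffI[OF upd, of "{n}" "{n}"] updn
        by (auto simp: bij_betw_def)
      moreover have "{..<Suc n} - {n} = {..<n}" by auto
      ultimately show ?thesis by simp
    qed
    have notin: "i \<le> n \<Longrightarrow> n \<notin> upd ` {..<i}" for i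
      using bij by (auto simp: bij_betw_def)
    show ?thesis
    proof (rule ksimplex.intros, standard)
      show "bij_betw upd {..<n} {..<n}" by fact
      show "base(n := p) \<in> {..<n} \<rightarrow> {..<p}" "\<And>i. n\<le>i \<Longrightarrow> (base(n := p)) i = p"
        using base base_out by (auto simp: Pi_iff)
      show "(\<lambda>x. x(n := p)) ` F =
        (\<lambda>i j. if j \<in> upd ` {..<i} then Suc ((base(n := p)) j) else (base(n := p)) j) ` {..n}"
        unfolding F_eq image_image
        by (intro image_cong refl ext) (use notin in \<open>auto simp: enum_def\<close>)
    qed
  qed
next
  assume "ksimplex p n ((\<lambda>x. x(n := p)) ` F)"
  then show "\<exists>s a. ksimplex p (Suc n) s \<and> a \<in> s \<and> F = s - {a}"
  proof cases
    case (ksimplex base upd)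
    then interpret kuhn_simplex p n base upd "(\<lambda>x. x(n := p)) ` F" .
    define b where "b = base(n := 0)"
    define u where "u = upd(n := n)"
    define f' where "f' i j = (if j \<in> u ` {..<i} then Suc (b j) else b j)" for i j
    have uim: "i \<le> n \<Longrightarrow> u ` {..<i} = upd ` {..<i}" for i
      unfolding u_def by auto
    have notin: "i \<le> n \<Longrightarrow> n \<notin> upd ` {..<i}" for i
      using upd by (auto simp: bij_betw_def)
    have "F = (\<lambda>x. x(n := 0)) ` ((\<lambda>x. x(n := p)) ` F)"
      using F by (force simp: image_image fun_upd_idem)
    also have "\<dots> = f' ` {..n}"
      unfolding s_eq image_image
      by (intro image_cong refl ext) (use notin uim in \<open>auto simp: enum_def f'_def b_def\<close>)
    finally have F_eq: "F = f' ` {..n}" .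
    have "f' (Suc n) n = 1"
      by (auto simp: f'_def u_def b_def)
    then have new: "f' (Suc n) \<notin> F" using F by auto
    have "ksimplex p (Suc n) (f' ` {..Suc n})"
    proof (rule ksimplex.intros, standard)
      show "b \<in> {..<Suc n} \<rightarrow> {..<p}"
        using base \<open>0 < p\<close> unfolding lessThan_Suc b_def by (auto simp: Pi_iff)
      show "\<And>i. Suc n \<le> i \<Longrightarrow> b i = p"
        using base_out by (auto simp: b_def)
      have "bij_betw u ({..<n} \<union> {n}) ({..<n} \<union> {u n})"
        using upd by (intro notIn_Un_bij_betw) (auto simp: u_def bij_betw_def inj_on_def)
      then show "bij_betw u {..<Suc n} {..<Suc n}"
        by (simp add: u_def lessThan_Suc)
      show "f' ` {..Suc n} = (\<lambda>i j. if j \<in> u ` {..<i} then Suc (b j) else b j) ` {..Suc n}"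
        by (intro image_cong refl ext) (simp add: f'_def)
    qed
    moreover have "F = f' ` {..Suc n} - {f' (Suc n)}"
      using new unfolding F_eq by (auto simp: atMost_Suc)
    ultimately show ?thesis by blast
  qed
qed

text \<open>The boundary facets labelled by \<open>{..n}\<close> lie on the faces \<open>x n = 0\<close> and \<open>x n = p\<close>. These carry the
  same labels but opposite values of \<open>\<beta>\<close>, so every fully labelled simplex of the \<open>n\<close>-dimensional cube
  is counted on exactly one of them, and Kuhn's lemma says that their number is odd.\<close>

lemma kuhn_antiperiodic:
  fixes lab :: "(nat \<Rightarrow> nat) \<Rightarrow> nat \<Rightarrow> nat" and \<beta> :: "(nat \<Rightarrow> nat) \<Rightarrow> bool"
  assumes p: "0 < p"
    and lab_0: "\<And>x j. \<forall>j. x j \<le> p \<Longrightarrow> j < n \<Longrightarrow> x j = 0 \<Longrightarrow> lab x j = 0"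
    and lab_1: "\<And>x j. \<forall>j. x j \<le> p \<Longrightarrow> j < n \<Longrightarrow> x j = p \<Longrightarrow> lab x j = 1"
    and per: "\<And>x j. \<forall>j. x j \<le> p \<Longrightarrow> x n = 0 \<Longrightarrow> lab (x(n := p)) = lab x"
    and anti: "\<And>x. \<forall>j. x j \<le> p \<Longrightarrow> x n = 0 \<Longrightarrow> \<beta> (x(n := p)) \<longleftrightarrow> \<not> \<beta> x"
    and const: "\<And>s x y. ksimplex p n s \<Longrightarrow> (reduced n \<circ> lab) ` s = {..n} \<Longrightarrow> x \<in> s \<Longrightarrow> y \<in> s \<Longrightarrow> \<beta> x = \<beta> y"
  shows "odd (card {s. ksimplex p (Suc n) s \<and>
           (\<lambda>x. if \<beta> x then reduced n (lab x) else Suc n) ` s = {..Suc n}})"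
proof -
  define rl where "rl x = (if \<beta> x then reduced n (lab x) else Suc n)" for x
  have rl_n: "rl x \<le> n \<longleftrightarrow> \<beta> x" for x
    by (simp add: rl_def reduced_labelling)
  define up where "up = (\<lambda>x::nat\<Rightarrow>nat. x(n := p))"
  define dn where "dn = (\<lambda>x::nat\<Rightarrow>nat. x(n := 0))"
  have le_p: "\<forall>j. x j \<le> p" if "ksimplex p k s" "x \<in> s" for k s x
    using that by (auto elim!: ksimplex.cases dest: kuhn_simplex.s_le_p)
  have topn: "x n = p" if "ksimplex p n s" "x \<in> s" for s x
    using that by (auto elim!: ksimplex.cases dest: kuhn_simplex.out_eq_p)
  let ?full = "\<lambda>s. ksimplex p n s \<and> (reduced n \<circ> lab) ` s = {..n}"
  let ?P = "{s. ?full s \<and> (\<forall>x\<in>s. \<beta> x)}"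
  let ?N = "{s. ?full s \<and> (\<forall>x\<in>s. \<not> \<beta> x)}"
  \<comment> \<open>The facets that \<open>kuhn_simplex_lemma\<close> counts. On them \<beta> holds
    at every vertex, since its failure gives the label \<open>Suc n\<close>.\<close>
  let ?B = "{f. \<exists>s a. ksimplex p (Suc n) s \<and> a \<in> s \<and> (f = s - {a}) \<and>
      rl ` f = {..n} \<and> ((\<exists>j\<le>n. \<forall>x\<in>f. x j = 0) \<or> (\<exists>j\<le>n. \<forall>x\<in>f. x j = p))}"
  have fin: "finite {s. ksimplex p n s}" by (rule finite_ksimplexes)
  have "{s. ?full s} = ?P \<union> ?N"
    using const by blast
  moreover have "?P \<inter> ?N = {}"
    by auto
  moreover have "finite ?P" "finite ?N"
    by (rule finite_subset[OF _ fin], blast)+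
  ultimately have "card {s. ?full s} = card ?P + card ?N"
    by (simp add: card_Un_disjoint)
  moreover have "odd (card {s. ?full s})"
    using kuhn_combinatorial[OF p, of n lab] lab_0 lab_1 by blast
  ultimately have odd_PN: "odd (card ?P + card ?N)" by simp
  have inj_dn: "inj_on (image dn) ?N"
  proof (rule inj_on_inverseI)
    fix s assume "s \<in> ?N"
    then have "up (dn x) = x" if "x \<in> s" for x
      using topn that by (auto simp: up_def dn_def)
    then show "up ` (dn ` s) = s"
      by (auto simp: image_image)
  qed
  have BI: "f \<in> ?B" if 1: "\<exists>s a. ksimplex p (Suc n) s \<and> a \<in> s \<and> f = s - {a}"
    and 2: "rl ` f = {..n}" and 3: "(\<forall>x\<in>f. x n = 0) \<or> (\<forall>x\<in>f. x n = p)" for f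
  proof -
    from 1 obtain s a where sa: "ksimplex p (Suc n) s" "a \<in> s" "f = s - {a}"
      by (elim exE conjE) (rule that)
    have 4: "(\<exists>j\<le>n. \<forall>x\<in>f. x j = 0) \<or> (\<exists>j\<le>n. \<forall>x\<in>f. x j = p)"
      using 3 by (elim disjE) (rule disjI1 disjI2, rule exI[of _ n], simp)+
    show ?thesis
      by (rule CollectI, rule exI[of _ s], rule exI[of _ a], intro conjI sa 2 4)
  qed
  have B_eq: "?B = ?P \<union> image dn ` ?N"
  proof (intro equalityI subsetI)
    fix f assume "f \<in> ?B"
    then obtain s a where *: "ksimplex p (Suc n) s \<and> a \<in> s \<and> f = s - {a} \<and>
        rl ` f = {..n} \<and> ((\<exists>j\<le>n. \<forall>x\<in>f. x j = 0) \<or> (\<exists>j\<le>n. \<forall>x\<in>f. x j = p))"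
      by (elim CollectE exE) (rule that)
    note s = *[THEN conjunct1] *[THEN conjunct2, THEN conjunct1] *[THEN conjunct2, THEN conjunct2, THEN conjunct1]
    note rl = *[THEN conjunct2, THEN conjunct2, THEN conjunct2, THEN conjunct1]
    note bd = *[THEN conjunct2, THEN conjunct2, THEN conjunct2, THEN conjunct2]
    have \<beta>: "\<beta> x" if "x \<in> f" for x
      using rl that by (auto simp flip: rl_n)
    have red: "(reduced n \<circ> lab) ` f = {..n}"
      using rl \<beta> by (auto simp: rl_def)
    have lef: "\<forall>j. x j \<le> p" if "x \<in> f" for x
      using le_p[OF s(1)] s(3) that by auto
    \<comment> \<open>A face in a direction \<open>j < n\<close> cannot carry all labels: on
      \<open>x j = 0\<close> the label \<open>j\<close> is missing, on \<open>x j = p\<close> the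
      label \<open>n\<close>.\<close>
    from bd have "(\<forall>x\<in>f. x n = 0) \<or> (\<forall>x\<in>f. x n = p)"
    proof (elim disjE exE conjE)
      fix j assume j: "j \<le> n" "\<forall>x\<in>f. x j = 0"
      show ?thesis
      proof (cases "j = n")
        case False
        have "reduced n (lab x) \<noteq> j" if "x \<in> f" for x
          using lab_0[of x j] lef[OF that] j that False by (intro reduced_labelling_zero) auto
        then have "j \<notin> (reduced n \<circ> lab) ` f" by auto
        then show ?thesis using red j by auto
      qed (use j in auto)
    next
      fix j assume j: "j \<le> n" "\<forall>x\<in>f. x j = p"
      show ?thesis
      proof (cases "j = n")
        case False
        have "reduced n (lab x) \<noteq> n" if "x \<in> f" for x
        proof -
          have jn: "j < n" using j False by simp
          then have "lab x j = 1" using j that by (intro lab_1[OF lef[OF that]]) simp_all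
          then show ?thesis using reduced_labelling_nonzero[OF jn, of "lab x"] jn by simp
        qed
        then have "n \<notin> (reduced n \<circ> lab) ` f" by (metis comp_apply imageE)
        then show ?thesis using red j by auto
      qed (use j in auto)
    qed
    then show "f \<in> ?P \<union> image dn ` ?N"
    proof
      assume f0: "\<forall>x\<in>f. x n = 0"
      then have "ksimplex p n (up ` f)"
        using simplex_bottom_face[OF p f0] s unfolding up_def by blast
      moreover have "(reduced n \<circ> lab) ` (up ` f) = {..n}"
        unfolding red[symmetric] image_image up_def
        by (intro image_cong refl) (simp add: per lef f0)
      moreover have "\<forall>x\<in>up ` f. \<not> \<beta> x"
        using anti lef f0 \<beta> by (auto simp: up_def)
      ultimately have "up ` f \<in> ?N" by simp
      moreover have "f = dn ` (up ` f)"
        using f0 by (force simp: image_image dn_def up_def fun_upd_idem)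
      ultimately have "f \<in> image dn ` ?N" by (rule rev_image_eqI)
      then show ?thesis ..
    next
      assume fp: "\<forall>x\<in>f. x n = p"
      then have "ksimplex p n f"
        using simplex_top_face[OF p fp] s by blast
      then have "f \<in> ?P" using red \<beta> by simp
      then show ?thesis ..
    qed
  next
    fix f assume "f \<in> ?P \<union> image dn ` ?N"
    then show "f \<in> ?B"
    proof
      assume f: "f \<in> ?P"
      then have fp: "\<forall>x\<in>f. x n = p" using topn by blast
      have rl: "rl ` f = (reduced n \<circ> lab) ` f"
        using f by (intro image_cong refl) (auto simp: rl_def)
      have "\<exists>s a. ksimplex p (Suc n) s \<and> a \<in> s \<and> f = s - {a}"
        using simplex_top_face[OF p fp] f by blast
      then show ?thesis using rl f fp by (intro BI) simp_all
    next
      assume "f \<in> image dn ` ?N"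
      then obtain t where t: "t \<in> ?N" "f = dn ` t" by blast
      have ud: "up (dn x) = x" if "x \<in> t" for x
        using topn t(1) that by (auto simp: up_def dn_def)
      have f0: "\<forall>x\<in>f. x n = 0" using t by (auto simp: dn_def)
      have "up ` f = t" using ud by (auto simp: t(2) image_image)
      then have "\<exists>s a. ksimplex p (Suc n) s \<and> a \<in> s \<and> f = s - {a}"
        using simplex_bottom_face[OF p f0] t(1) unfolding up_def by auto
      moreover have "rl (dn x) = (reduced n \<circ> lab) x" if x: "x \<in> t" for x
      proof -
        have le: "\<forall>j. dn x j \<le> p" using le_p t(1) x by (auto simp: dn_def)
        have 0: "dn x n = 0" by (simp add: dn_def)
        have "\<beta> (dn x)"
          using anti[OF le 0] ud[OF x] t(1) x by (auto simp: up_def)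
        moreover have "lab (dn x) = lab x"
          using per[OF le 0] ud[OF x] by (simp add: up_def)
        ultimately show ?thesis by (simp add: rl_def)
      qed
      then have "rl ` f = (reduced n \<circ> lab) ` t"
        unfolding t(2) image_image by (intro image_cong refl)
      ultimately show ?thesis using f0 t(1) by (intro BI) simp_all
    qed
  qed
  have disj: "?P \<inter> image dn ` ?N = {}"
  proof -
    have False if "s \<in> ?P" "t \<in> ?N" "s = dn ` t" for s t
    proof -
      have "s \<noteq> {}" using that(1) by auto
      then obtain x where "x \<in> s" by blast
      then have "x n = p" "x n = 0" using that topn[of s x] by (auto simp: dn_def)
      then show False using p by simp
    qed
    then show ?thesis by blast
  qed
  have "card ?B = card ?P + card (image dn ` ?N)"
    unfolding B_eq using disj \<open>finite ?P\<close> \<open>finite ?N\<close> by (intro card_Un_disjoint) auto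
  also have "card (image dn ` ?N) = card ?N"
    by (rule card_image[OF inj_dn])
  finally have "odd (card ?B)" using odd_PN by simp
  moreover have "\<forall>s. ksimplex p (Suc n) s \<longrightarrow> rl ` s \<subseteq> {.. Suc n}"
    using reduced_labelling(1) by (fastforce simp: rl_def le_Suc_eq)
  ultimately have "odd (card {s. ksimplex p (Suc n) s \<and> rl ` s = {..Suc n}})"
    by (intro kuhn_simplex_lemma)
  then show ?thesis by (simp add: rl_def[abs_def])
qed

lemma ksimplex_le: "ksimplex p n s \<Longrightarrow> x \<in> s \<Longrightarrow> x j \<le> p"
  by (auto elim!: ksimplex.cases dest: kuhn_simplex.s_le_p)

lemma ksimplex_close:
  assumes "ksimplex p n s" "x \<in> s" "y \<in> s"
  shows "\<bar>real (x j) - real (y j)\<bar> \<le> 1"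
  using assms(1)
proof cases
  case (ksimplex base upd)
  then interpret kuhn_simplex p n base upd s .
  show ?thesis
    using base_le[OF assms(2), of j] base_le[OF assms(3), of j]
      le_Suc_base[OF assms(2), of j] le_Suc_base[OF assms(3), of j] by linarith
qed

text \<open>Without a common zero, a small grid simplex carrying all labels of \<open>f1\<close>,
  \<open>f2\<close>, \<open>f3\<close> makes these three small, so \<open>b\<close> is large and of
  constant sign on it. This is the hypothesis on \<beta> in \<open>kuhn_antiperiodic\<close>, and
  the same fact rules out the fully labelled 4-simplex which that lemma provides.\<close>

lemma miranda_antiperiodic:
  fixes f1 f2 f3 b :: "real \<times> real \<times> real \<times> real \<Rightarrow> real"
  defines "Q \<equiv> {0..1} \<times> {0..1} \<times> {0..1} \<times> {0..1}"
  assumes cont: "continuous_on Q f1" "continuous_on Q f2" "continuous_on Q f3" "continuous_on Q b"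
    and m1: "\<And>y z t. y \<in> {0..1} \<Longrightarrow> z \<in> {0..1} \<Longrightarrow> t \<in> {0..1} \<Longrightarrow> f1 (0,y,z,t) \<le> 0 \<and> 0 \<le> f1 (1,y,z,t)"
    and m2: "\<And>x z t. x \<in> {0..1} \<Longrightarrow> z \<in> {0..1} \<Longrightarrow> t \<in> {0..1} \<Longrightarrow> f2 (x,0,z,t) \<le> 0 \<and> 0 \<le> f2 (x,1,z,t)"
    and m3: "\<And>x y t. x \<in> {0..1} \<Longrightarrow> y \<in> {0..1} \<Longrightarrow> t \<in> {0..1} \<Longrightarrow> f3 (x,y,0,t) \<le> 0 \<and> 0 \<le> f3 (x,y,1,t)"
    and per: "\<And>x y z. x \<in> {0..1} \<Longrightarrow> y \<in> {0..1} \<Longrightarrow> z \<in> {0..1} \<Longrightarrow>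
        f1 (x,y,z,1) = f1 (x,y,z,0) \<and> f2 (x,y,z,1) = f2 (x,y,z,0) \<and> f3 (x,y,z,1) = f3 (x,y,z,0)
        \<and> b (x,y,z,1) = - b (x,y,z,0)"
  shows "\<exists>x\<in>Q. f1 x = 0 \<and> f2 x = 0 \<and> f3 x = 0 \<and> b x = 0"
proof (rule ccontr)
  assume no: "\<not> ?thesis"
  define g where "g x = \<bar>f1 x\<bar> + \<bar>f2 x\<bar> + \<bar>f3 x\<bar> + \<bar>b x\<bar>" for x
  have "compact Q" unfolding Q_def by (intro compact_Times compact_Icc)
  moreover have "Q \<noteq> {}" by (auto simp: Q_def)
  moreover have "continuous_on Q g" unfolding g_def by (intro continuous_intros cont)
  ultimately have "\<exists>x\<in>Q. \<forall>y\<in>Q. g x \<le> g y"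
    by (rule continuous_attains_inf)
  then obtain q where q: "q \<in> Q" "\<And>x. x \<in> Q \<Longrightarrow> g q \<le> g x" by auto
  define d where "d = g q"
  have "d > 0" using no q(1) by (fastforce simp: d_def g_def)
  have gd: "d \<le> \<bar>f1 x\<bar> + \<bar>f2 x\<bar> + \<bar>f3 x\<bar> + \<bar>b x\<bar>" if "x \<in> Q" for x
    using q(2)[OF that] by (simp add: d_def g_def)
  \<comment> \<open>With oscillations below \<open>d/5\<close>, three small functions leave
    \<open>\<bar>b\<bar>\<close> above \<open>2*d/5\<close>, twice the oscillation of
    \<open>b\<close>.\<close>
  have uc: "\<exists>\<delta>>0. \<forall>x\<in>Q. \<forall>y\<in>Q. dist x y < \<delta> \<longrightarrow> \<bar>h x - h y\<bar> < d/5"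
    if h: "continuous_on Q h" for h :: "real \<times> real \<times> real \<times> real \<Rightarrow> real"
    using compact_uniformly_continuous[OF h \<open>compact Q\<close>] \<open>d > 0\<close>
    unfolding uniformly_continuous_on_def dist_real_def
    by (elim allE[of _ "d/5"]) (auto simp: dist_commute abs_minus_commute)
  from uc[OF cont(1)] obtain \<delta>1 where \<delta>1: "\<delta>1 > 0"
    "\<forall>x\<in>Q. \<forall>y\<in>Q. dist x y < \<delta>1 \<longrightarrow> \<bar>f1 x - f1 y\<bar> < d/5" by (elim exE conjE) (rule that)
  from uc[OF cont(2)] obtain \<delta>2 where \<delta>2: "\<delta>2 > 0"
    "\<forall>x\<in>Q. \<forall>y\<in>Q. dist x y < \<delta>2 \<longrightarrow> \<bar>f2 x - f2 y\<bar> < d/5" by (elim exE conjE) (rule that)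
  from uc[OF cont(3)] obtain \<delta>3 where \<delta>3: "\<delta>3 > 0"
    "\<forall>x\<in>Q. \<forall>y\<in>Q. dist x y < \<delta>3 \<longrightarrow> \<bar>f3 x - f3 y\<bar> < d/5" by (elim exE conjE) (rule that)
  from uc[OF cont(4)] obtain \<delta>4 where \<delta>4: "\<delta>4 > 0"
    "\<forall>x\<in>Q. \<forall>y\<in>Q. dist x y < \<delta>4 \<longrightarrow> \<bar>b x - b y\<bar> < d/5" by (elim exE conjE) (rule that)
  define \<delta> where "\<delta> = min (min \<delta>1 \<delta>2) (min \<delta>3 \<delta>4)"
  have "\<delta> > 0" using \<delta>1(1) \<delta>2(1) \<delta>3(1) \<delta>4(1) by (simp add: \<delta>_def)
  then obtain p :: nat where p: "4 / \<delta> < real p" using reals_Archimedean2 by blast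
  have p0: "0 < p" using p \<open>\<delta> > 0\<close> by (auto intro!: gr0I)
  have p\<delta>: "4 / real p < \<delta>" using p p0 \<open>\<delta> > 0\<close> by (simp add: field_simps)
  define pt where "pt v = (real (v 0) / p, real (v 1) / p, real (v 2) / p, real (v 3) / p)" for v :: "nat \<Rightarrow> nat"
  have ptQ: "pt v \<in> Q" if "\<forall>j. v j \<le> p" for v
    using that p0 by (simp add: pt_def Q_def)
  define f where "f i = (if i = 0 then f1 else if i = 1 then f2 else f3)" for i :: nat
  \<comment> \<open>At both ends of coordinate \<open>i\<close> the label is forced, so that a zero
    of \<open>f i\<close> there does no harm. The default 0 from index 3 on makes the labels on
    \<open>v 3 = 0\<close> and \<open>v 3 = p\<close> equal as functions.\<close>
  define lab where "lab v i = (if i \<ge> 3 \<or> v i = 0 then 0 else if v i = p \<or> f i (pt v) \<ge> 0 then 1 else 0::nat)" for v i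
  \<comment> \<open>On \<open>v 3 = p\<close> the sign is taken, negated, from the opposite face:
    the condition \<open>b > 0\<close> alone would violate antiperiodicity where \<open>b\<close>
    vanishes.\<close>
  define \<beta> where "\<beta> v = (if v 3 = p then \<not> b (pt (v(3 := 0))) > 0 else b (pt v) > 0)" for v
  have unit: "real m / real p \<in> {0..1}" if "m \<le> p" for m using that p0 by simp
  have i3: "i = 0 \<or> i = 1 \<or> i = 2" if "i < 3" for i :: nat using that by auto
  have f_lo: "f i (pt v) \<le> 0" if v: "\<forall>j. v j \<le> p" and "i < 3" "v i = 0" for v i
    using i3[OF \<open>i < 3\<close>] m1[OF unit unit unit, of "v 1" "v 2" "v 3"]
      m2[OF unit unit unit, of "v 0" "v 2" "v 3"] m3[OF unit unit unit, of "v 0" "v 1" "v 3"] that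
    by (auto simp: f_def pt_def)
  have f_hi: "f i (pt v) \<ge> 0" if v: "\<forall>j. v j \<le> p" and "i < 3" "v i = p" for v i
    using i3[OF \<open>i < 3\<close>] m1[OF unit unit unit, of "v 1" "v 2" "v 3"]
      m2[OF unit unit unit, of "v 0" "v 2" "v 3"] m3[OF unit unit unit, of "v 0" "v 1" "v 3"] that p0
    by (auto simp: f_def pt_def)
  have per_f: "f i (pt (v(3 := p))) = f i (pt v)" and per_b: "b (pt (v(3 := p))) = - b (pt v)"
    if v: "\<forall>j. v j \<le> p" and "v 3 = 0" for v i
    using per[OF unit unit unit, of "v 0" "v 1" "v 2"] that p0 by (auto simp: f_def pt_def)
  have lab1: "f i (pt v) \<ge> 0" if "\<forall>j. v j \<le> p" "i < 3" "lab v i \<noteq> 0" for v i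
    using that f_hi by (auto simp: lab_def split: if_splits)
  have lab0: "f i (pt v) \<le> 0" if "\<forall>j. v j \<le> p" "i < 3" "lab v i = 0" for v i
    using that f_lo by (auto simp: lab_def split: if_splits)
  have \<beta>1: "b (pt v) \<ge> 0" if "\<forall>j. v j \<le> p" "\<beta> v" for v
    using that per_b[of "v(3 := 0)"] by (auto simp: \<beta>_def fun_upd_idem split: if_splits)
  have \<beta>0: "b (pt v) \<le> 0" if "\<forall>j. v j \<le> p" "\<not> \<beta> v" for v
    using that per_b[of "v(3 := 0)"] by (auto simp: \<beta>_def fun_upd_idem split: if_splits)
  have close: "dist (pt v) (pt w) < \<delta>" if "ksimplex p n s" "v \<in> s" "w \<in> s" for n s v w
  proof -
    have c: "\<bar>real (v j) / p - real (w j) / p\<bar> \<le> 1 / p" for j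
      using ksimplex_close[OF that, of j] p0
      by (simp flip: diff_divide_distrib add: divide_right_mono)
    have "dist (pt v) (pt w) \<le> \<bar>real (v 0) / p - real (w 0) / p\<bar> + (\<bar>real (v 1) / p - real (w 1) / p\<bar>
        + (\<bar>real (v 2) / p - real (w 2) / p\<bar> + \<bar>real (v 3) / p - real (w 3) / p\<bar>))"
      unfolding pt_def dist_Pair_Pair
      by (intro order.trans[OF sqrt_sum_squares_le_sum] add_mono zero_le_dist)
         (auto simp: dist_real_def dist_Pair_Pair intro!: order.trans[OF sqrt_sum_squares_le_sum] add_mono)
    also have "\<dots> \<le> 4 / p" using c[of 0] c[of 1] c[of 2] c[of 3] by simp
    also note p\<delta>
    finally show ?thesis .
  qed
  have fsmall: "\<bar>f i (pt z)\<bar> < d/5"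
    if s: "ksimplex p n s" and lab: "{..3} \<subseteq> (reduced 3 \<circ> lab) ` s" and z: "z \<in> s" and "i < 3" for n s z i
  proof -
    from lab have "i \<in> (reduced 3 \<circ> lab) ` s" "3 \<in> (reduced 3 \<circ> lab) ` s"
      using \<open>i < 3\<close> by auto
    then obtain x y where xy: "x \<in> s" "reduced 3 (lab x) = i" "y \<in> s" "reduced 3 (lab y) = 3" by force
    have le: "\<forall>j. v j \<le> p" if "v \<in> s" for v using ksimplex_le[OF s that] by blast
    have "lab x i \<noteq> 0" using reduced_labelling(3)[of 3 "lab x"] xy \<open>i < 3\<close> by auto
    then have "f i (pt x) \<ge> 0" using lab1 le xy \<open>i < 3\<close> by blast
    moreover have "lab y i = 0" using reduced_labelling(2)[of 3 "lab y"] xy \<open>i < 3\<close> by auto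
    then have "f i (pt y) \<le> 0" using lab0 le xy \<open>i < 3\<close> by blast
    moreover have "\<bar>f i (pt v) - f i (pt w)\<bar> < d/5" if "v \<in> s" "w \<in> s" for v w
      using close[OF s that] ptQ[OF le[OF that(1)]] ptQ[OF le[OF that(2)]] \<delta>1(2) \<delta>2(2) \<delta>3(2)
      by (simp add: f_def \<delta>_def)
    from this[OF z xy(1)] this[OF z xy(3)]
    have "\<bar>f i (pt z) - f i (pt x)\<bar> < d/5" "\<bar>f i (pt z) - f i (pt y)\<bar> < d/5" .
    ultimately show ?thesis by linarith
  qed
  have bbig: "\<bar>b (pt z)\<bar> > 2*d/5"
    if s: "ksimplex p n s" and lab: "{..3} \<subseteq> (reduced 3 \<circ> lab) ` s" and z: "z \<in> s" for n s z
    using fsmall[OF that, of 0] fsmall[OF that, of 1] fsmall[OF that, of 2] ksimplex_le[OF s z]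
      gd[OF ptQ, of z] by (simp add: f_def)
  have bclose: "\<bar>b (pt v) - b (pt w)\<bar> < d/5" if s: "ksimplex p n s" and "v \<in> s" "w \<in> s" for n s v w
    using close[OF that] ptQ ksimplex_le[OF s \<open>v \<in> s\<close>] ksimplex_le[OF s \<open>w \<in> s\<close>] \<delta>4(2)
    by (simp add: \<delta>_def)
  have sign: "\<beta> v = \<beta> w"
    if s: "ksimplex p n s" and lab: "{..3} \<subseteq> (reduced 3 \<circ> lab) ` s" and v: "v \<in> s" and w: "w \<in> s" for n s v w
  proof -
    have le: "\<forall>j. v j \<le> p" "\<forall>j. w j \<le> p" using ksimplex_le[OF s v] ksimplex_le[OF s w] by auto
    have "\<not> (\<beta> v \<and> \<not> \<beta> w)" "\<not> (\<beta> w \<and> \<not> \<beta> v)"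
      using bclose[OF s v w] bbig[OF s lab v] bbig[OF s lab w] \<open>d > 0\<close>
        \<beta>1[OF le(1)] \<beta>0[OF le(1)] \<beta>1[OF le(2)] \<beta>0[OF le(2)] by linarith+
    then show ?thesis by blast
  qed
  have "odd (card {s. ksimplex p (Suc 3) s \<and>
           (\<lambda>x. if \<beta> x then reduced 3 (lab x) else Suc 3) ` s = {..Suc 3}})"
  proof (rule kuhn_antiperiodic[OF p0])
    show "lab (x(3 := p)) = lab x" if "\<forall>j. x j \<le> p" "x 3 = 0" for x :: "nat \<Rightarrow> nat" and j :: nat
      using per_f[OF that] by (auto simp: lab_def fun_eq_iff)
    show "\<beta> (x(3 := p)) \<longleftrightarrow> \<not> \<beta> x" if "\<forall>j. x j \<le> p" "x 3 = 0" for x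
      using p0 that by (simp add: \<beta>_def fun_upd_idem)
    show "\<beta> x = \<beta> y" if "ksimplex p 3 s" "(reduced 3 \<circ> lab) ` s = {..3}" "x \<in> s" "y \<in> s" for s x y
      using sign[OF that(1) _ that(3,4)] that(2) by simp
  qed (use p0 in \<open>auto simp: lab_def\<close>)
  then have "{s. ksimplex p (Suc 3) s \<and>
           (\<lambda>x. if \<beta> x then reduced 3 (lab x) else Suc 3) ` s = {..Suc 3}} \<noteq> {}" (is "?F \<noteq> {}")
    by (intro notI) (simp only: card.empty even_zero not_True_eq_False)
  then obtain s where "s \<in> ?F" by auto
  then have s: "ksimplex p (Suc 3) s"
    and full: "(\<lambda>x. if \<beta> x then reduced 3 (lab x) else Suc 3) ` s = {..Suc 3}"
    unfolding mem_Collect_eq by (rule conjunct1, rule conjunct2)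
  have lab: "{..3} \<subseteq> (reduced 3 \<circ> lab) ` s"
  proof
    fix i :: nat assume "i \<in> {..3}"
    then have "i \<in> (\<lambda>x. if \<beta> x then reduced 3 (lab x) else Suc 3) ` s" "i \<noteq> Suc 3"
      unfolding full by auto
    then show "i \<in> (reduced 3 \<circ> lab) ` s" by (auto split: if_splits)
  qed
  have "0 \<in> (\<lambda>x. if \<beta> x then reduced 3 (lab x) else Suc 3) ` s"
    "Suc 3 \<in> (\<lambda>x. if \<beta> x then reduced 3 (lab x) else Suc 3) ` s"
    unfolding full by auto
  then obtain v w where v: "v \<in> s" "0 = (if \<beta> v then reduced 3 (lab v) else Suc 3)"
    and w: "w \<in> s" "Suc 3 = (if \<beta> w then reduced 3 (lab w) else Suc 3)"
    by (elim imageE) (rule that)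
  have "\<beta> v" using v(2) by (cases "\<beta> v") simp_all
  moreover have "\<not> \<beta> w" using w(2) reduced_labelling(1)[of 3 "lab w"] by (cases "\<beta> w") simp_all
  ultimately show False using sign[OF s lab v(1) w(1)] by blast
qed

section \<open>Odd functions of a direction, and even plane fields\<close>

text \<open>\<open>Re (cnj w * \<omega>)\<close> is an inner product and
  \<open>Im (cnj \<omega>0 * \<omega>1)\<close> the determinant; \<open>- \<i> * \<omega>1\<close>
  and \<open>\<i> * \<omega>0\<close> are the determinant times the dual basis.\<close>

lemma dual_basis_identity:
  fixes \<omega>0 \<omega>1 w :: complex
  shows "- \<i> * \<omega>1 * of_real (Re (cnj w * \<omega>0)) + \<i> * \<omega>0 * of_real (Re (cnj w * \<omega>1))
         = of_real (Im (cnj \<omega>0 * \<omega>1)) * w"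
  by (simp add: complex_eq_iff algebra_simps)

text \<open>The direction runs over a half circle, whose ends differ by sign. The even function
  \<open>a\<close> and the components of an even plane field built from \<open>b0\<close> and
  \<open>b1\<close> are periodic and satisfy the sign conditions; \<open>b2\<close> is the
  antiperiodic function.\<close>

lemma antiperiodic_common_zero:
  fixes a b0 b1 b2 :: "complex \<times> complex \<times> real \<Rightarrow> real" and N :: "complex \<Rightarrow> complex"
  assumes cont: "continuous_on UNIV a" "continuous_on UNIV b0" "continuous_on UNIV b1" "continuous_on UNIV b2"
    and even: "\<And>m e h. a (m, - e, h) = a (m, e, h)"
    and odd: "\<And>m e h. b0 (m, - e, h) = - b0 (m, e, h)" "\<And>m e h. b1 (m, - e, h) = - b1 (m, e, h)"
      "\<And>m e h. b2 (m, - e, h) = - b2 (m, e, h)"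
    and indep: "Im (cnj \<omega>0 * \<omega>1) \<noteq> 0"
    and N: "(\<forall>m. N m = m - z0) \<or> (\<forall>m. N m = cnj (m - z0))"
    and M: "0 < M" and h01: "h0 < h1"
    and side: "\<And>m e h. cmod e = 1 \<Longrightarrow> h0 \<le> h \<Longrightarrow> h \<le> h1 \<Longrightarrow> M \<le> cmod (m - z0) \<Longrightarrow>
        b0 (m,e,h) = Re (cnj (N m) * (e * \<omega>0)) \<and> b1 (m,e,h) = Re (cnj (N m) * (e * \<omega>1))"
    and bot: "\<And>m e. cmod e = 1 \<Longrightarrow> cmod (m - z0) \<le> 2 * M \<Longrightarrow> a (m, e, h0) \<le> 0"
    and top: "\<And>m e. cmod e = 1 \<Longrightarrow> cmod (m - z0) \<le> 2 * M \<Longrightarrow> 0 \<le> a (m, e, h1)"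
  obtains m e h where "cmod e = 1" "h0 \<le> h" "h \<le> h1"
    "a (m,e,h) = 0" "b0 (m,e,h) = 0" "b1 (m,e,h) = 0" "b2 (m,e,h) = 0"
proof -
  define D where "D = Im (cnj \<omega>0 * \<omega>1)"
  have D: "D \<noteq> 0" using indep by (simp add: D_def)
  \<comment> \<open>\<open>B\<close> is \<open>e\<close> times the vector with inner products \<open>b0\<close>, \<open>b1\<close> with \<open>\<omega>0\<close>, \<open>\<omega>1\<close>; hence it is even in \<open>e\<close>\<close>
  define B where "B = (\<lambda>(m,e,h). e * (- \<i> * \<omega>1 * of_real (b0 (m,e,h)) + \<i> * \<omega>0 * of_real (b1 (m,e,h))) / of_real D)"
  have contB: "continuous_on UNIV B"
    unfolding B_def case_prod_beta' prod.collapse by (intro continuous_intros cont) (use D in simp)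
  have B_even: "B (m, - e, h) = B (m, e, h)" for m e h
    by (simp add: B_def odd algebra_simps)
  have B_side: "B (m,e,h) = N m" if "cmod e = 1" "h0 \<le> h" "h \<le> h1" "M \<le> cmod (m - z0)" for m e h
  proof -
    have "e * cnj e = 1" using that(1) by (simp add: complex_mult_cnj cmod_power2[symmetric] flip: of_real_power)
    define w where "w = N m * cnj e"
    have "b0 (m,e,h) = Re (cnj w * \<omega>0)" "b1 (m,e,h) = Re (cnj w * \<omega>1)"
      using side[OF that] by (simp_all add: w_def mult_ac)
    then have "B (m,e,h) = e * (of_real D * w) / of_real D"
      unfolding B_def D_def dual_basis_identity[symmetric] by simp
    also have "\<dots> = N m * (e * cnj e)" using D by (simp add: w_def)
    finally show ?thesis using \<open>e * cnj e = 1\<close> by simp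
  qed
  have B_zero: "b0 (m,e,h) = 0 \<and> b1 (m,e,h) = 0" if "B (m,e,h) = 0" "cmod e = 1" for m e h
  proof -
    have "e \<noteq> 0" using that(2) by auto
    then have eq: "\<omega>1 * of_real (b0 (m,e,h)) = \<omega>0 * of_real (b1 (m,e,h))"
      using that(1) D by (simp add: B_def)
    then have "cnj \<omega>0 * \<omega>1 * of_real (b0 (m,e,h)) = of_real (cmod \<omega>0 ^ 2 * b1 (m,e,h))"
      using complex_norm_square[of \<omega>0] by (simp add: mult.assoc)
    then have "Im (cnj \<omega>0 * \<omega>1 * of_real (b0 (m,e,h))) = 0" by (simp only: Im_complex_of_real)
    then have "D * b0 (m,e,h) = 0" by (simp add: D_def)
    then have "b0 (m,e,h) = 0" using D by simp
    moreover have "\<omega>0 \<noteq> 0" using indep by auto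
    ultimately show ?thesis using eq by simp
  qed
  \<comment> \<open>In the mirrored case the reflection is undone by changing the sign of the
    imaginary component.\<close>
  obtain \<sigma> :: real where \<sigma>: "\<sigma> = 1 \<or> \<sigma> = -1" and N_Re: "\<And>m. Re (N m) = Re (m - z0)" and N_Im: "\<And>m. \<sigma> * Im (N m) = Im (m - z0)"
  proof -
    show ?thesis using N that[of 1] that[of "-1"] by auto
  qed
  \<comment> \<open>The midpoint runs over the square of half-side \<open>M\<close> about
    \<open>z0\<close>: its edges are at distance at least \<open>M\<close>, where
    \<open>side\<close> applies, and all of it lies within \<open>2 * M\<close>, where
    \<open>bot\<close> and \<open>top\<close> apply.\<close>
  define P where "P = (\<lambda>(x,y,z,t). (z0 + Complex (M * (2*x - 1)) (M * (2*y - 1)), cis (pi * t), h0 + (h1 - h0) * z))"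
  have contP: "continuous_on UNIV P"
    unfolding P_def case_prod_beta' cis_conv_exp Complex_eq by (intro continuous_intros)
  have contPc: "continuous_on S (\<lambda>x. g (P x))" if "continuous_on UNIV g" for S and g :: "complex \<times> complex \<times> real \<Rightarrow> real"
    by (rule continuous_on_subset[OF continuous_on_compose2[OF that contP]]) auto
  have hz: "h0 \<le> h0 + (h1 - h0) * z" "h0 + (h1 - h0) * z \<le> h1" if "z \<in> {0..1}" for z
  proof -
    have "0 \<le> (h1 - h0) * z" "0 \<le> (h1 - h0) * (1 - z)"
      using that h01 by (intro mult_nonneg_nonneg; simp)+
    then show "h0 \<le> h0 + (h1 - h0) * z" "h0 + (h1 - h0) * z \<le> h1" by (simp_all add: algebra_simps)
  qed
  have unit: "\<bar>2*x - 1\<bar> \<le> 1" if "x \<in> {0..1}" for x :: real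
    using that by (simp add: abs_le_iff)
  have big: "M \<le> cmod (Complex (M * (2*x - 1)) (M * (2*y - 1)))" if "x = 0 \<or> x = 1 \<or> y = 0 \<or> y = 1" for x y
    using abs_Re_le_cmod[of "Complex (M * (2*x - 1)) (M * (2*y - 1))"]
      abs_Im_le_cmod[of "Complex (M * (2*x - 1)) (M * (2*y - 1))"] M that by auto
  have small: "cmod (Complex (M * (2*x - 1)) (M * (2*y - 1))) \<le> 2 * M" if "x \<in> {0..1}" "y \<in> {0..1}" for x y
  proof -
    have "cmod (Complex (M * (2*x - 1)) (M * (2*y - 1))) \<le> \<bar>M * (2*x - 1)\<bar> + \<bar>M * (2*y - 1)\<bar>"
      using cmod_le[of "Complex (M * (2*x - 1)) (M * (2*y - 1))"] by simp
    also have "\<dots> \<le> M + M"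
      using unit[OF that(1)] unit[OF that(2)] M by (intro add_mono) (simp_all add: abs_mult)
    finally show ?thesis by simp
  qed
  have "\<exists>x\<in>{0..1} \<times> {0..1} \<times> {0..1} \<times> {0..1}.
      Re (B (P x)) = 0 \<and> \<sigma> * Im (B (P x)) = 0 \<and> a (P x) = 0 \<and> b2 (P x) = 0"
  proof (rule miranda_antiperiodic)
    fix y z t :: real assume "y \<in> {0..1}" "z \<in> {0..1}" "t \<in> {0..1}"
    then have "B (P (0,y,z,t)) = N (fst (P (0,y,z,t)))" "B (P (1,y,z,t)) = N (fst (P (1,y,z,t)))"
      using hz[of z] big[of 0 y] big[of 1 y] by (auto simp: P_def intro!: B_side)
    then show "Re (B (P (0,y,z,t))) \<le> 0 \<and> 0 \<le> Re (B (P (1,y,z,t)))"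
      using M by (simp add: N_Re) (simp add: P_def)
  next
    fix x z t :: real assume "x \<in> {0..1}" "z \<in> {0..1}" "t \<in> {0..1}"
    then have "B (P (x,0,z,t)) = N (fst (P (x,0,z,t)))" "B (P (x,1,z,t)) = N (fst (P (x,1,z,t)))"
      using hz[of z] big[of x 0] big[of x 1] by (auto simp: P_def intro!: B_side)
    then show "\<sigma> * Im (B (P (x,0,z,t))) \<le> 0 \<and> 0 \<le> \<sigma> * Im (B (P (x,1,z,t)))"
      using M by (simp add: N_Im) (simp add: P_def)
  next
    fix x y t :: real assume "x \<in> {0..1}" "y \<in> {0..1}" "t \<in> {0..1}"
    then show "a (P (x,y,0,t)) \<le> 0 \<and> 0 \<le> a (P (x,y,1,t))"
      using bot top small[of x y] by (simp add: P_def)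
  next
    fix x y z :: real
    have "P (x,y,z,1) = (fst (P (x,y,z,0)), - fst (snd (P (x,y,z,0))), snd (snd (P (x,y,z,0))))"
      by (simp add: P_def)
    then show "Re (B (P (x,y,z,1))) = Re (B (P (x,y,z,0))) \<and> \<sigma> * Im (B (P (x,y,z,1))) = \<sigma> * Im (B (P (x,y,z,0)))
      \<and> a (P (x,y,z,1)) = a (P (x,y,z,0)) \<and> b2 (P (x,y,z,1)) = - b2 (P (x,y,z,0))"
      by (simp add: B_even even odd)
  qed (intro contPc continuous_intros contB cont)+
  then obtain x where x: "x \<in> {0..1} \<times> {0..1} \<times> {0..1} \<times> {0..1}"
    and z: "Re (B (P x)) = 0" "\<sigma> * Im (B (P x)) = 0" "a (P x) = 0" "b2 (P x) = 0" by auto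
  obtain m e h where Px: "P x = (m,e,h)" by (metis prod_cases3)
  have e: "cmod e = 1" "h0 \<le> h" "h \<le> h1"
    using x hz Px by (auto simp: P_def)
  have "B (m,e,h) = 0" using z \<sigma> Px by (auto simp: complex_eq_iff)
  from B_zero[OF this e(1)] show ?thesis
    using that e z Px by simp
qed

text \<open>A phase correction \<open>\<kappa>\<close>, odd in the direction and zero on \<open>O' k\<close>, squeezes the phase of \<open>W k\<close>
  into \<open>[-\<pi>/2, \<pi>/2]\<close> on \<open>T k\<close>. After that \<open>W k\<close> has the sign \<open>\<sigma>\<close> wherever it is real and nonzero on \<open>T k\<close>,
  so \<open>cover\<close> excludes that all \<open>W k\<close> are real and the greatest \<open>\<sigma> * Re (W k)\<close> vanishes.\<close>

lemma perturbed_surfaces_meet: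
  fixes W :: "nat \<Rightarrow> complex \<times> complex \<times> real \<Rightarrow> complex"
    and T O' :: "nat \<Rightarrow> (complex \<times> complex \<times> real) set"
    and \<phi> :: "nat \<Rightarrow> complex \<times> complex \<times> real \<Rightarrow> real" and \<omega> :: "nat \<Rightarrow> complex"
    and \<sigma> :: real and N :: "complex \<Rightarrow> complex"
  defines "mx \<equiv> \<lambda>x. max (\<sigma> * Re (W 0 x)) (max (\<sigma> * Re (W 1 x)) (\<sigma> * Re (W 2 x)))"
  assumes \<sigma>: "\<sigma> = 1 \<or> \<sigma> = - 1"
    and cont: "\<And>k. continuous_on UNIV (W k)"
    and conj: "\<And>k m e h. W k (m, - e, h) = cnj (W k (m, e, h))"
    and closed: "\<And>k. closed (T k)" "\<And>k. closed (O' k)" and disj: "\<And>k. T k \<inter> O' k = {}"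
    and inv: "\<And>k m e h. (m, e, h) \<in> T k \<Longrightarrow> (m, - e, h) \<in> T k"
      "\<And>k m e h. (m, e, h) \<in> O' k \<Longrightarrow> (m, - e, h) \<in> O' k"
    and \<phi>_cont: "\<And>k. continuous_on (T k) (\<phi> k)"
    and \<phi>_odd: "\<And>k m e h. (m, e, h) \<in> T k \<Longrightarrow> \<phi> k (m, - e, h) = - \<phi> k (m, e, h)"
    and \<phi>: "\<And>k x. x \<in> T k \<Longrightarrow> W k x = of_real (\<sigma> * cmod (W k x)) * cis (\<phi> k x)"
    and bdry: "\<And>k m e h. cmod e = 1 \<Longrightarrow> h = h0 \<or> h = h1 \<or> M \<le> cmod (m - z0) \<Longrightarrow> (m, e, h) \<in> O' k"
    and indep: "Im (cnj (\<omega> 0) * \<omega> 1) \<noteq> 0"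
    and N: "(\<forall>m. N m = m - z0) \<or> (\<forall>m. N m = cnj (m - z0))"
    and M: "0 < M" and h01: "h0 < h1"
    and side: "\<And>k m e h. k < 2 \<Longrightarrow> cmod e = 1 \<Longrightarrow> h0 \<le> h \<Longrightarrow> h \<le> h1 \<Longrightarrow> M \<le> cmod (m - z0) \<Longrightarrow>
        Im (W k (m,e,h)) = Re (cnj (N m) * (e * \<omega> k))"
    and bot: "\<And>m e. cmod e = 1 \<Longrightarrow> cmod (m - z0) \<le> 2 * M \<Longrightarrow> \<sigma> * mx (m, e, h0) \<le> 0"
    and top: "\<And>m e. cmod e = 1 \<Longrightarrow> cmod (m - z0) \<le> 2 * M \<Longrightarrow> 0 \<le> \<sigma> * mx (m, e, h1)"
    and cover: "\<And>i m e h. i < 3 \<Longrightarrow> cmod e = 1 \<Longrightarrow> h0 \<le> h \<Longrightarrow> h \<le> h1 \<Longrightarrow> W i (m,e,h) = 0 \<Longrightarrow>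
        \<exists>k<3. ((m,e,h) \<in> T k \<and> W k (m,e,h) \<noteq> 0) \<or> ((m,e,h) \<in> O' k \<and> Im (W k (m,e,h)) \<noteq> 0)"
  shows False
proof -
  define clip :: "real \<Rightarrow> real" where "clip t = max (- pi/2) (min t (pi/2))" for t
  have clip_odd: "clip (- t) = - clip t" for t using pi_gt_zero unfolding clip_def by linarith
  have clip_cont: "continuous_on S clip" for S unfolding clip_def by (intro continuous_intros)
  \<comment> \<open>Tietze extends the correction from two disjoint closed sets. Taking the odd part
    in \<open>e\<close> keeps the prescribed values, since both sets are symmetric and the
    prescribed function is odd.\<close>
  have "\<exists>\<kappa>. continuous_on UNIV \<kappa> \<and> (\<forall>m e h. \<kappa> (m,- e,h) = - \<kappa> (m,e,h)) \<and>
      (\<forall>x\<in>T k. \<kappa> x = clip (\<phi> k x) - \<phi> k x) \<and> (\<forall>x\<in>O' k. \<kappa> x = 0)" for k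
  proof -
    define f where "f x = (if x \<in> T k then clip (\<phi> k x) - \<phi> k x else 0)" for x
    have "continuous_on (T k \<union> O' k) f"
      unfolding f_def
    proof (rule continuous_on_cases[OF closed])
      show "continuous_on (T k) (\<lambda>x. clip (\<phi> k x) - \<phi> k x)"
        by (intro continuous_intros continuous_on_compose2[OF clip_cont \<phi>_cont] \<phi>_cont) auto
    qed (use disj in auto)
    moreover have "closedin (top_of_set UNIV) (T k \<union> O' k)" using closed by (simp add: closed_Un)
    ultimately obtain g where g: "continuous_on UNIV g" "\<And>x. x \<in> T k \<union> O' k \<Longrightarrow> g x = f x"
      by (rule Tietze_unbounded) blast
    define \<kappa> where "\<kappa> = (\<lambda>(m,e,h). (g (m,e,h) - g (m,-e,h)) / 2)"
    have "continuous_on UNIV \<kappa>"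
      unfolding \<kappa>_def case_prod_beta'
      by (intro continuous_intros continuous_on_compose2[OF g(1)]) auto
    moreover have "\<kappa> (m,- e,h) = - \<kappa> (m,e,h)" for m e h by (simp add: \<kappa>_def field_simps)
    moreover have "\<kappa> x = clip (\<phi> k x) - \<phi> k x" if "x \<in> T k" for x
    proof (cases x)
      case (fields m e h)
      then show ?thesis using that inv(1)[of m e h] by (simp add: \<kappa>_def g(2) f_def clip_odd \<phi>_odd field_simps)
    qed
    moreover have "\<kappa> x = 0" if "x \<in> O' k" for x
    proof (cases x)
      case (fields m e h)
      then show ?thesis using that inv(2)[of m e h k] disj[of k] by (auto simp: \<kappa>_def g(2) f_def)
    qed
    ultimately show ?thesis by blast
  qed
  then obtain \<kappa> where \<kappa>: "\<And>k. continuous_on UNIV (\<kappa> k)" "\<And>k m e h. \<kappa> k (m,- e,h) = - \<kappa> k (m,e,h)"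
    "\<And>k x. x \<in> T k \<Longrightarrow> \<kappa> k x = clip (\<phi> k x) - \<phi> k x" "\<And>k x. x \<in> O' k \<Longrightarrow> \<kappa> k x = 0"
    by metis
  define V where "V k x = W k x * cis (\<kappa> k x)" for k x
  have V_cont: "continuous_on UNIV (V k)" for k
    unfolding V_def cis_conv_exp by (intro continuous_intros cont \<kappa>)
  have V_conj: "V k (m, - e, h) = cnj (V k (m, e, h))" for k m e h
    by (simp add: V_def conj \<kappa> cis_cnj)
  have V_O: "V k x = W k x" if "x \<in> O' k" for k x using \<kappa>(4)[OF that] by (simp add: V_def)
  \<comment> \<open>For \<sigma> = 1 this is the largest of the real parts, for \<sigma> = - 1 the
    smallest.\<close>
  define a where "a x = \<sigma> * max (\<sigma> * Re (V 0 x)) (max (\<sigma> * Re (V 1 x)) (\<sigma> * Re (V 2 x)))" for x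
  obtain m e h where e: "cmod e = 1" "h0 \<le> h" "h \<le> h1" and a0: "a (m,e,h) = 0"
    and im0: "Im (V 0 (m,e,h)) = 0" "Im (V 1 (m,e,h)) = 0" "Im (V 2 (m,e,h)) = 0"
  proof (rule antiperiodic_common_zero[where ?a = a and ?b0.0 = "\<lambda>x. Im (V 0 x)" and ?b1.0 = "\<lambda>x. Im (V 1 x)" and ?b2.0 = "\<lambda>x. Im (V 2 x)",
        OF _ _ _ _ _ _ _ _ indep N M h01])
    show "continuous_on UNIV a" unfolding a_def by (intro continuous_intros V_cont)
    show "a (m, - e, h) = a (m, e, h)" for m e h by (simp add: a_def V_conj)
    show "Im (V 0 (m,e,h)) = Re (cnj (N m) * (e * \<omega> 0)) \<and> Im (V 1 (m,e,h)) = Re (cnj (N m) * (e * \<omega> 1))"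
      if "cmod e = 1" "h0 \<le> h" "h \<le> h1" "M \<le> cmod (m - z0)" for m e h
      using side[OF _ that, of 0] side[OF _ that, of 1] bdry[of e h m] that by (simp add: V_O)
    show "a (m, e, h0) \<le> 0" if "cmod e = 1" "cmod (m - z0) \<le> 2 * M" for m e
      using bot[OF that] bdry[of e h0 m] that by (simp add: a_def V_O mx_def)
    show "0 \<le> a (m, e, h1)" if "cmod e = 1" "cmod (m - z0) \<le> 2 * M" for m e
      using top[OF that] bdry[of e h1 m] that by (simp add: a_def V_O mx_def)
  qed (auto intro!: continuous_intros V_cont simp: V_conj)
  let ?x = "(m,e,h)"
  have three: "k = 0 \<or> k = 1 \<or> k = 2" if "k < 3" for k :: nat using that by auto
  have im: "Im (V k ?x) = 0" if "k < 3" for k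
    using im0 three[OF that] by auto
  have mx0: "max (\<sigma> * Re (V 0 ?x)) (max (\<sigma> * Re (V 1 ?x)) (\<sigma> * Re (V 2 ?x))) = 0"
    using a0 \<sigma> by (auto simp: a_def)
  then have le0: "\<sigma> * Re (V k ?x) \<le> 0" if "k < 3" for k
    using three[OF that] by (auto simp: max_def split: if_splits)
  from mx0 have "\<exists>i<3. \<sigma> * Re (V i ?x) = 0"
    by (auto simp: max_def split: if_splits intro: exI[of _ 0] exI[of _ 1] exI[of _ 2])
  then obtain i where i: "i < 3" "Re (V i ?x) = 0" using \<sigma> by auto
  then have "V i ?x = 0" using im by (simp add: complex_eq_iff)
  then have "W i ?x = 0" by (simp add: V_def)
  from cover[OF i(1) e this] obtain k where k: "k < 3"
    and "(?x \<in> T k \<and> W k ?x \<noteq> 0) \<or> (?x \<in> O' k \<and> Im (W k ?x) \<noteq> 0)" by blast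
  then show False
  proof (elim disjE conjE)
    assume x: "?x \<in> T k" and nz: "W k ?x \<noteq> 0"
    have "V k ?x = of_real (\<sigma> * cmod (W k ?x)) * (cis (\<phi> k ?x) * cis (\<kappa> k ?x))"
      unfolding V_def by (subst \<phi>[OF x]) (simp only: mult.assoc)
    also have "\<dots> = of_real (\<sigma> * cmod (W k ?x)) * cis (clip (\<phi> k ?x))"
      by (simp add: cis_mult \<kappa>(3)[OF x])
    finally have V: "V k ?x = of_real (\<sigma> * cmod (W k ?x)) * cis (clip (\<phi> k ?x))" .
    define t where "t = clip (\<phi> k ?x)"
    have t: "- pi/2 \<le> t" "t \<le> pi/2" using pi_gt_zero unfolding t_def clip_def by linarith+
    have "sin t = 0" using im[OF k] nz \<sigma> by (auto simp: V t_def)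
    \<comment> \<open>This is the purpose of the clipping: the other zeros of the sine, such as
      \<pi>, would reverse the sign of \<open>V k\<close>.\<close>
    have "t = 0"
      using sin_eq_0_pi[of t] t \<open>sin t = 0\<close> pi_gt_zero by linarith
    then have "\<sigma> * Re (V k ?x) = cmod (W k ?x)" using \<sigma> by (auto simp: V t_def)
    then show False using le0[OF k] nz by simp
  next
    assume "?x \<in> O' k" "Im (W k ?x) \<noteq> 0"
    then show False using im[OF k] by (simp add: V_O)
  qed
qed

section \<open>Chords of a Jordan curve\<close>

lemma continuous_2pi_int_constant:
  fixes f :: "'a::topological_space \<Rightarrow> real"
  assumes "connected S" "continuous_on S f" and int: "\<And>x. x \<in> S \<Longrightarrow> cis (f x) = 1"
  obtains k :: int where "\<And>x. x \<in> S \<Longrightarrow> f x = 2 * pi * k"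
proof -
  have ex: "\<exists>n::int. f x = 2 * pi * n" if "x \<in> S" for x
  proof -
    have "cos (f x) = 1" using int[OF that] by (simp add: complex_eq_iff)
    then show ?thesis using cos_one_2pi_int[of "f x"] by (auto simp: mult_ac)
  qed
  have "f constant_on S"
  proof (rule continuous_discrete_range_constant[OF assms(1,2)])
    fix x assume x: "x \<in> S"
    have "2 * pi \<le> norm (f y - f x)" if y: "y \<in> S \<and> f y \<noteq> f x" for y
    proof -
      obtain n m :: int where nm: "f x = 2 * pi * n" "f y = 2 * pi * m" using ex x y by metis
      then have "n \<noteq> m" using y by auto
      then have "1 \<le> \<bar>real_of_int m - real_of_int n\<bar>" by linarith
      then have "2 * pi * 1 \<le> 2 * pi * \<bar>real_of_int m - real_of_int n\<bar>" by (intro mult_left_mono) auto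
      also have "\<dots> = norm (f y - f x)"
        unfolding nm real_norm_def right_diff_distrib[symmetric] abs_mult by simp
      finally show ?thesis by simp
    qed
    then show "\<exists>e>0. \<forall>y. y \<in> S \<and> f y \<noteq> f x \<longrightarrow> e \<le> norm (f y - f x)"
      by (intro exI[of _ "2 * pi"]) auto
  qed
  then obtain v where "\<forall>x\<in>S. f x = v" unfolding constant_on_def by blast
  then show ?thesis using ex that by (cases "S = {}") (force, metis ex_in_conv)
qed

text \<open>A continuous map from a compact set to a Hausdorff space is closed, hence a quotient map
  onto its image.\<close>

lemma continuous_on_compact_quotient:
  fixes q :: "'a::t2_space \<Rightarrow> 'b::t2_space" and f :: "'b \<Rightarrow> 'c::topological_space"
  assumes K: "compact K" and q: "continuous_on K q" and fq: "continuous_on K (\<lambda>x. f (q x))"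
  shows "continuous_on (q ` K) f"
proof -
  have clo: "closed (q ` K)" by (intro compact_imp_closed compact_continuous_image q K)
  have "closed (f -` B \<inter> q ` K)" if B: "closed B" for B
  proof -
    have "closed ((\<lambda>x. f (q x)) -` B \<inter> K)"
      using fq B compact_imp_closed[OF K] by (simp add: continuous_on_closed_vimage)
    then have "compact ((\<lambda>x. f (q x)) -` B \<inter> K)"
      using closed_Int_compact[OF _ K] by (metis Int_assoc Int_absorb)
    then have "compact (q ` ((\<lambda>x. f (q x)) -` B \<inter> K))"
      by (rule compact_continuous_image[rotated]) (rule continuous_on_subset[OF q], auto)
    moreover have "q ` ((\<lambda>x. f (q x)) -` B \<inter> K) = f -` B \<inter> q ` K" by auto
    ultimately show ?thesis by (simp add: compact_imp_closed)
  qed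
  then show ?thesis using clo by (simp add: continuous_on_closed_vimage)
qed

lemma polar_lift:
  fixes F :: "'a::real_normed_vector \<Rightarrow> complex"
  assumes "convex S" and F: "continuous_on S F" "\<And>x. x \<in> S \<Longrightarrow> F x \<noteq> 0"
  obtains \<theta> where "continuous_on S \<theta>" "\<And>x. x \<in> S \<Longrightarrow> F x = of_real (cmod (F x)) * cis (\<theta> x)"
proof -
  have "contractible S" using assms(1) by (rule convex_imp_contractible)
  then obtain g where g: "continuous_on S g" "\<And>x. x \<in> S \<Longrightarrow> F x = exp (g x)"
    using continuous_logarithm_on_contractible[OF F(1) _ F(2)] by blast
  show ?thesis
  proof
    show "continuous_on S (\<lambda>x. Im (g x))" by (intro continuous_intros g)
    show "F x = of_real (cmod (F x)) * cis (Im (g x))" if "x \<in> S" for x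
      using g(2)[OF that] exp_eq_polar[of "g x"] by (simp add: norm_mult)
  qed
qed

text \<open>Parameters on the line modulo 1, rather than on the circle, give the chords the convex
  strip \<open>s < t < s + 1\<close> as covering space, where arguments lift.\<close>

locale jordan_loop =
  fixes c :: "real \<Rightarrow> complex"
  assumes c_cont: "continuous_on UNIV c"
    and c_per: "c (t + 1) = c t"
    and c_inj: "c s = c t \<Longrightarrow> s - t \<in> \<int>"
begin

definition "\<Gamma> = range c"

lemma c_per_int: "c (t + of_int k) = c t"
proof (induction k rule: int_induct[where k=0])
  case (step1 i) then show ?case using c_per[of "t + of_int i"] by (simp add: add.assoc)
next
  case (step2 i) then show ?case using c_per[of "t + of_int (i - 1)"] by (simp add: add.assoc)
qed simp

lemma c_in [simp]: "c t \<in> \<Gamma>" by (simp add: \<Gamma>_def)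

lemma \<Gamma>_eq: "\<Gamma> = c ` {0..1}"
proof
  have "c t \<in> c ` {0..1}" for t
  proof (rule image_eqI)
    show "c t = c (frac t)" using c_per_int[of t "- \<lfloor>t\<rfloor>"] by (simp add: frac_def)
    show "frac t \<in> {0..1}" using frac_lt_1[of t] by simp
  qed
  then show "\<Gamma> \<subseteq> c ` {0..1}" by (auto simp: \<Gamma>_def)
qed (auto simp: \<Gamma>_def)

lemma compact_\<Gamma>: "compact \<Gamma>"
  unfolding \<Gamma>_eq by (intro compact_continuous_image continuous_on_subset[OF c_cont]) auto

lemma c_neq: "s < t \<Longrightarrow> t < s + 1 \<Longrightarrow> c s \<noteq> c t"
proof
  assume "s < t" "t < s + 1" "c s = c t"
  then obtain k where "t - s = of_int k" using c_inj[of t s] by (metis Ints_cases)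
  with \<open>s < t\<close> \<open>t < s + 1\<close> have "0 < k" "k < 1" by linarith+
  then show False by simp
qed

lemma simple_path_c: "simple_path c" and path_image_c: "path_image c = \<Gamma>"
  and c_closed: "pathfinish c = pathstart c"
proof -
  have "False" if "x \<in> {0..1}" "y \<in> {0..1}" "c x = c y" "x < y" "\<not> (x = 0 \<and> y = 1)" for x y
    using c_neq[of x y] that by auto
  then show "simple_path c"
    unfolding simple_path_def loop_free_def path_def
    using continuous_on_subset[OF c_cont] by (metis linorder_neqE subset_UNIV)
  show "path_image c = \<Gamma>" by (simp add: path_image_def \<Gamma>_eq)
  show "pathfinish c = pathstart c" using c_per[of 0] by (simp add: pathfinish_def pathstart_def)
qed

abbreviation "Ins \<equiv> inside \<Gamma>"
abbreviation "Out \<equiv> outside \<Gamma>"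

lemma jordan:
  "Ins \<noteq> {}" "open Ins" "connected Ins" "Out \<noteq> {}" "open Out" "connected Out" "bounded Ins"
  "Ins \<inter> Out = {}" "Ins \<union> Out = - \<Gamma>" "frontier Ins = \<Gamma>" "frontier Out = \<Gamma>"
  using Jordan_inside_outside[OF simple_path_c c_closed] by (simp_all add: path_image_c)

text \<open>The signed distance to the curve, positive outside. Splitting it into the two unsigned
  distances makes its monotonicity along transversal directions evident.\<close>

definition \<psi> :: "complex \<Rightarrow> real" where "\<psi> z = infdist z Ins - infdist z Out"

lemma \<psi>_cont: "continuous_on S \<psi>"
  unfolding \<psi>_def by (intro continuous_intros)

definition gap :: "complex \<Rightarrow> real \<Rightarrow> complex \<Rightarrow> real" where
  "gap m h e = \<psi> (m + of_real h * e) - \<psi> (m - of_real h * e)"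

lemma gap_cont: "continuous_on UNIV (\<lambda>x. gap (f x) (g x) (k x))"
  if "continuous_on UNIV f" "continuous_on UNIV g" "continuous_on UNIV k"
  unfolding gap_def by (intro continuous_intros continuous_on_compose2[OF \<psi>_cont] that) auto

lemma gap_odd: "gap m h (- e) = - gap m h e"
  by (simp add: gap_def)

lemma closure_sides: "closure Ins = Ins \<union> \<Gamma>" "closure Out = Out \<union> \<Gamma>"
  using jordan by (metis closure_Un_frontier)+

lemma infdist_sides:
  "infdist z Ins = 0 \<longleftrightarrow> z \<in> Ins \<union> \<Gamma>" "infdist z Out = 0 \<longleftrightarrow> z \<in> Out \<union> \<Gamma>"
  using in_closure_iff_infdist_zero[OF jordan(1), of z] in_closure_iff_infdist_zero[OF jordan(4), of z]
  by (simp_all add: closure_sides)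

lemma \<psi>_sign: "\<psi> z > 0 \<longleftrightarrow> z \<in> Out" "\<psi> z < 0 \<longleftrightarrow> z \<in> Ins" "\<psi> z = 0 \<longleftrightarrow> z \<in> \<Gamma>"
proof -
  have "(z \<in> Out \<and> z \<notin> Ins \<and> z \<notin> \<Gamma>) \<or> (z \<in> Ins \<and> z \<notin> Out \<and> z \<notin> \<Gamma>) \<or> (z \<in> \<Gamma> \<and> z \<notin> Ins \<and> z \<notin> Out)"
    using jordan(8,9) by blast
  then show "\<psi> z > 0 \<longleftrightarrow> z \<in> Out" "\<psi> z < 0 \<longleftrightarrow> z \<in> Ins" "\<psi> z = 0 \<longleftrightarrow> z \<in> \<Gamma>"
    using infdist_sides[of z] infdist_nonneg[of z Ins] infdist_nonneg[of z Out]
    by (auto simp: \<psi>_def less_le)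
qed

lemma strip_convex: "convex {(s, t). s < t \<and> t < s + (1::real)}"
proof -
  have "{(s, t). s < t \<and> t < s + (1::real)} = {x. inner (1, -1) x < 0} \<inter> {x. inner (-1, 1) x < 1}"
    by (auto simp: inner_prod_def)
  then show ?thesis by (simp add: convex_Int convex_halfspace_lt)
qed

text \<open>The sign of the rotation angle: whether \<open>F\<close> or \<open>- F\<close> has an odd lifted argument on the space of
  chords. Continuity is only required away from the diagonal because \<open>\<phi>\<close> need not extend to it.\<close>

definition chord_class :: "(complex \<times> complex \<Rightarrow> complex) \<Rightarrow> real \<Rightarrow> bool" where
  "chord_class F \<sigma> \<longleftrightarrow> (\<exists>\<phi>.
     (\<forall>\<rho>>0. continuous_on {(x, y). x \<in> \<Gamma> \<and> y \<in> \<Gamma> \<and> \<rho> \<le> dist x y} \<phi>) \<and>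
     (\<forall>x\<in>\<Gamma>. \<forall>y\<in>\<Gamma>. x \<noteq> y \<longrightarrow> \<phi> (y, x) = - \<phi> (x, y) \<and>
        F (x, y) = of_real (\<sigma> * cmod (F (x, y))) * cis (\<phi> (x, y))))"

text \<open>Shifting \<open>(s, t)\<close> to \<open>(t, s + 1)\<close> swaps the end points of a chord; this is the deck
  transformation of the strip over the space of unordered chords.\<close>

lemma chord_class_exists:
  fixes F :: "complex \<times> complex \<Rightarrow> complex"
  assumes F: "continuous_on UNIV F" and sym: "\<And>x y. F (y, x) = cnj (F (x, y))"
    and nz: "\<And>x y. x \<in> \<Gamma> \<Longrightarrow> y \<in> \<Gamma> \<Longrightarrow> x \<noteq> y \<Longrightarrow> F (x, y) \<noteq> 0"
  shows "chord_class F 1 \<or> chord_class F (- 1)"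
proof -
  define S where "S = {(s, t). s < t \<and> t < s + (1::real)}"
  define q where "q = (\<lambda>(s, t). (c s, c t))"
  have q_cont: "continuous_on X q" for X
    unfolding q_def case_prod_beta' by (intro continuous_intros continuous_on_compose2[OF c_cont]) auto
  have Fq: "continuous_on S (\<lambda>x. F (q x))"
    by (intro continuous_on_compose2[OF F q_cont]) auto
  have Fnz: "F (q x) \<noteq> 0" if "x \<in> S" for x
    using that nz[OF c_in c_in c_neq] by (auto simp: S_def q_def)
  obtain \<theta> where \<theta>: "continuous_on S \<theta>" "\<And>x. x \<in> S \<Longrightarrow> F (q x) = of_real (cmod (F (q x))) * cis (\<theta> x)"
    using polar_lift[OF strip_convex[folded S_def] Fq Fnz] by blast
  define J where "J = (\<lambda>(s::real, t::real). (t, s + 1))"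
  have J_S: "J x \<in> S" if "x \<in> S" for x using that by (auto simp: S_def J_def)
  have J_cont: "continuous_on X J" for X
    unfolding J_def case_prod_beta' by (intro continuous_intros)
  have FJ: "F (q (J x)) = cnj (F (q x))" for x
    by (cases x) (simp only: q_def J_def prod.case c_per, rule sym)
  obtain k :: int where k: "\<And>x. x \<in> S \<Longrightarrow> \<theta> (J x) + \<theta> x = 2 * pi * k"
  proof (rule continuous_2pi_int_constant)
    show "connected S" unfolding S_def by (rule convex_connected[OF strip_convex])
    show "continuous_on S (\<lambda>x. \<theta> (J x) + \<theta> x)"
      by (intro continuous_intros continuous_on_compose2[OF \<theta>(1) J_cont] \<theta>) (auto intro: J_S)
    fix x assume x: "x \<in> S"
    have "of_real (cmod (F (q x))) * cis (\<theta> (J x)) = cnj (of_real (cmod (F (q x))) * cis (\<theta> x))"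
      using \<theta>(2)[OF J_S[OF x]] \<theta>(2)[OF x] by (simp add: FJ)
    then have "cis (\<theta> (J x)) = cnj (cis (\<theta> x))" using Fnz[OF x] by simp
    then have "cis (\<theta> (J x)) = cis (- \<theta> x)" by (simp add: cis_cnj)
    then show "cis (\<theta> (J x) + \<theta> x) = 1" by (simp only: cis_mult[symmetric]) (simp add: cis_mult)
  qed blast
  \<comment> \<open>Subtracting half of the constant sum makes the argument odd under
    \<open>J\<close>, at the cost of the factor \<open>cis (pi * k)\<close>; so the parity of
    \<open>k\<close> is the sign of the class.\<close>
  define \<phi>' where "\<phi>' x = \<theta> x - pi * k" for x
  have \<phi>'J: "\<phi>' (J x) = - \<phi>' x" if "x \<in> S" for x using k[OF that] by (simp add: \<phi>'_def)
  define \<sigma> :: real where "\<sigma> = (if even k then 1 else - 1)"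
  have cis_k: "cis (pi * k) = of_real \<sigma>"
    by (auto simp: \<sigma>_def complex_eq_iff cos_npi_int sin_npi_int)
  have F\<phi>': "F (q x) = of_real (\<sigma> * cmod (F (q x))) * cis (\<phi>' x)" if "x \<in> S" for x
  proof -
    have "cis (\<theta> x) = of_real \<sigma> * cis (\<phi>' x)"
      unfolding cis_k[symmetric] cis_mult by (simp add: \<phi>'_def)
    then show ?thesis using \<theta>(2)[OF that] by (simp only: of_real_mult) (simp only: mult_ac)
  qed
  \<comment> \<open>\<open>J\<close> applied twice is the shift by \<open>(1, 1)\<close>, and such
    shifts are the identifications of the strip over ordered chords; so \<phi>' descends.\<close>
  have shift1: "\<phi>' (s + 1, t + 1) = \<phi>' (s, t)" if "(s, t) \<in> S" for s t
    using \<phi>'J[OF that] \<phi>'J[OF J_S[OF that]] by (simp add: J_def)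
  have shift_nat: "\<phi>' (s + real n, t + real n) = \<phi>' (s, t)" if "(s, t) \<in> S" for s t n
  proof (induction n)
    case (Suc n)
    have "(s + real n, t + real n) \<in> S" using that by (simp add: S_def)
    from shift1[OF this] Suc show ?case by (simp add: algebra_simps)
  qed simp
  have shift: "\<phi>' (s + of_int n, t + of_int n) = \<phi>' (s, t)" if "(s, t) \<in> S" for s t n
  proof (cases "n \<ge> 0")
    case True then show ?thesis using shift_nat[OF that, of "nat n"] by simp
  next
    case False
    have "(s + of_int n, t + of_int n) \<in> S" using that by (simp add: S_def)
    from shift_nat[OF this, of "nat (- n)"] False show ?thesis by simp
  qed
  have well: "\<phi>' x = \<phi>' y" if x: "x \<in> S" and y: "y \<in> S" and xy: "q x = q y" for x y
  proof -
    obtain s t s' t' where st: "x = (s, t)" "y = (s', t')" by (cases x, cases y)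
    obtain m n :: int where "s' - s = m" "t' - t = n"
      using c_inj[of s' s] c_inj[of t' t] xy by (auto simp: st q_def elim!: Ints_cases)
    then have mn: "s' = s + m" "t' = t + n" by auto
    with x y have "n - m < 1" "m - n < 1" by (auto simp: st S_def)
    then have "m = n" by linarith
    then show ?thesis using shift[of s t n] x by (simp add: st mn)
  qed
  define \<phi> where "\<phi> p = \<phi>' (SOME x. x \<in> S \<and> q x = p)" for p
  have \<phi>q: "\<phi> (q x) = \<phi>' x" if "x \<in> S" for x
  proof -
    have "(SOME y. y \<in> S \<and> q y = q x) \<in> S \<and> q (SOME y. y \<in> S \<and> q y = q x) = q x"
      by (rule someI[of _ x]) (simp add: that)
    then show ?thesis unfolding \<phi>_def using well[OF _ that] by blast
  qed
  have onto: "\<exists>s t. s \<in> {0..1} \<and> (s, t) \<in> S \<and> q (s, t) = (x, y)" if xy: "x \<in> \<Gamma>" "y \<in> \<Gamma>" "x \<noteq> y" for x y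
  proof -
    obtain s t where st: "x = c s" "s \<in> {0..1}" "y = c t"
      using xy(1,2) unfolding \<Gamma>_eq by blast
    define t' where "t' = t + of_int (- \<lfloor>t - s\<rfloor>)"
    have y: "y = c t'" unfolding t'_def c_per_int by (rule st)
    have "s \<le> t'" "t' < s + 1" unfolding t'_def by linarith+
    moreover have "s \<noteq> t'" using y st xy(3) by auto
    ultimately show ?thesis using st y by (intro exI[of _ s] exI[of _ t']) (auto simp: S_def q_def)
  qed
  have "chord_class F \<sigma>"
    unfolding chord_class_def
  proof (intro exI[of _ \<phi>] conjI allI impI ballI)
    fix \<rho> :: real assume "\<rho> > 0"
    \<comment> \<open>A compact part of the strip that covers all chords of length at least
      \<rho>.\<close>
    define K where "K = {x. fst x \<in> {0..1} \<and> snd x - fst x \<in> {0..1} \<and> \<rho> \<le> dist (c (fst x)) (c (snd x))}"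
    have KS: "K \<subseteq> S"
    proof
      fix x assume x: "x \<in> K"
      then have "c (fst x) \<noteq> c (snd x)" using \<open>\<rho> > 0\<close> by (auto simp: K_def)
      moreover have "snd x = fst x \<or> snd x = fst x + 1 \<Longrightarrow> c (snd x) = c (fst x)" using c_per by auto
      ultimately have "snd x - fst x \<noteq> 0" "snd x - fst x \<noteq> 1" by (auto simp: algebra_simps)
      then show "x \<in> S" using x by (auto simp: K_def S_def split: prod.splits)
    qed
    have "closed K"
    proof -
      have "closed ({x. fst x \<in> {0..1}} \<inter> {x. snd x - fst x \<in> {0..1}} \<inter> {x. \<rho> \<le> dist (c (fst x)) (c (snd x))})"
        unfolding atLeastAtMost_iff
        by (intro closed_Int closed_Collect_conj closed_Collect_le continuous_intros continuous_on_compose2[OF c_cont]) auto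
      moreover have "\<dots> = K" unfolding K_def by auto
      ultimately show ?thesis by simp
    qed
    moreover have "bounded K"
      by (rule bounded_subset[of "{0..1} \<times> {0..2}"]) (auto simp: K_def bounded_Times)
    ultimately have "compact K" by (simp add: compact_eq_bounded_closed)
    moreover have "continuous_on K (\<lambda>x. \<phi> (q x))"
    proof (rule continuous_on_eq)
      show "continuous_on K \<phi>'"
        unfolding \<phi>'_def by (intro continuous_intros continuous_on_subset[OF \<theta>(1) KS])
    qed (use KS \<phi>q in auto)
    ultimately have "continuous_on (q ` K) \<phi>"
      using continuous_on_compact_quotient q_cont by blast
    moreover have "{(x, y). x \<in> \<Gamma> \<and> y \<in> \<Gamma> \<and> \<rho> \<le> dist x y} \<subseteq> q ` K"
    proof (clarify)
      fix x y assume xy: "x \<in> \<Gamma>" "y \<in> \<Gamma>" "\<rho> \<le> dist x y"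
      then have "x \<noteq> y" using \<open>\<rho> > 0\<close> by auto
      from onto[OF xy(1,2) this] obtain s t where st: "s \<in> {0..1}" "(s, t) \<in> S" "q (s, t) = (x, y)" by blast
      then have "(s, t) \<in> K" using xy(3) by (auto simp: K_def S_def q_def)
      then show "(x, y) \<in> q ` K" using st(3) by (metis image_eqI)
    qed
    ultimately show "continuous_on {(x, y). x \<in> \<Gamma> \<and> y \<in> \<Gamma> \<and> \<rho> \<le> dist x y} \<phi>"
      by (rule continuous_on_subset)
  next
    fix x y assume "x \<in> \<Gamma>" "y \<in> \<Gamma>" "x \<noteq> y"
    then obtain s t where st: "(s, t) \<in> S" "q (s, t) = (x, y)" using onto by blast
    have "q (J (s, t)) = (y, x)" using st by (auto simp: q_def J_def c_per)
    then show "\<phi> (y, x) = - \<phi> (x, y)"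
      using \<phi>q[OF st(1)] \<phi>q[OF J_S[OF st(1)]] \<phi>'J[OF st(1)] st by simp
    show "F (x, y) = of_real (\<sigma> * cmod (F (x, y))) * cis (\<phi> (x, y))"
      using F\<phi>'[OF st(1)] \<phi>q[OF st(1)] st by simp
  qed
  then show ?thesis by (auto simp: \<sigma>_def split: if_splits)
qed

end

lemma unit_orthogonal_unique:
  assumes \<nu>: "\<nu> \<noteq> 0" and e: "cmod e = 1" "cmod e' = 1"
    and o: "Re (cnj \<nu> * e) = 0" "Re (cnj \<nu> * e') = 0"
  shows "e' = e \<or> e' = - e"
proof -
  define s s' where "s = Im (cnj \<nu> * e)" and "s' = Im (cnj \<nu> * e')"
  have s: "cnj \<nu> * e = \<i> * of_real s" and s': "cnj \<nu> * e' = \<i> * of_real s'"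
    unfolding s_def s'_def complex_eq_iff using o by auto
  have "cmod (\<i> * of_real s) = cmod \<nu>" "cmod (\<i> * of_real s') = cmod \<nu>"
    unfolding s[symmetric] s'[symmetric] norm_mult using e by auto
  then have "\<bar>s\<bar> = cmod \<nu>" "\<bar>s'\<bar> = cmod \<nu>" by (simp_all add: norm_mult)
  then have "s' = s \<or> s' = - s" by linarith
  then have "cnj \<nu> * e' = cnj \<nu> * e \<or> cnj \<nu> * e' = cnj \<nu> * (- e)"
    unfolding mult_minus_right s s' by auto
  then show ?thesis using \<nu> by (metis complex_cnj_zero_iff mult_left_cancel)
qed

section \<open>Chords rotated about their midpoints\<close>

context jordan_loop begin

text \<open>The chord with end points \<open>x\<close>, \<open>y\<close> is rotated by \<open>\<eta>\<close> about its midpoint; the value vanishes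
  iff both new end points lie on the curve, that is, iff the two chords are the diagonals of an
  inscribed rectangle.\<close>

definition rot :: "complex \<Rightarrow> complex \<times> complex \<Rightarrow> complex" where
  "rot \<eta> = (\<lambda>(x, y). Complex
     (\<psi> ((x + y) / 2 + \<eta> * ((x - y) / 2)) + \<psi> ((x + y) / 2 - \<eta> * ((x - y) / 2)))
     (\<psi> ((x + y) / 2 + \<eta> * ((x - y) / 2)) - \<psi> ((x + y) / 2 - \<eta> * ((x - y) / 2))))"

lemma rot_cont: "continuous_on UNIV (rot \<eta>)"
  unfolding rot_def case_prod_beta' Complex_eq
  by (intro continuous_intros continuous_on_compose2[OF \<psi>_cont]) auto

lemma rot_swap: "rot \<eta> (y, x) = cnj (rot \<eta> (x, y))"
proof -
  define w where "w = \<eta> * ((x - y) / 2)"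
  have 1: "\<eta> * ((y - x) / 2) = - w" by (simp add: w_def field_simps)
  have 2: "(y + x) / 2 = (x + y) / 2" by (simp add: add.commute)
  show ?thesis unfolding rot_def prod.case 1 2 w_def[symmetric] by (simp add: complex_eq_iff)
qed

lemma rot_minus: "rot (- \<eta>) p = cnj (rot \<eta> p)"
  by (cases p) (simp add: rot_def complex_eq_iff)

text \<open>A further rotation by \<pi> exchanges the new end points and so conjugates
  \<open>rot\<close>; the negated lift serves for the conjugate.\<close>

lemma chord_class_minus:
  assumes "chord_class (rot \<eta>) \<sigma>"
  shows "chord_class (rot (- \<eta>)) \<sigma>"
proof -
  obtain \<phi> where \<phi>: "\<forall>\<rho>>0. continuous_on {(x, y). x \<in> \<Gamma> \<and> y \<in> \<Gamma> \<and> \<rho> \<le> dist x y} \<phi>"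
     "\<forall>x\<in>\<Gamma>. \<forall>y\<in>\<Gamma>. x \<noteq> y \<longrightarrow> \<phi> (y, x) = - \<phi> (x, y) \<and>
        rot \<eta> (x, y) = of_real (\<sigma> * cmod (rot \<eta> (x, y))) * cis (\<phi> (x, y))"
    using assms unfolding chord_class_def by blast
  show ?thesis unfolding chord_class_def
  proof (intro exI[of _ "\<lambda>p. - \<phi> p"] conjI allI impI ballI)
    fix x y assume xy: "x \<in> \<Gamma>" "y \<in> \<Gamma>" "x \<noteq> y"
    have \<phi>xy: "\<phi> (y, x) = - \<phi> (x, y)" "rot \<eta> (x, y) = of_real (\<sigma> * cmod (rot \<eta> (x, y))) * cis (\<phi> (x, y))"
      using \<phi>(2) xy by blast+
    show "- \<phi> (y, x) = - (- \<phi> (x, y))" by (simp only: \<phi>xy(1))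
    have "cnj (rot \<eta> (x, y)) = of_real (\<sigma> * cmod (rot \<eta> (x, y))) * cnj (cis (\<phi> (x, y)))"
      by (subst \<phi>xy(2)) (simp only: complex_cnj_mult complex_cnj_complex_of_real)
    then show "rot (- \<eta>) (x, y) = of_real (\<sigma> * cmod (rot (- \<eta>) (x, y))) * cis (- \<phi> (x, y))"
      unfolding rot_minus complex_mod_cnj cis_cnj .
  qed (use \<phi>(1) in \<open>auto intro: continuous_on_minus\<close>)
qed

end

section \<open>Surfaces of rotated chords\<close>

text \<open>The field \<open>\<nu>\<close> represents the normal direction of the curve. In the collar \<open>U\<close> the difference of
  \<open>\<psi>\<close> across \<open>m\<close> at scale \<open>\<epsilon>\<close> can be deformed into the inner product with \<open>\<nu>\<close> so that it always vanishes
  in a single direction up to sign; far away \<open>\<nu>\<close> is the radial field or its mirror image.\<close>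

locale collared_loop = jordan_loop +
  fixes \<epsilon> :: real and \<nu> N :: "complex \<Rightarrow> complex" and U :: "complex set" and z0 :: complex and R0 :: real
  assumes \<epsilon>: "0 < \<epsilon>" and \<nu>_cont: "continuous_on UNIV \<nu>"
    and N: "(\<forall>m. N m = m - z0) \<or> (\<forall>m. N m = cnj (m - z0))"
    and \<nu>_far: "\<And>m. R0 \<le> cmod (m - z0) \<Longrightarrow> \<nu> m = N m"
    and U_\<Gamma>: "\<Gamma> \<subseteq> U"
    and U_transversal: "\<And>m e e' t. m \<in> U \<Longrightarrow> cmod e = 1 \<Longrightarrow> cmod e' = 1 \<Longrightarrow> 0 \<le> t \<Longrightarrow> t \<le> 1 \<Longrightarrow>
        (1 - t) * gap m \<epsilon> e + t * Re (cnj (\<nu> m) * e) = 0 \<Longrightarrow>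
        (1 - t) * gap m \<epsilon> e' + t * Re (cnj (\<nu> m) * e') = 0 \<Longrightarrow>
        e' = e \<or> e' = - e"
    and U_Ins: "\<And>m e. m \<in> Ins \<Longrightarrow> m \<notin> U \<Longrightarrow> cmod e = 1 \<Longrightarrow> \<psi> (m + of_real \<epsilon> * e) < 0"
    and U_Out: "\<And>m e. m \<in> Out \<Longrightarrow> m \<notin> U \<Longrightarrow> cmod e = 1 \<Longrightarrow> 0 < \<psi> (m + of_real \<epsilon> * e)"
    and \<nu>_Out: "\<And>m. m \<in> Out \<Longrightarrow> \<nu> m \<noteq> 0"
begin

definition "\<rho> = (SOME r. 0 < r \<and> \<Gamma> \<subseteq> ball z0 r \<and> Ins \<subseteq> ball z0 r)"

lemma \<rho>: "0 < \<rho>" "\<Gamma> \<subseteq> ball z0 \<rho>" "Ins \<subseteq> ball z0 \<rho>"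
proof -
  have "bounded (\<Gamma> \<union> Ins)" using compact_imp_bounded[OF compact_\<Gamma>] jordan(7) by simp
  then obtain r where "0 < r" "\<Gamma> \<union> Ins \<subseteq> ball z0 r" using bounded_subset_ballD by blast
  then have "\<exists>r. 0 < r \<and> \<Gamma> \<subseteq> ball z0 r \<and> Ins \<subseteq> ball z0 r" by blast
  from someI_ex[OF this] show "0 < \<rho>" "\<Gamma> \<subseteq> ball z0 \<rho>" "Ins \<subseteq> ball z0 \<rho>"
    unfolding \<rho>_def by blast+
qed

text \<open>From \<open>4 * \<rho>\<close> on the distance to the inside is at least
  \<open>3 * \<rho>\<close>, so \<psi> exceeds \<open>2 * \<rho>\<close>, while everywhere it is
  above \<open>- (2 * \<rho>)\<close>.\<close>

definition "R = max R0 (4 * \<rho>)"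

lemma \<psi>_lower: "- (2 * \<rho>) < \<psi> w"
proof (cases "w \<in> Ins")
  case True
  have "infdist w Out \<le> infdist (c 0) Out + dist w (c 0)" by (rule infdist_triangle)
  also have "infdist (c 0) Out = 0" by (simp add: infdist_sides)
  also have "dist w (c 0) < \<rho> + \<rho>"
    using subsetD[OF \<rho>(2) c_in[of 0]] subsetD[OF \<rho>(3) True] dist_triangle[of w "c 0" z0]
    by (simp add: dist_commute)
  finally show ?thesis unfolding \<psi>_def using infdist_nonneg[of w Ins] by simp
next
  case False
  then show ?thesis using \<psi>_sign(2)[of w] \<rho>(1) by linarith
qed

lemma \<psi>_upper: "\<psi> w \<le> cmod (w - z0) + \<rho>"
proof -
  obtain i where i: "i \<in> Ins" using jordan(1) by blast
  have "\<psi> w \<le> infdist w Ins" unfolding \<psi>_def using infdist_nonneg[of w Out] by simp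
  also have "\<dots> \<le> dist w i" using i by (rule infdist_le)
  also have "\<dots> \<le> dist w z0 + dist z0 i" by (rule dist_triangle)
  also have "\<dots> \<le> cmod (w - z0) + \<rho>" using \<rho>(3) i by (force simp: dist_norm)
  finally show ?thesis .
qed

lemma \<psi>_far: "2 * \<rho> < \<psi> w" if "R \<le> cmod (w - z0)"
proof -
  have far: "4 * \<rho> \<le> cmod (w - z0)" using that by (simp add: R_def)
  have "w \<notin> Ins \<union> \<Gamma>" using \<rho> far by (force simp: dist_norm norm_minus_commute)
  then have "infdist w Out = 0" using jordan(9) infdist_sides(2) by blast
  moreover have "3 * \<rho> \<le> infdist w Ins"
    unfolding infdist_notempty[OF jordan(1)]
  proof (rule cINF_greatest[OF jordan(1)])
    fix i assume "i \<in> Ins"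
    then have "dist z0 i < \<rho>" using \<rho>(3) by auto
    then show "3 * \<rho> \<le> dist w i"
      using far dist_triangle[of w z0 i] by (simp add: dist_norm norm_minus_commute)
  qed
  ultimately show ?thesis using \<rho>(1) by (simp add: \<psi>_def)
qed

text \<open>For \<open>h \<ge> \<epsilon>\<close> and \<open>m\<close> near the curve, \<open>VA\<close> and \<open>VB\<close> are the sum and the difference of \<open>\<psi>\<close> at the
  end points of the chord with midpoint \<open>m\<close>, direction \<open>e\<close> and half-length \<open>h\<close>. For smaller \<open>h\<close> the
  difference is deformed into the inner product with \<open>\<nu>\<close>, and negative \<open>h\<close> lowers the sum.\<close>

definition "blend m h = max (max 0 (min 1 ((\<epsilon> - h) / \<epsilon>))) (max 0 (min 1 (cmod (m - z0) - R)))"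

definition VA :: "complex \<times> complex \<times> real \<Rightarrow> real" where
  "VA = (\<lambda>(m, e, h). \<psi> (m + of_real (max h \<epsilon>) * e) + \<psi> (m - of_real (max h \<epsilon>) * e) + min h 0)"

definition VB :: "complex \<times> complex \<times> real \<Rightarrow> real" where
  "VB = (\<lambda>(m, e, h). (1 - blend m h) * gap m (max h \<epsilon>) e + blend m h * Re (cnj (\<nu> m) * e))"

lemma VA_cont: "continuous_on UNIV VA" and VB_cont: "continuous_on UNIV VB"
  unfolding VA_def VB_def gap_def blend_def case_prod_beta'
  by (intro continuous_intros continuous_on_compose2[OF \<psi>_cont] continuous_on_compose2[OF \<nu>_cont]; use \<epsilon> in force)+

lemma VA_even: "VA (m, - e, h) = VA (m, e, h)" and VB_odd: "VB (m, - e, h) = - VB (m, e, h)"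
  by (simp_all add: VA_def VB_def gap_def algebra_simps)

lemma blend: "0 \<le> blend m h" "blend m h \<le> 1"
  by (auto simp: blend_def)

text \<open>If the midpoint is far from \<open>z0\<close> or the chord is long, one end point is at
  distance at least \<open>R\<close>, and its value of \<psi> outweighs that of the other.\<close>

lemma VA_pos: "0 < VA (m, e, h)" if "cmod e = 1" "0 \<le> h" and far: "R \<le> cmod (m - z0) \<or> R \<le> h"
proof -
  define w where "w = of_real (max h \<epsilon>) * e"
  have nw: "h \<le> cmod w" using that by (simp add: w_def norm_mult)
  have "2 * cmod (m - z0) = cmod ((m + w - z0) + (m - w - z0))"
    by (simp add: norm_mult[of 2, symmetric, simplified] algebra_simps)
  also have "\<dots> \<le> cmod (m + w - z0) + cmod (m - w - z0)" by (rule norm_triangle_ineq)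
  finally have 1: "2 * cmod (m - z0) \<le> cmod (m + w - z0) + cmod (m - w - z0)" .
  have "2 * cmod w = cmod ((m + w - z0) - (m - w - z0))"
    by (simp add: norm_mult[of 2, symmetric, simplified] algebra_simps)
  also have "\<dots> \<le> cmod (m + w - z0) + cmod (m - w - z0)" by (rule norm_triangle_ineq4)
  finally have "2 * cmod w \<le> cmod (m + w - z0) + cmod (m - w - z0)" .
  with 1 far nw have "R \<le> cmod (m + w - z0) \<or> R \<le> cmod (m - w - z0)" by linarith
  then have "0 < \<psi> (m + w) + \<psi> (m - w)"
    using \<psi>_far[of "m + w"] \<psi>_far[of "m - w"] \<psi>_lower[of "m + w"] \<psi>_lower[of "m - w"] by linarith
  then show ?thesis using that(2) by (simp add: VA_def w_def)
qed

text \<open>Positivity of \<open>VA\<close> keeps the zeros away from the region where the far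
  deformation of \<open>VB\<close> acts, so from height \<epsilon> on they are genuine
  chords.\<close>

lemma V_high:
  assumes e: "cmod e = 1" and h: "\<epsilon> \<le> h" and V: "VA (m, e, h) = 0" "VB (m, e, h) = 0"
  shows "cmod (m - z0) < R" "h < R" "m + of_real h * e \<in> \<Gamma>" "m - of_real h * e \<in> \<Gamma>"
proof -
  show R: "cmod (m - z0) < R" "h < R" using VA_pos[of e h m] assms \<epsilon> by force+
  have "(\<epsilon> - h) / \<epsilon> \<le> 0" using h \<epsilon> by (simp add: divide_le_0_iff)
  then have "blend m h = 0" using R(1) by (simp add: blend_def)
  then have "\<psi> (m + of_real h * e) = 0" "\<psi> (m - of_real h * e) = 0"
    using V h \<epsilon> by (simp_all add: VA_def VB_def gap_def max_def)
  then show "m + of_real h * e \<in> \<Gamma>" "m - of_real h * e \<in> \<Gamma>" by (simp_all add: \<psi>_sign)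
qed

text \<open>Passing from direction \<open>e * \<omega>\<close> to \<open>e * \<omega>'\<close>
  rotates a chord by \<open>\<omega>' * cnj \<omega>\<close>; so one surface function, evaluated on
  the chords of another, is a value of \<open>rot\<close>.\<close>

lemma V_high_rot:
  assumes "\<epsilon> \<le> h" and "cmod (m - z0) < R" and \<omega>: "cmod \<omega> = 1"
  shows "Complex (VA (m, e * \<omega>', h)) (VB (m, e * \<omega>', h)) =
    rot (\<omega>' * cnj \<omega>) (m + of_real h * (e * \<omega>), m - of_real h * (e * \<omega>))"
proof -
  have "(\<epsilon> - h) / \<epsilon> \<le> 0" using assms(1) \<epsilon> by (simp add: divide_le_0_iff)
  then have b: "blend m h = 0" using assms(2) by (simp add: blend_def)
  have "\<omega>' * cnj \<omega> * (of_real h * (e * \<omega>)) = of_real h * (e * \<omega>') * (\<omega> * cnj \<omega>)" by (simp add: mult_ac)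
  also have "\<omega> * cnj \<omega> = 1" using \<omega> complex_norm_square[of \<omega>] by simp
  finally have 1: "\<omega>' * cnj \<omega> * (of_real h * (e * \<omega>)) = of_real h * (e * \<omega>')" by simp
  have 2: "((m + w) + (m - w)) / 2 = m" "((m + w) - (m - w)) / 2 = w" for w :: complex by (simp_all add: field_simps)
  show ?thesis using assms(1) \<epsilon> unfolding rot_def prod.case 2 1
    by (simp add: VA_def VB_def gap_def b max_def)
qed

text \<open>In the collar this is transversality, with the blend as deformation parameter. Beyond it
  both end points at scale \<epsilon> lie on the side of \<open>m\<close>: inside, \<open>VA\<close>
  is negative; outside, it can vanish only for \<open>h < 0\<close>, when the blend is complete and
  \<open>VB\<close> is the inner product with a nonzero vector.\<close>

lemma V_low:
  assumes e: "cmod e = 1" "cmod e' = 1" "e' \<noteq> e" "e' \<noteq> - e" and h: "h \<le> \<epsilon>"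
    and V: "VA (m, e, h) = 0" "VB (m, e, h) = 0"
  shows "VB (m, e', h) \<noteq> 0"
proof
  assume V': "VB (m, e', h) = 0"
  have mx: "max h \<epsilon> = \<epsilon>" using h by simp
  show False
  proof (cases "m \<in> U")
    case True
    show False
      using U_transversal[OF True e(1,2) blend[of m h]] V(2) V' e(3,4) by (simp add: VB_def mx)
  next
    case False
    then have "m \<notin> \<Gamma>" using U_\<Gamma> by blast
    then consider "m \<in> Ins" | "m \<in> Out" using jordan(9) by blast
    then show False
    proof cases
      case 1
      have "\<psi> (m + of_real \<epsilon> * e) < 0" "\<psi> (m + of_real \<epsilon> * (- e)) < 0"
        using U_Ins[OF 1 False, of e] U_Ins[OF 1 False, of "- e"] e by simp_all
      then show False using V(1) by (simp add: VA_def mx)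
    next
      case 2
      have "0 < \<psi> (m + of_real \<epsilon> * e)" "0 < \<psi> (m + of_real \<epsilon> * (- e))"
        using U_Out[OF 2 False, of e] U_Out[OF 2 False, of "- e"] e by simp_all
      then have "h < 0" using V(1) by (simp add: VA_def mx min_def split: if_splits)
      then have "1 \<le> (\<epsilon> - h) / \<epsilon>" using \<epsilon> by (simp add: field_simps)
      then have "blend m h = 1" by (simp add: blend_def)
      then have "Re (cnj (\<nu> m) * e) = 0" "Re (cnj (\<nu> m) * e') = 0" using V(2) V' by (simp_all add: VB_def)
      from unit_orthogonal_unique[OF \<nu>_Out[OF 2] e(1,2) this] e(3,4) show False by blast
    qed
  qed
qed

section \<open>The box of midpoints and heights, and the surfaces in it\<close>

definition "M = R + 1"
text \<open>Low enough for \<open>min h 0\<close> to outweigh the sum of two values of \<psi>, each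
  at most \<open>2 * M + \<epsilon> + \<rho>\<close> for midpoints within \<open>2 * M\<close> of
  \<open>z0\<close>.\<close>

definition "hbot = - 2 * (2 * M + \<epsilon> + \<rho>) - 1"
definition "htop = max R \<epsilon> + 1"

lemma heights: "0 < M" "hbot < 0" "\<epsilon> < htop" "hbot < htop" "0 < htop" "R < htop"
  using \<rho>(1) \<epsilon> by (auto simp: hbot_def htop_def M_def R_def max_def)

lemma VB_side: "VB (m, e, h) = Re (cnj (N m) * e)" if "M \<le> cmod (m - z0)"
proof -
  have "1 \<le> cmod (m - z0) - R" using that by (simp add: M_def)
  then have "blend m h = 1" by (simp add: blend_def)
  moreover have "\<nu> m = N m" using \<nu>_far[of m] that by (simp add: M_def R_def)
  ultimately show ?thesis by (simp add: VB_def)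
qed

lemma VA_bot: "VA (m, e, hbot) < 0" if e: "cmod e = 1" and m: "cmod (m - z0) \<le> 2 * M"
proof -
  have mx: "max hbot \<epsilon> = \<epsilon>" using heights(2) \<epsilon> by simp
  have "cmod (m + of_real \<epsilon> * e' - z0) \<le> 2 * M + \<epsilon>" if "cmod e' = 1" for e'
    using norm_triangle_ineq[of "m - z0" "of_real \<epsilon> * e'"] m that \<epsilon> by (simp add: norm_mult algebra_simps)
  from this[of e] this[of "- e"] \<psi>_upper[of "m + of_real \<epsilon> * e"] \<psi>_upper[of "m - of_real \<epsilon> * e"] e
  have "\<psi> (m + of_real \<epsilon> * e) + \<psi> (m - of_real \<epsilon> * e) \<le> 2 * (2 * M + \<epsilon> + \<rho>)" by simp
  moreover have "min hbot 0 = hbot" using heights(2) by simp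
  ultimately show ?thesis unfolding VA_def prod.case mx by (simp add: hbot_def)
qed

lemma VA_top: "0 < VA (m, e, htop)" if "cmod e = 1"
  using VA_pos[OF that, of htop m] heights by simp

definition "surf \<omega> = (\<lambda>(m, e, h). Complex (VA (m, e * \<omega>, h)) (VB (m, e * \<omega>, h)))"

lemma surf_cont: "continuous_on UNIV (surf \<omega>)"
  unfolding surf_def case_prod_beta' Complex_eq
  by (intro continuous_intros continuous_on_compose2[OF VA_cont] continuous_on_compose2[OF VB_cont]) auto

lemma surf_conj: "surf \<omega> (m, - e, h) = cnj (surf \<omega> (m, e, h))"
  by (simp add: surf_def complex_eq_iff VA_even VB_odd)

text \<open>A surface is cut at half-length \<epsilon>: \<open>high\<close> consists of chords of
  the curve, on which the sign classes act, while \<open>low\<close> belongs to the deformed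
  functions.\<close>

definition "high \<omega> = {(m, e, h). cmod e = 1 \<and> \<epsilon> \<le> h \<and> surf \<omega> (m, e, h) = 0}"
definition "low \<omega> = {(m, e, h). cmod e = 1 \<and> h \<le> \<epsilon> \<and> surf \<omega> (m, e, h) = 0}"
definition "rim = {(m, e::complex, h). h = hbot \<or> h = htop \<or> M \<le> cmod (m - z0)}"

lemma closed_high: "closed (high \<omega>)" and closed_low: "closed (low \<omega>)" and closed_rim: "closed rim"
proof -
  have "high \<omega> = {x. cmod (fst (snd x)) = 1} \<inter> {x. \<epsilon> \<le> snd (snd x)} \<inter> {x. surf \<omega> x = 0}"
    by (auto simp: high_def)
  also have "closed \<dots>"
    by (intro closed_Int closed_Collect_eq closed_Collect_le continuous_intros surf_cont)
  finally show "closed (high \<omega>)" .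
  have "low \<omega> = {x. cmod (fst (snd x)) = 1} \<inter> {x. snd (snd x) \<le> \<epsilon>} \<inter> {x. surf \<omega> x = 0}"
    by (auto simp: low_def)
  also have "closed \<dots>"
    by (intro closed_Int closed_Collect_eq closed_Collect_le continuous_intros surf_cont)
  finally show "closed (low \<omega>)" .
  have "rim = {x. snd (snd x) = hbot} \<union> {x. snd (snd x) = htop} \<union> {x. M \<le> cmod (fst x - z0)}"
    by (auto simp: rim_def)
  also have "closed \<dots>"
    by (intro closed_Un closed_Collect_eq closed_Collect_le continuous_intros)
  finally show "closed rim" .
qed

lemma high_rim: "cmod \<omega> = 1 \<Longrightarrow> high \<omega> \<inter> rim = {}"
proof -
  assume \<omega>: "cmod \<omega> = 1"
  have False if "(m, e, h) \<in> high \<omega>" "(m, e, h) \<in> rim" for m e h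
  proof -
    have e: "cmod (e * \<omega>) = 1" "\<epsilon> \<le> h" "VA (m, e * \<omega>, h) = 0" "VB (m, e * \<omega>, h) = 0"
      using that(1) \<omega> by (auto simp: high_def surf_def norm_mult complex_eq_iff)
    from V_high(1,2)[OF this] that(2) e(2) \<epsilon> heights show False by (auto simp: rim_def M_def)
  qed
  then show ?thesis by auto
qed

text \<open>The chords on \<open>high\<close> have length at least \<open>2 * \<epsilon>\<close>, so
  the lift given by the class is continuous along them and can be pulled back.\<close>

lemma high_class:
  assumes \<omega>: "cmod \<omega> = 1" "cmod \<omega>' = 1" and nz: "\<And>x y. x \<in> \<Gamma> \<Longrightarrow> y \<in> \<Gamma> \<Longrightarrow> x \<noteq> y \<Longrightarrow> rot (\<omega>' * cnj \<omega>) (x, y) \<noteq> 0"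
    and cl: "chord_class (rot (\<omega>' * cnj \<omega>)) \<sigma>"
  obtains \<phi> where "continuous_on (high \<omega>) \<phi>"
    "\<And>m e h. (m, e, h) \<in> high \<omega> \<Longrightarrow> \<phi> (m, - e, h) = - \<phi> (m, e, h)"
    "\<And>x. x \<in> high \<omega> \<Longrightarrow> surf \<omega>' x = of_real (\<sigma> * cmod (surf \<omega>' x)) * cis (\<phi> x)"
    "\<And>x. x \<in> high \<omega> \<Longrightarrow> surf \<omega>' x \<noteq> 0"
proof -
  obtain \<phi> where \<phi>: "\<forall>\<rho>>0. continuous_on {(x, y). x \<in> \<Gamma> \<and> y \<in> \<Gamma> \<and> \<rho> \<le> dist x y} \<phi>"
     "\<forall>x\<in>\<Gamma>. \<forall>y\<in>\<Gamma>. x \<noteq> y \<longrightarrow> \<phi> (y, x) = - \<phi> (x, y) \<and>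
        rot (\<omega>' * cnj \<omega>) (x, y) = of_real (\<sigma> * cmod (rot (\<omega>' * cnj \<omega>) (x, y))) * cis (\<phi> (x, y))"
    using cl unfolding chord_class_def by blast
  have \<phi>2: "\<phi> (snd p, fst p) = - \<phi> p" "rot (\<omega>' * cnj \<omega>) p = of_real (\<sigma> * cmod (rot (\<omega>' * cnj \<omega>) p)) * cis (\<phi> p)"
    if "fst p \<in> \<Gamma> \<and> snd p \<in> \<Gamma> \<and> fst p \<noteq> snd p" for p
    using \<phi>(2)[rule_format, of "fst p" "snd p"] that unfolding prod.collapse by blast+
  define q where "q = (\<lambda>(m, e, h). (m + of_real h * (e * \<omega>), m - of_real h * (e * \<omega>)))"
  have q: "q (m, e, h) \<in> {(x, y). x \<in> \<Gamma> \<and> y \<in> \<Gamma> \<and> 2 * \<epsilon> \<le> dist x y}"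
    "surf \<omega>' (m, e, h) = rot (\<omega>' * cnj \<omega>) (q (m, e, h))" if "(m, e, h) \<in> high \<omega>" for m e h
  proof -
    have e: "cmod (e * \<omega>) = 1" "\<epsilon> \<le> h" "VA (m, e * \<omega>, h) = 0" "VB (m, e * \<omega>, h) = 0"
      using that \<omega> by (auto simp: high_def surf_def norm_mult complex_eq_iff)
    note V = V_high[OF e]
    have "dist (m + of_real h * (e * \<omega>)) (m - of_real h * (e * \<omega>)) = cmod (of_real (2 * h) * (e * \<omega>))"
      by (simp add: dist_norm algebra_simps)
    also have "\<dots> = 2 * h" using e \<epsilon> by (simp only: norm_mult) simp
    finally show "q (m, e, h) \<in> {(x, y). x \<in> \<Gamma> \<and> y \<in> \<Gamma> \<and> 2 * \<epsilon> \<le> dist x y}"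
      using V(3,4) e(2) by (simp add: q_def)
    show "surf \<omega>' (m, e, h) = rot (\<omega>' * cnj \<omega>) (q (m, e, h))"
      using V_high_rot[OF e(2) V(1) \<omega>(1)] by (simp add: surf_def q_def)
  qed
  have dist: "fst (q x) \<in> \<Gamma> \<and> snd (q x) \<in> \<Gamma> \<and> fst (q x) \<noteq> snd (q x)" if "x \<in> high \<omega>" for x
    using q(1)[of "fst x" "fst (snd x)" "snd (snd x)"] that \<epsilon> by (auto simp: case_prod_beta)
  show ?thesis
  proof
    show "continuous_on (high \<omega>) (\<lambda>x. \<phi> (q x))"
    proof (rule continuous_on_compose2[of "{(x, y). x \<in> \<Gamma> \<and> y \<in> \<Gamma> \<and> 2 * \<epsilon> \<le> dist x y}" \<phi>])
      show "continuous_on {(x, y). x \<in> \<Gamma> \<and> y \<in> \<Gamma> \<and> 2 * \<epsilon> \<le> dist x y} \<phi>" using \<phi>(1) \<epsilon> by simp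
      show "continuous_on (high \<omega>) q" unfolding q_def case_prod_beta' by (intro continuous_intros)
      show "q ` high \<omega> \<subseteq> {(x, y). x \<in> \<Gamma> \<and> y \<in> \<Gamma> \<and> 2 * \<epsilon> \<le> dist x y}"
      proof (intro image_subsetI)
        fix x assume "x \<in> high \<omega>"
        then show "q x \<in> {(x, y). x \<in> \<Gamma> \<and> y \<in> \<Gamma> \<and> 2 * \<epsilon> \<le> dist x y}"
          by (cases x) (simp only: q(1))
      qed
    qed
    show "\<phi> (q (m, - e, h)) = - \<phi> (q (m, e, h))" if "(m, e, h) \<in> high \<omega>" for m e h
    proof -
      have "q (m, - e, h) = (snd (q (m, e, h)), fst (q (m, e, h)))" by (simp add: q_def)
      then show ?thesis by (simp only: \<phi>2(1)[OF dist[OF that]])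
    qed
    fix x assume x: "x \<in> high \<omega>"
    have s: "surf \<omega>' x = rot (\<omega>' * cnj \<omega>) (q x)" using q(2) x by (cases x) auto
    show "surf \<omega>' x = of_real (\<sigma> * cmod (surf \<omega>' x)) * cis (\<phi> (q x))"
      unfolding s by (rule \<phi>2(2)[OF dist[OF x]])
    show "surf \<omega>' x \<noteq> 0" unfolding s using nz[of "fst (q x)" "snd (q x)"] dist[OF x] by simp
  qed
qed

end

lemma unit_real: "cmod \<eta> = 1 \<Longrightarrow> Im \<eta> = 0 \<Longrightarrow> \<eta> = 1 \<or> \<eta> = - 1"
  by (auto simp: cmod_def complex_eq_iff)

context collared_loop begin

lemma surf_low:
  assumes "cmod \<omega> = 1" "cmod \<omega>' = 1" "\<omega>' \<noteq> \<omega>" "\<omega>' \<noteq> - \<omega>" and e: "cmod e = 1" "h \<le> \<epsilon>"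
    and 0: "surf \<omega> (m, e, h) = 0"
  shows "Im (surf \<omega>' (m, e, h)) \<noteq> 0"
proof -
  have "e \<noteq> 0" using e by auto
  then have "e * \<omega>' \<noteq> e * \<omega>" "e * \<omega>' \<noteq> - (e * \<omega>)"
    using assms(3,4) by (metis mult_left_cancel, metis mult_left_cancel mult_minus_right)
  moreover have "VA (m, e * \<omega>, h) = 0" "VB (m, e * \<omega>, h) = 0"
    using 0 by (simp_all add: surf_def complex_eq_iff)
  ultimately show ?thesis
    using V_low[of "e * \<omega>" "e * \<omega>'" h m] assms(1,2) e by (simp add: surf_def norm_mult)
qed

lemma surf_bot: "cmod \<omega> = 1 \<Longrightarrow> cmod e = 1 \<Longrightarrow> cmod (m - z0) \<le> 2 * M \<Longrightarrow> Re (surf \<omega> (m, e, hbot)) < 0"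
  using VA_bot[of "e * \<omega>" m] by (simp add: surf_def norm_mult)

lemma surf_top: "cmod \<omega> = 1 \<Longrightarrow> cmod e = 1 \<Longrightarrow> 0 < Re (surf \<omega> (m, e, htop))"
  using VA_top[of "e * \<omega>" m] by (simp add: surf_def norm_mult)

lemma surf_side: "M \<le> cmod (m - z0) \<Longrightarrow> Im (surf \<omega> (m, e, h)) = Re (cnj (N m) * (e * \<omega>))"
  using VB_side[of m "e * \<omega>" h] by (simp add: surf_def)

lemma high_inv: "(m, e, h) \<in> high \<omega> \<Longrightarrow> (m, - e, h) \<in> high \<omega>"
  and low_inv: "(m, e, h) \<in> low \<omega> \<Longrightarrow> (m, - e, h) \<in> low \<omega>"
  and rim_inv: "(m, e, h) \<in> rim \<Longrightarrow> (m, - e, h) \<in> rim"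
  by (auto simp: high_def low_def rim_def surf_conj)

lemma high_low:
  assumes "cmod \<omega> = 1" "cmod \<omega>' = 1" "\<omega>' \<noteq> \<omega>" "\<omega>' \<noteq> - \<omega>"
  shows "high \<omega> \<inter> low \<omega>' = {}"
proof -
  have False if "(m, e, h) \<in> high \<omega>" "(m, e, h) \<in> low \<omega>'" for m e h
    using surf_low[OF assms, of e h m] that by (auto simp: high_def low_def)
  then show ?thesis by auto
qed

text \<open>The phase of \<open>W 0\<close> is known on \<open>high \<eta>\<close> and that of
  \<open>W 1\<close> on \<open>high 1\<close>. Since \<open>low \<eta>\<close> may touch
  \<open>high \<eta>\<close> at half-length \<epsilon>, \<open>W 0\<close> cannot be kept
  unperturbed on it, and likewise for \<open>W 1\<close>; a third direction \<zeta> takes over on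
  short chords.\<close>

lemma no_mutual_class:
  assumes \<eta>: "cmod \<eta> = 1" "\<eta> \<noteq> 1" "\<eta> \<noteq> - 1" and \<sigma>: "\<sigma> = 1 \<or> \<sigma> = - 1"
    and nz: "\<And>x y. x \<in> \<Gamma> \<Longrightarrow> y \<in> \<Gamma> \<Longrightarrow> x \<noteq> y \<Longrightarrow> rot \<eta> (x, y) \<noteq> 0"
      "\<And>x y. x \<in> \<Gamma> \<Longrightarrow> y \<in> \<Gamma> \<Longrightarrow> x \<noteq> y \<Longrightarrow> rot (cnj \<eta>) (x, y) \<noteq> 0"
    and cl: "chord_class (rot \<eta>) \<sigma>" "chord_class (rot (cnj \<eta>)) \<sigma>"
  shows False
proof -
  have "connected (sphere (0::complex) 1)" by (rule connected_sphere) simp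
  moreover have "1 \<in> sphere (0::complex) 1" "- 1 \<in> sphere (0::complex) 1" by simp_all
  ultimately have "infinite (sphere (0::complex) 1)"
    using connected_finite_iff_sing[of "sphere (0::complex) 1"]
    by (metis empty_iff one_neq_neg_one singletonD)
  then obtain \<zeta> where \<zeta>: "\<zeta> \<in> sphere (0::complex) 1" "\<zeta> \<notin> {1, - 1, \<eta>, - \<eta>}"
    by (meson finite.emptyI finite.insertI finite_subset subsetI)
  obtain \<phi>1 where \<phi>1: "continuous_on (high 1) \<phi>1"
    "\<And>m e h. (m, e, h) \<in> high 1 \<Longrightarrow> \<phi>1 (m, - e, h) = - \<phi>1 (m, e, h)"
    "\<And>x. x \<in> high 1 \<Longrightarrow> surf \<eta> x = of_real (\<sigma> * cmod (surf \<eta> x)) * cis (\<phi>1 x)"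
    "\<And>x. x \<in> high 1 \<Longrightarrow> surf \<eta> x \<noteq> 0"
    using high_class[of 1 \<eta> \<sigma>] \<eta> nz(1) cl(1) by auto
  obtain \<phi>0 where \<phi>0: "continuous_on (high \<eta>) \<phi>0"
    "\<And>m e h. (m, e, h) \<in> high \<eta> \<Longrightarrow> \<phi>0 (m, - e, h) = - \<phi>0 (m, e, h)"
    "\<And>x. x \<in> high \<eta> \<Longrightarrow> surf 1 x = of_real (\<sigma> * cmod (surf 1 x)) * cis (\<phi>0 x)"
    "\<And>x. x \<in> high \<eta> \<Longrightarrow> surf 1 x \<noteq> 0"
    using high_class[of \<eta> 1 \<sigma>] \<eta> nz(2) cl(2) by auto
  \<comment> \<open>the third surface is a dummy: its real part never attains the maximum, and its imaginary part
    does not vanish at short chords in the directions \<open>1\<close> and \<open>\<eta>\<close>\<close>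
  define W where "W k x = (if k = (0::nat) then surf 1 x else if k = 1 then surf \<eta> x
    else Complex (- \<sigma>) (Im (surf \<zeta> x)))" for k x
  define T where "T k = (if k = (0::nat) then high \<eta> else if k = 1 then high 1 else {})" for k
  define B where "B k = (if k = (0::nat) then rim else if k = 1 then rim else UNIV)" for k
  define \<phi> where "\<phi> k = (if k = (0::nat) then \<phi>0 else \<phi>1)" for k
  show False
  proof (rule perturbed_surfaces_meet[where W=W and T=T and O'=B and \<phi> = \<phi> and \<sigma> = \<sigma> and N=N and ?z0.0 = z0
        and M=M and ?h0.0 = hbot and ?h1.0 = htop and \<omega> = "\<lambda>k. if k = 0 then 1 else \<eta>"])
    show "continuous_on UNIV (W k)" for k
    proof -
      have "continuous_on UNIV (\<lambda>x. Complex (- \<sigma>) (Im (surf \<zeta> x)))"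
        unfolding Complex_eq by (intro continuous_intros surf_cont)
      then show ?thesis using surf_cont[of 1] surf_cont[of \<eta>]
        unfolding W_def[abs_def] by (cases "k = 0"; cases "k = 1") simp_all
    qed
    show "W k (m, - e, h) = cnj (W k (m, e, h))" for k m e h
      by (simp add: W_def surf_conj complex_eq_iff)
    show "closed (T k)" "closed (B k)" for k by (simp_all add: T_def B_def closed_high closed_rim)
    show "T k \<inter> B k = {}" for k using high_rim[of 1] high_rim[of \<eta>] \<eta> by (simp add: T_def B_def)
    show "(m, - e, h) \<in> T k" if "(m, e, h) \<in> T k" for m e h k
      using that by (auto simp: T_def high_inv split: if_splits)
    show "(m, - e, h) \<in> B k" if "(m, e, h) \<in> B k" for m e h k
      using that by (auto simp: B_def rim_inv split: if_splits)
    show "continuous_on (T k) (\<phi> k)" for k by (simp add: T_def \<phi>_def \<phi>0 \<phi>1)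
    show "\<phi> k (m, - e, h) = - \<phi> k (m, e, h)" if "(m, e, h) \<in> T k" for m e h k
      using that by (auto simp: T_def \<phi>_def \<phi>0 \<phi>1 split: if_splits)
    show "W k x = of_real (\<sigma> * cmod (W k x)) * cis (\<phi> k x)" if xT: "x \<in> T k" for k x
    proof -
      have "k = 0 \<or> k = 1" using xT by (auto simp: T_def split: if_splits)
      then consider "k = 0" | "k = 1" by blast
      then show ?thesis
      proof cases
        case 1 then show ?thesis using \<phi>0(3)[of x] xT unfolding W_def T_def \<phi>_def by (simp only: if_True simp_thms)
      next
        case 2 then show ?thesis using \<phi>1(3)[of x] xT unfolding W_def T_def \<phi>_def by (simp only: if_True if_False one_neq_zero simp_thms)
      qed
    qed
    show "(m, e, h) \<in> B k" if "h = hbot \<or> h = htop \<or> M \<le> cmod (m - z0)" for k m e h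
      using that by (simp add: B_def rim_def)
    show "Im (cnj (if (0::nat) = 0 then 1 else \<eta>) * (if (1::nat) = 0 then 1 else \<eta>)) \<noteq> 0"
      using unit_real[of \<eta>] \<eta> by auto
    show "Im (W k (m, e, h)) = Re (cnj (N m) * (e * (if k = 0 then 1 else \<eta>)))"
      if "k < 2" "M \<le> cmod (m - z0)" for k m e h
      using that surf_side[of m 1 e h] surf_side[of m \<eta> e h] by (auto simp: W_def less_2_cases_iff)
    show "\<sigma> * max (\<sigma> * Re (W 0 (m, e, hbot))) (max (\<sigma> * Re (W 1 (m, e, hbot))) (\<sigma> * Re (W 2 (m, e, hbot)))) \<le> 0"
      if "cmod e = 1" "cmod (m - z0) \<le> 2 * M" for m e
      using surf_bot[of 1 e m] surf_bot[of \<eta> e m] \<sigma> \<eta> that by (auto simp: W_def max_def)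
    show "0 \<le> \<sigma> * max (\<sigma> * Re (W 0 (m, e, htop))) (max (\<sigma> * Re (W 1 (m, e, htop))) (\<sigma> * Re (W 2 (m, e, htop))))"
      if "cmod e = 1" "cmod (m - z0) \<le> 2 * M" for m e
      using surf_top[of 1 e m] surf_top[of \<eta> e m] \<sigma> \<eta> that by (auto simp: W_def max_def)
    show "\<exists>k<3. (m, e, h) \<in> T k \<and> W k (m, e, h) \<noteq> 0 \<or> (m, e, h) \<in> B k \<and> Im (W k (m, e, h)) \<noteq> 0"
      if "i < 3" "cmod e = 1" and W0: "W i (m, e, h) = 0" for i m e h
    proof -
      have i: "i = 0 \<or> i = 1" using W0 \<sigma> by (auto simp: W_def complex_eq_iff split: if_splits)
      show ?thesis
      proof (cases "h \<le> \<epsilon>")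
        case True
        have "Im (surf \<zeta> (m, e, h)) \<noteq> 0"
          using i W0 surf_low[of 1 \<zeta> e h m] surf_low[of \<eta> \<zeta> e h m] \<zeta> \<eta> True that(2) by (auto simp: W_def)
        then show ?thesis by (intro exI[of _ 2]) (simp add: B_def W_def)
      next
        case False
        show ?thesis
        proof (cases "i = 0")
          case True
          then have "(m, e, h) \<in> high 1" using W0 False that(2) by (simp add: high_def W_def)
          then show ?thesis using \<phi>1(4) by (intro exI[of _ 1]) (simp add: T_def W_def)
        next
          case False
          with i have "i = 1" by simp
          then have "(m, e, h) \<in> high \<eta>" using W0 \<open>\<not> h \<le> \<epsilon>\<close> that(2) by (simp add: high_def W_def)
          then show ?thesis using \<phi>0(4) by (intro exI[of _ 0]) (simp add: T_def W_def)
        qed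
      qed
    qed
  qed (use N heights \<sigma> in auto)
qed

text \<open>For the directions \<open>1\<close>, \<open>\<eta>1\<close>,
  \<open>\<eta>1 * \<eta>2\<close> the ratio of each to its cyclic predecessor is one of the three
  rotations of sign \<sigma>. So each function has a known phase on the long chords of its
  predecessor. On the short chords of its successor it stays unperturbed; these two sets are
  disjoint, as their directions are independent.\<close>

lemma no_cyclic_class:
  assumes \<eta>: "cmod \<eta>1 = 1" "cmod \<eta>2 = 1" "\<eta>1 \<notin> {1, - 1}" "\<eta>2 \<notin> {1, - 1}" "\<eta>1 * \<eta>2 \<notin> {1, - 1}"
    and \<sigma>: "\<sigma> = 1 \<or> \<sigma> = - 1"
    and nz: "\<And>x y. x \<in> \<Gamma> \<Longrightarrow> y \<in> \<Gamma> \<Longrightarrow> x \<noteq> y \<Longrightarrow> rot \<eta>1 (x, y) \<noteq> 0"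
      "\<And>x y. x \<in> \<Gamma> \<Longrightarrow> y \<in> \<Gamma> \<Longrightarrow> x \<noteq> y \<Longrightarrow> rot \<eta>2 (x, y) \<noteq> 0"
      "\<And>x y. x \<in> \<Gamma> \<Longrightarrow> y \<in> \<Gamma> \<Longrightarrow> x \<noteq> y \<Longrightarrow> rot (cnj (\<eta>1 * \<eta>2)) (x, y) \<noteq> 0"
    and cl: "chord_class (rot \<eta>1) \<sigma>" "chord_class (rot \<eta>2) \<sigma>" "chord_class (rot (cnj (\<eta>1 * \<eta>2))) \<sigma>"
  shows False
proof -
  define \<omega> where "\<omega> k = (if k = (0::nat) then 1 else if k = 1 then \<eta>1 else \<eta>1 * \<eta>2)" for k
  have \<omega>1: "cmod (\<omega> k) = 1" for k using \<eta> by (simp add: \<omega>_def norm_mult)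
  have [simp]: "\<eta>1 \<noteq> 0" using \<eta>(1) by auto
  \<comment> \<open>Successor and predecessor modulo 3.\<close>
  define nx where "nx k = (if k = (0::nat) then 1 else if k = 1 then 2 else 0 :: nat)" for k
  define pv where "pv k = (if k = (0::nat) then 2 else if k = 1 then 0 else 1 :: nat)" for k
  have three: "k = 0 \<or> k = 1 \<or> k = 2" if "k < 3" for k :: nat using that by auto
  define ap where "ap a b \<longleftrightarrow> a \<noteq> b \<and> a \<noteq> - b" for a b :: complex
  have ap_sym: "ap b a" if "ap a b" for a b
    using that unfolding ap_def by (metis minus_minus)
  have "\<eta>1 * \<eta>2 \<noteq> \<eta>1 * 1" "\<eta>1 * \<eta>2 \<noteq> \<eta>1 * (- 1)"
    unfolding mult_left_cancel[OF \<open>\<eta>1 \<noteq> 0\<close>] using \<eta>(4) by blast+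
  then have ap: "ap \<eta>1 1" "ap (\<eta>1 * \<eta>2) 1" "ap (\<eta>1 * \<eta>2) \<eta>1"
    using \<eta>(3,5) unfolding ap_def by simp_all
  have "ap (\<omega> (nx k)) (\<omega> (pv k))" "ap (\<omega> k) (\<omega> (nx k))" for k
    using ap ap[THEN ap_sym] by (auto simp: \<omega>_def nx_def pv_def)
  then have ne: "\<omega> (nx k) \<noteq> \<omega> (pv k)" "\<omega> (nx k) \<noteq> - \<omega> (pv k)" "\<omega> k \<noteq> \<omega> (nx k)" "\<omega> k \<noteq> - \<omega> (nx k)" for k
    unfolding ap_def by blast+
  have ratio: "\<omega> k * cnj (\<omega> (pv k)) = (if k = 0 then cnj (\<eta>1 * \<eta>2) else if k = 1 then \<eta>1 else \<eta>2)" for k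
    using complex_norm_square[of \<eta>1] \<eta>(1) by (simp add: \<omega>_def pv_def)
  define good where "good k \<phi> \<longleftrightarrow> continuous_on (high (\<omega> (pv k))) \<phi> \<and>
    (\<forall>m e h. (m, e, h) \<in> high (\<omega> (pv k)) \<longrightarrow> \<phi> (m, - e, h) = - \<phi> (m, e, h)) \<and>
    (\<forall>x \<in> high (\<omega> (pv k)). surf (\<omega> k) x = of_real (\<sigma> * cmod (surf (\<omega> k) x)) * cis (\<phi> x)
      \<and> surf (\<omega> k) x \<noteq> 0)" for k \<phi>
  have "\<exists>\<phi>. good k \<phi>" for k
  proof -
    have nz': "rot (\<omega> k * cnj (\<omega> (pv k))) (x, y) \<noteq> 0" if "x \<in> \<Gamma>" "y \<in> \<Gamma>" "x \<noteq> y" for x y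
      using nz[OF that] by (simp add: ratio)
    have "chord_class (rot (\<omega> k * cnj (\<omega> (pv k)))) \<sigma>"
      using cl by (simp add: ratio)
    from high_class[OF \<omega>1 \<omega>1 nz' this] obtain \<phi> where \<phi>: "continuous_on (high (\<omega> (pv k))) \<phi>"
      "\<And>m e h. (m, e, h) \<in> high (\<omega> (pv k)) \<Longrightarrow> \<phi> (m, - e, h) = - \<phi> (m, e, h)"
      "\<And>x. x \<in> high (\<omega> (pv k)) \<Longrightarrow> surf (\<omega> k) x = of_real (\<sigma> * cmod (surf (\<omega> k) x)) * cis (\<phi> x)"
      "\<And>x. x \<in> high (\<omega> (pv k)) \<Longrightarrow> surf (\<omega> k) x \<noteq> 0"
      by blast
    then have "good k \<phi>" unfolding good_def by blast
    then show ?thesis by (rule exI[of _ \<phi>])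
  qed
  then have "\<forall>k. \<exists>\<phi>. good k \<phi>" by simp
  from choice[OF this] obtain \<phi> where "\<forall>k. good k (\<phi> k)" by (rule exE)
  then have good: "\<And>k. good k (\<phi> k)" by (rule spec)
  have \<phi>: "continuous_on (high (\<omega> (pv k))) (\<phi> k)"
    "(m, e, h) \<in> high (\<omega> (pv k)) \<Longrightarrow> \<phi> k (m, - e, h) = - \<phi> k (m, e, h)"
    "x \<in> high (\<omega> (pv k)) \<Longrightarrow> surf (\<omega> k) x = of_real (\<sigma> * cmod (surf (\<omega> k) x)) * cis (\<phi> k x)"
    "x \<in> high (\<omega> (pv k)) \<Longrightarrow> surf (\<omega> k) x \<noteq> 0" for k m e h x
    using good[of k] unfolding good_def by blast+
  show False
  proof (rule perturbed_surfaces_meet[where W="\<lambda>k. surf (\<omega> k)" and T="\<lambda>k. high (\<omega> (pv k))"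
        and O'="\<lambda>k. rim \<union> low (\<omega> (nx k))" and \<phi> = \<phi> and \<sigma> = \<sigma> and N=N and ?z0.0 = z0
        and M=M and ?h0.0 = hbot and ?h1.0 = htop and \<omega> = \<omega>])
    show "closed (high (\<omega> (pv k)))" "closed (rim \<union> low (\<omega> (nx k)))" for k
      by (simp_all add: closed_high closed_rim closed_low closed_Un)
    show "high (\<omega> (pv k)) \<inter> (rim \<union> low (\<omega> (nx k))) = {}" for k
      using high_rim[OF \<omega>1] high_low[OF \<omega>1 \<omega>1 ne(1,2)] by blast
    show "(m, - e, h) \<in> rim \<union> low (\<omega> (nx k))" if "(m, e, h) \<in> rim \<union> low (\<omega> (nx k))" for m e h k
      using that rim_inv low_inv by blast
    show "(m, e, h) \<in> rim \<union> low (\<omega> (nx k))" if "h = hbot \<or> h = htop \<or> M \<le> cmod (m - z0)" for k m e h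
      using that by (simp add: rim_def)
    show "Im (cnj (\<omega> 0) * \<omega> 1) \<noteq> 0"
      using unit_real[of \<eta>1] \<eta> by (auto simp: \<omega>_def)
    show "\<sigma> * max (\<sigma> * Re (surf (\<omega> 0) (m, e, hbot))) (max (\<sigma> * Re (surf (\<omega> 1) (m, e, hbot))) (\<sigma> * Re (surf (\<omega> 2) (m, e, hbot)))) \<le> 0"
      if "cmod e = 1" "cmod (m - z0) \<le> 2 * M" for m e
      using surf_bot[OF \<omega>1 that, of 0] surf_bot[OF \<omega>1 that, of 1] surf_bot[OF \<omega>1 that, of 2] \<sigma>
      by (auto simp: max_def)
    show "0 \<le> \<sigma> * max (\<sigma> * Re (surf (\<omega> 0) (m, e, htop))) (max (\<sigma> * Re (surf (\<omega> 1) (m, e, htop))) (\<sigma> * Re (surf (\<omega> 2) (m, e, htop))))"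
      if "cmod e = 1" "cmod (m - z0) \<le> 2 * M" for m e
      using surf_top[OF \<omega>1 that(1), of 0 m] surf_top[OF \<omega>1 that(1), of 1 m] surf_top[OF \<omega>1 that(1), of 2 m] \<sigma>
      by (auto simp: max_def)
    show "\<exists>k<3. (m, e, h) \<in> high (\<omega> (pv k)) \<and> surf (\<omega> k) (m, e, h) \<noteq> 0 \<or>
        (m, e, h) \<in> rim \<union> low (\<omega> (nx k)) \<and> Im (surf (\<omega> k) (m, e, h)) \<noteq> 0"
      if "i < 3" "cmod e = 1" and W0: "surf (\<omega> i) (m, e, h) = 0" for i m e h
    proof (cases "h \<le> \<epsilon>")
      case True
      have k: "pv i < 3" "nx (pv i) = i" using three[OF that(1)] by (auto simp: nx_def pv_def)
      have "(m, e, h) \<in> low (\<omega> i)" using True that by (simp add: low_def)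
      moreover have "Im (surf (\<omega> (pv i)) (m, e, h)) \<noteq> 0"
        using surf_low[OF \<omega>1 \<omega>1 ne(3,4)[of "pv i"] that(2) True, of m] W0 by (simp add: k)
      ultimately show ?thesis using k by (intro exI[of _ "pv i"]) simp
    next
      case False
      have k: "nx i < 3" "pv (nx i) = i" using three[OF that(1)] by (auto simp: nx_def pv_def)
      have "(m, e, h) \<in> high (\<omega> i)" using False that by (simp add: high_def)
      then show ?thesis using k \<phi>(4)[of _ "nx i"] by (intro exI[of _ "nx i"]) simp
    qed
    next
    show "surf (\<omega> k) x = of_real (\<sigma> * cmod (surf (\<omega> k) x)) * cis (\<phi> k x)" if "x \<in> high (\<omega> (pv k))" for k x
      by (rule \<phi>(3)[OF that])
  qed (use N heights \<sigma> in \<open>simp_all add: \<phi>(1,2) surf_cont surf_conj high_inv surf_side\<close>)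
qed

end

section \<open>Signs on a cyclic group\<close>

text \<open>Diagonals of equal length with a common midpoint span a rectangle, and half the angle
  between them has the ratio of the sides as its tangent.\<close>

lemma rectangle_of_diagonals:
  fixes m d :: complex
  assumes d: "d \<noteq> 0" and \<alpha>: "0 < \<alpha>" "\<alpha> < pi"
    and on: "m + d \<in> G" "m - d \<in> G" "m + cis \<alpha> * d \<in> G" "m - cis \<alpha> * d \<in> G"
  shows "\<exists>a b c d. inscribed_rectangle G a b c d \<and> dist a b / dist b c = tan (\<alpha> / 2)"
proof -
  define \<beta> where "\<beta> = \<alpha> / 2"
  have \<alpha>\<beta>: "\<alpha> = 2 * \<beta>" by (simp add: \<beta>_def)
  \<comment> \<open>The half-angle forms show the side lengths and, through the factor
    \<open>\<i>\<close>, the right angle.\<close>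
  have 1: "cis \<alpha> - 1 = 2 * \<i> * of_real (sin \<beta>) * cis \<beta>" and 2: "cis \<alpha> + 1 = 2 * of_real (cos \<beta>) * cis \<beta>"
    unfolding \<alpha>\<beta> by (simp_all add: complex_eq_iff sin_double cos_double power2_eq_square sin_times_sin[symmetric])
      (use sin_cos_squared_add[of \<beta>] in \<open>simp_all add: power2_eq_square algebra_simps\<close>)
  have s: "0 < sin \<beta>" "0 < cos \<beta>" using \<alpha> by (auto simp: \<beta>_def intro!: sin_gt_zero cos_gt_zero)
  let ?a = "m + d" and ?b = "m + cis \<alpha> * d" and ?c = "m - d" and ?d = "m - cis \<alpha> * d"
  have ba: "?b - ?a = (cis \<alpha> - 1) * d" and da: "?d - ?a = - ((cis \<alpha> + 1) * d)"
    and bc: "?b - ?c = (cis \<alpha> + 1) * d" by (simp_all add: algebra_simps)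
  have "dist ?a ?b = cmod ((cis \<alpha> - 1) * d)"
    unfolding ba[symmetric] by (simp add: dist_norm norm_minus_commute)
  then have n1: "dist ?a ?b = 2 * sin \<beta> * cmod d"
    using s unfolding 1 by (simp add: norm_mult)
  have n2: "dist ?b ?c = 2 * cos \<beta> * cmod d"
    using s unfolding dist_norm bc 2 by (simp add: norm_mult)
  have n3: "?d - ?a = - (?b - ?c)" by (simp add: algebra_simps)
  have "inscribed_rectangle G ?a ?b ?c ?d"
    unfolding inscribed_rectangle_def nondegenerate_rectangle_def
  proof (intro conjI on)
    show "?a \<noteq> ?b" using n1 s d by auto
    have "?b \<noteq> ?c" using n2 s d by auto
    then show "?a \<noteq> ?d" using n3 by (metis eq_iff_diff_eq_0 neg_equal_0_iff_equal)
    show "?c - ?b = ?d - ?a" by (simp add: algebra_simps)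
    define w where "w = cis \<beta> * d"
    have "?b - ?a = \<i> * (of_real (2 * sin \<beta>) * w)" "?d - ?a = of_real (- 2 * cos \<beta>) * w"
      unfolding ba da 1 2 w_def by simp_all
    then show "orthogonal (?b - ?a) (?d - ?a)"
      by (simp only: orthogonal_def) (simp add: inner_complex_def)
  qed
  moreover have "dist ?a ?b / dist ?b ?c = tan (\<alpha> / 2)"
    unfolding n1 n2 using d by (simp add: tan_def \<beta>_def)
  ultimately show ?thesis by blast
qed

context collared_loop begin

text \<open>Otherwise all these rotations have signs, and the sign of \<open>\<eta> 1\<close> is
  passed on by adding \<open>\<eta> 1\<close> up to \<open>\<eta> (n - 1)\<close>. But this is
  \<open>- cnj (\<eta> 1)\<close>, and \<open>cnj (\<eta> 1)\<close> cannot share the sign of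
  \<open>\<eta> 1\<close>.\<close>

lemma rot_vanishes:
  assumes n: "2 \<le> (n::nat)"
  shows "\<exists>k. 1 \<le> k \<and> k \<le> n - 1 \<and> (\<exists>x\<in>\<Gamma>. \<exists>y\<in>\<Gamma>. x \<noteq> y \<and> rot (cis (pi * real k / real n)) (x, y) = 0)"
proof (rule ccontr)
  assume no: "\<not> ?thesis"
  define \<eta> where "\<eta> k = cis (pi * real k / real n)" for k
  have \<eta>1: "cmod (\<eta> k) = 1" for k by (simp add: \<eta>_def)
  have nz: "rot (\<eta> k) (x, y) \<noteq> 0" if "1 \<le> k" "k \<le> n - 1" "x \<in> \<Gamma>" "y \<in> \<Gamma>" "x \<noteq> y" for k x y
    using no that unfolding \<eta>_def by blast
  have \<eta>_cnj: "cnj (\<eta> k) = - \<eta> (n - k)" if "k \<le> n" for k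
  proof -
    have "pi * real (n - k) / real n = pi + - (pi * real k / real n)"
      using that n by (simp add: of_nat_diff field_simps)
    then have "\<eta> (n - k) = cis pi * cis (- (pi * real k / real n))"
      unfolding \<eta>_def cis_mult by simp
    then show ?thesis by (simp add: \<eta>_def cis_cnj)
  qed
  have \<eta>_ne: "\<eta> k \<noteq> 1 \<and> \<eta> k \<noteq> - 1" if "1 \<le> k" "k \<le> n - 1" for k
  proof -
    have "0 < pi * real k / real n" "pi * real k / real n < pi"
      using that n by (simp_all add: field_simps)
    then have "0 < Im (\<eta> k)" by (simp add: \<eta>_def sin_gt_zero)
    then show ?thesis by auto
  qed
  have nz_cnj: "rot (cnj (\<eta> k)) (x, y) \<noteq> 0" if "1 \<le> k" "k \<le> n - 1" "x \<in> \<Gamma>" "y \<in> \<Gamma>" "x \<noteq> y" for k x y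
  proof -
    have "1 \<le> n - k" "n - k \<le> n - 1" using that(1,2) n by linarith+
    from nz[OF this that(3-5)] show ?thesis using \<eta>_cnj[of k] that(1,2) by (simp add: rot_minus)
  qed
  have ex: "chord_class (rot (\<eta> k)) 1 \<or> chord_class (rot (\<eta> k)) (- 1)" if "1 \<le> k" "k \<le> n - 1" for k
    using chord_class_exists[OF rot_cont rot_swap nz[OF that]] .
  have ex_cnj: "chord_class (rot (cnj (\<eta> k))) 1 \<or> chord_class (rot (cnj (\<eta> k))) (- 1)" if "1 \<le> k" "k \<le> n - 1" for k
    using chord_class_exists[OF rot_cont rot_swap nz_cnj[OF that]] .
  have mutual: False if "1 \<le> k" "k \<le> n - 1" "chord_class (rot (\<eta> k)) \<sigma>" "chord_class (rot (cnj (\<eta> k))) \<sigma>"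
    "\<sigma> = 1 \<or> \<sigma> = - 1" for k \<sigma>
    using no_mutual_class[OF \<eta>1 _ _ that(5) nz[OF that(1,2)] nz_cnj[OF that(1,2)] that(3,4)] \<eta>_ne[OF that(1,2)] by blast
  have n1: "1 \<le> (1::nat)" "1 \<le> n - 1" using n by auto
  obtain \<sigma> :: real where \<sigma>: "\<sigma> = 1 \<or> \<sigma> = - 1" and \<sigma>1: "chord_class (rot (\<eta> 1)) \<sigma>" using ex[OF n1] by auto
  have all: "chord_class (rot (\<eta> k)) \<sigma>" if "1 \<le> k" "k \<le> n - 1" for k
    using that
  proof (induction k rule: dec_induct)
    case (step k)
    then have k: "1 \<le> k" "k \<le> n - 1" "1 \<le> Suc k" "Suc k \<le> n - 1" by linarith+
    have mult: "\<eta> 1 * \<eta> k = \<eta> (Suc k)"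
    proof -
      have "pi * real 1 / real n + pi * real k / real n = pi * real (Suc k) / real n"
        by (simp add: add_divide_distrib[symmetric] algebra_simps)
      then show ?thesis unfolding \<eta>_def cis_mult by (simp only:)
    qed
    \<comment> \<open>The conjugate must have the sign \<open>- \<sigma>\<close>, and therefore
      \<open>\<eta> (Suc k)\<close> itself cannot.\<close>
    have "chord_class (rot (cnj (\<eta> (Suc k)))) \<sigma> \<Longrightarrow> False"
      using no_cyclic_class[of "\<eta> 1" "\<eta> k" \<sigma>] \<eta>1 \<eta>_ne[OF n1] \<eta>_ne[OF k(1,2)] \<eta>_ne[OF k(3,4)] \<sigma>
        nz[OF n1] nz[OF k(1,2)] nz_cnj[OF k(3,4)] \<sigma>1 step.IH[OF k(2)] unfolding mult by blast
    then have "chord_class (rot (cnj (\<eta> (Suc k)))) (- \<sigma>)" using ex_cnj[OF k(3,4)] \<sigma> by auto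
    moreover have "- \<sigma> = 1 \<or> - \<sigma> = - 1" using \<sigma> by auto
    ultimately have "\<not> chord_class (rot (\<eta> (Suc k))) (- \<sigma>)" using mutual[OF k(3,4)] by blast
    then show ?case using ex[OF k(3,4)] \<sigma> by auto
  qed (rule \<sigma>1)
  have "chord_class (rot (\<eta> (n - 1))) \<sigma>" by (rule all) (use n in auto)
  then have "chord_class (rot (- \<eta> (n - 1))) \<sigma>" by (rule chord_class_minus)
  also have "- \<eta> (n - 1) = cnj (\<eta> 1)" using \<eta>_cnj[of 1] n by simp
  finally show False using mutual[OF n1 \<sigma>1 _ \<sigma>] by blast
qed

lemma rectangle_exists:
  assumes n: "2 \<le> (n::nat)"
  shows "\<exists>k a b c d. 1 \<le> k \<and> k \<le> n - 1 \<and> inscribed_rectangle \<Gamma> a b c d \<and>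
    dist a b / dist b c = tan (real k * pi / (2 * real n))"
proof -
  obtain k x y where k: "1 \<le> k" "k \<le> n - 1" and xy: "x \<in> \<Gamma>" "y \<in> \<Gamma>" "x \<noteq> y"
    and 0: "rot (cis (pi * real k / real n)) (x, y) = 0"
    using rot_vanishes[OF n] by blast
  define m d where "m = (x + y) / 2" and "d = (x - y) / 2"
  have "0 < pi * real k / real n" "pi * real k / real n < pi"
    using k n by (simp_all add: field_simps)
  moreover have "m + d = x" "m - d = y" by (simp_all add: m_def d_def field_simps)
  moreover have "d \<noteq> 0" using xy(3) by (simp add: d_def)
  moreover have "\<psi> (m + cis (pi * real k / real n) * d) = 0" "\<psi> (m - cis (pi * real k / real n) * d) = 0"
    using 0 unfolding rot_def prod.case m_def[symmetric] d_def[symmetric] by (simp_all add: complex_eq_iff)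
  ultimately have "\<exists>a b c d. inscribed_rectangle \<Gamma> a b c d \<and> dist a b / dist b c = tan (pi * real k / real n / 2)"
    using xy by (intro rectangle_of_diagonals[of d _ m]) (simp_all add: \<psi>_sign)
  moreover have "pi * real k / real n / 2 = real k * pi / (2 * real n)" by (simp add: field_simps)
  ultimately show ?thesis using k by metis
qed

end

section \<open>Cones along a locally 1-Lipschitz curve\<close>

text \<open>By polarisation a distance-preserving map, translated to fix the origin, preserves inner
  products; so it is the rotation by \<open>u\<close>, preceded by a reflection if
  \<open>s = - 1\<close>.\<close>

lemma square_isometry_coordinates:
  fixes \<phi> :: "real \<times> real \<Rightarrow> complex"
  assumes r: "0 < r" and iso: "\<And>z w. z \<in> Q \<Longrightarrow> w \<in> Q \<Longrightarrow> dist (\<phi> z) (\<phi> w) = dist z w"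
    and Q: "Q = {-r<..<r} \<times> {-r<..<r}"
  obtains u s where "cmod u = 1" "s = 1 \<or> s = (- 1 :: real)"
    "\<And>x y. (x, y) \<in> Q \<Longrightarrow> \<phi> (x, y) = \<phi> (0, 0) + u * Complex x (s * y)"
proof -
  define g where "g z = \<phi> z - \<phi> (0, 0)" for z
  have 0: "(0, 0) \<in> Q" using r by (simp add: Q)
  have ng: "norm (g z) = norm z" if "z \<in> Q" for z
    using iso[OF that 0] by (simp add: g_def dist_norm zero_prod_def[symmetric])
  have ngd: "norm (g z - g w) = norm (z - w)" if "z \<in> Q" "w \<in> Q" for z w
    using iso[OF that] by (simp add: g_def dist_norm)
  have inn: "inner (g z) (g w) = inner z w" if "z \<in> Q" "w \<in> Q" for z w
    using ng[OF that(1)] ng[OF that(2)] ngd[OF that] by (simp add: dot_norm_neg)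
  \<comment> \<open>The unit vectors need not lie in the square; these multiples do, and their
    images are rescaled.\<close>
  define \<delta> where "\<delta> = r / 2"
  have \<delta>: "0 < \<delta>" "(\<delta>, 0) \<in> Q" "(0, \<delta>) \<in> Q" using r by (auto simp: \<delta>_def Q)
  define u where "u = g (\<delta>, 0) / of_real \<delta>"
  define v where "v = g (0, \<delta>) / of_real \<delta>"
  have nu: "cmod u = 1" using ng[OF \<delta>(2)] \<delta>(1) by (simp add: u_def norm_divide norm_Pair)
  have nv: "cmod v = 1" using ng[OF \<delta>(3)] \<delta>(1) by (simp add: v_def norm_divide norm_Pair)
  have u_sc: "u = g (\<delta>, 0) /\<^sub>R \<delta>" and v_sc: "v = g (0, \<delta>) /\<^sub>R \<delta>"
    using \<delta> by (simp_all add: u_def v_def scaleR_conv_of_real field_simps)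
  have x: "inner (g (x, y)) u = x" and y: "inner (g (x, y)) v = y" if "(x, y) \<in> Q" for x y
    using inn[OF that \<delta>(2)] inn[OF that \<delta>(3)] \<delta>(1) by (simp_all add: u_sc v_sc inner_Pair)
  have uv: "inner u v = 0"
    using inn[OF \<delta>(2,3)] \<delta>(1) by (simp add: u_sc v_sc inner_Pair)
  have basis: "w = u * Complex (inner w u) (inner w (\<i> * u))" for w
  proof -
    have "u * Complex (inner w u) (inner w (\<i> * u)) = w * (u * cnj u)"
      by (simp add: complex_eq_iff inner_complex_def algebra_simps)
    also have "u * cnj u = 1" using nu complex_norm_square[of u] by simp
    finally show ?thesis by simp
  qed
  define s where "s = inner v (\<i> * u)"
  have v: "v = u * Complex 0 s" using basis[of v] uv by (simp add: s_def inner_commute)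
  then have "\<bar>s\<bar> = 1" using nu nv by (metis complex_eq_0 norm_mult cmod_def complex.sel add_0 mult_1 power_zero_numeral real_sqrt_abs)
  then have s: "s = 1 \<or> s = - 1" by linarith
  have "\<phi> (x, y) = \<phi> (0, 0) + u * Complex x (s * y)" if "(x, y) \<in> Q" for x y
  proof -
    have vs: "\<i> * u = s *\<^sub>R v" using s by (subst v) (auto simp: complex_eq_iff)
    have "inner (g (x, y)) (\<i> * u) = s * y" unfolding vs using y[OF that] by simp
    then have "g (x, y) = u * Complex x (s * y)" using basis[of "g (x, y)"] x[OF that] by simp
    then show ?thesis by (simp add: g_def algebra_simps)
  qed
  then show ?thesis using that nu s by blast
qed

text \<open>For a unit vector \<open>u\<close>, \<open>fx\<close> and \<open>fy\<close> are the
  coordinates in the orthonormal frame \<open>u\<close>, \<open>\<i> * u\<close>.\<close>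

definition fx :: "complex \<Rightarrow> complex \<Rightarrow> real" where "fx u e = Re (e * cnj u)"
definition fy :: "complex \<Rightarrow> complex \<Rightarrow> real" where "fy u e = Im (e * cnj u)"

context jordan_loop begin

text \<open>Near \<open>p\<close> the directions at angle less than \<open>\<pi>/4\<close> from \<open>\<i> u\<close> all lead out of the curve.\<close>

definition cone :: "complex \<Rightarrow> real \<Rightarrow> complex \<Rightarrow> bool" where
  "cone p r u \<longleftrightarrow> 0 < r \<and> cmod u = 1 \<and>
     (\<forall>z v. dist z p < r \<and> cmod v < r \<and> \<bar>fx u v\<bar> < fy u v \<longrightarrow>
        (z \<in> Out \<union> \<Gamma> \<longrightarrow> z + v \<in> Out) \<and> (z \<in> Ins \<union> \<Gamma> \<longrightarrow> z - v \<in> Ins))"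

lemma connected_side: "connected A \<Longrightarrow> A \<inter> \<Gamma> = {} \<Longrightarrow> A \<subseteq> Ins \<or> A \<subseteq> Out"
  using connectedD[of A Ins Out] jordan(2,5,8,9) by blast

text \<open>The parts of the square above and below the graph are connected and miss the curve, so
  each lies on one side; the sides differ because the curve is the frontier of both. A 1-Lipschitz
  graph cannot catch up with a step at less than \<pi>/4 from the vertical.\<close>

lemma cone_exists:
  assumes "locally_1_Lipschitz \<Gamma>" and p: "p \<in> \<Gamma>"
  shows "\<exists>r u. cone p r u"
proof -
  obtain r :: real and \<phi> :: "real \<times> real \<Rightarrow> complex" where r: "0 < r" and
    "let Q = {-r<..<r} \<times> {-r<..<r} in
          (\<forall>z\<in>Q. \<forall>w\<in>Q. dist (\<phi> z) (\<phi> w) = dist z w) \<and> \<phi> (0, 0) = p \<and>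
          (\<exists>f. 1-lipschitz_on {-r<..<r} f \<and> {z \<in> Q. \<phi> z \<in> \<Gamma>} = {(x, f x) | x. x \<in> {-r<..<r}})"
    using assms unfolding locally_1_Lipschitz_def by blast
  then obtain f :: "real \<Rightarrow> real" where iso: "\<forall>z\<in>{-r<..<r} \<times> {-r<..<r}. \<forall>w\<in>{-r<..<r} \<times> {-r<..<r}. dist (\<phi> z) (\<phi> w) = dist z w"
    and \<phi>0: "\<phi> (0, 0) = p" and f: "1-lipschitz_on {-r<..<r} f"
    and graph: "{z \<in> {-r<..<r} \<times> {-r<..<r}. \<phi> z \<in> \<Gamma>} = {(x, f x) | x. x \<in> {-r<..<r}}"
    unfolding Let_def by blast
  obtain u s where u: "cmod u = 1" and s: "s = 1 \<or> s = (- 1 :: real)"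
    and \<phi>: "\<And>x y. (x, y) \<in> {-r<..<r} \<times> {-r<..<r} \<Longrightarrow> \<phi> (x, y) = \<phi> (0, 0) + u * Complex x (s * y)"
    using square_isometry_coordinates[OF r _ refl, of \<phi>] iso by metis
  define F where "F x = s * f x" for x
  define P where "P x y = p + u * Complex x y" for x y
  have s2: "s * s = 1" using s by auto
  have fr: "f x \<in> {-r<..<r}" if "x \<in> {-r<..<r}" for x
  proof -
    have "(x, f x) \<in> {z \<in> {-r<..<r} \<times> {-r<..<r}. \<phi> z \<in> \<Gamma>}" unfolding graph using that by blast
    then show ?thesis by simp
  qed
  have Fr: "F x \<in> {-r<..<r}" if "x \<in> {-r<..<r}" for x
    using fr[OF that] s by (auto simp: F_def)
  have on: "P x y \<in> \<Gamma> \<longleftrightarrow> y = F x" if "x \<in> {-r<..<r}" "y \<in> {-r<..<r}" for x y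
  proof -
    have sy: "s * y \<in> {-r<..<r}" using that s by auto
    have "\<phi> (x, s * y) = P x y" using \<phi>[of x "s * y"] that(1) sy s2 by (simp add: P_def \<phi>0 mult.assoc[symmetric])
    moreover have "(x, s * y) \<in> {z \<in> {-r<..<r} \<times> {-r<..<r}. \<phi> z \<in> \<Gamma>} \<longleftrightarrow> s * y = f x"
      unfolding graph using that(1) by auto
    ultimately have "P x y \<in> \<Gamma> \<longleftrightarrow> s * y = f x" using that sy by auto
    then show ?thesis using s by (auto simp: F_def)
  qed
  have F_lip: "\<bar>F x - F x'\<bar> \<le> \<bar>x - x'\<bar>" if "x \<in> {-r<..<r}" "x' \<in> {-r<..<r}" for x x'
  proof -
    have "\<bar>f x - f x'\<bar> \<le> \<bar>x - x'\<bar>" using lipschitz_onD[OF f that] by (simp add: dist_real_def)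
    then show ?thesis using s by (auto simp: F_def abs_minus_commute)
  qed
  have F_cont: "continuous_on {-r<..<r} F"
    unfolding F_def by (intro continuous_intros lipschitz_on_continuous_on[OF f])
  \<comment> \<open>Written as images of a product to make connectedness immediate: \<open>t\<close>
    moves from the graph to the edge of the square.\<close>
  define A where "A = (\<lambda>(x, t). P x (F x + t * (r - F x))) ` ({-r<..<r} \<times> {0<..<1})"
  define B where "B = (\<lambda>(x, t). P x (F x - t * (F x + r))) ` ({-r<..<r} \<times> {0<..<1})"
  have conn: "connected ({-r<..<r} \<times> {0<..<1::real})" by (intro connected_Times) auto
  have F_cont': "continuous_on ({-r<..<r} \<times> {0<..<1::real}) (\<lambda>x. F (fst x))"
    by (intro continuous_on_compose2[OF F_cont] continuous_intros) auto
  have "connected A" "connected B"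
    unfolding A_def B_def P_def case_prod_beta' Complex_eq
    by (intro connected_continuous_image conn continuous_intros F_cont')+
  have above: "P x y \<in> A" if "x \<in> {-r<..<r}" "y \<in> {-r<..<r}" "F x < y" for x y
    unfolding A_def
  proof (rule image_eqI[of _ _ "(x, (y - F x) / (r - F x))"])
    show "P x y = (case (x, (y - F x) / (r - F x)) of (x, t) \<Rightarrow> P x (F x + t * (r - F x)))"
      using that by simp
  qed (use that Fr[OF that(1)] in \<open>auto simp: field_simps\<close>)
  have below: "P x y \<in> B" if "x \<in> {-r<..<r}" "y \<in> {-r<..<r}" "y < F x" for x y
    unfolding B_def
  proof (rule image_eqI[of _ _ "(x, (F x - y) / (F x + r))"])
    show "P x y = (case (x, (F x - y) / (F x + r)) of (x, t) \<Rightarrow> P x (F x - t * (F x + r)))"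
      using that by simp
  qed (use that Fr[OF that(1)] in \<open>auto simp: field_simps\<close>)
  have A_in: "\<exists>x y. z = P x y \<and> x \<in> {-r<..<r} \<and> y \<in> {-r<..<r} \<and> F x < y" if "z \<in> A" for z
  proof -
    from that obtain x t where xt: "x \<in> {-r<..<r}" "0 < t" "t < 1" "z = P x (F x + t * (r - F x))"
      unfolding A_def by auto
    have "0 < t * (r - F x)" "0 < (1 - t) * (r - F x)" using xt Fr[OF xt(1)] by auto
    then have "F x < F x + t * (r - F x)" "F x + t * (r - F x) < r" by (simp_all add: algebra_simps)
    then show ?thesis using xt Fr[OF xt(1)] by (intro exI[of _ x] exI[of _ "F x + t * (r - F x)"]) auto
  qed
  have B_in: "\<exists>x y. z = P x y \<and> x \<in> {-r<..<r} \<and> y \<in> {-r<..<r} \<and> y < F x" if "z \<in> B" for z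
  proof -
    from that obtain x t where xt: "x \<in> {-r<..<r}" "0 < t" "t < 1" "z = P x (F x - t * (F x + r))"
      unfolding B_def by auto
    have "0 < t * (F x + r)" "0 < (1 - t) * (F x + r)" using xt Fr[OF xt(1)] by auto
    then have "F x - t * (F x + r) < F x" "- r < F x - t * (F x + r)" by (simp_all add: algebra_simps)
    then show ?thesis using xt Fr[OF xt(1)] by (intro exI[of _ x] exI[of _ "F x - t * (F x + r)"]) auto
  qed
  have "A \<inter> \<Gamma> = {}" "B \<inter> \<Gamma> = {}" using A_in B_in on by blast+
  with \<open>connected A\<close> \<open>connected B\<close> have AB: "A \<subseteq> Ins \<or> A \<subseteq> Out" "B \<subseteq> Ins \<or> B \<subseteq> Out"
    using connected_side by blast+
  have coord: "\<exists>x y. z = P x y \<and> \<bar>x\<bar> \<le> dist z p \<and> \<bar>y\<bar> \<le> dist z p" for z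
  proof (intro exI conjI)
    have uu: "u * cnj u = 1" using u complex_norm_square[of u] by simp
    let ?w = "(z - p) * cnj u"
    have "cmod ?w = dist z p" using u by (simp add: norm_mult dist_norm)
    then show "\<bar>Re ?w\<bar> \<le> dist z p" "\<bar>Im ?w\<bar> \<le> dist z p" using abs_Re_le_cmod[of ?w] abs_Im_le_cmod[of ?w] by simp_all
    show "z = P (Re ?w) (Im ?w)"
    proof -
      have "u * ?w = (z - p) * (u * cnj u)" by (simp add: mult_ac)
      also have "\<dots> = z - p" by (simp only: uu mult_1_right)
      finally show ?thesis unfolding P_def complex_surj by (simp only:) simp
    qed
  qed
  have meets: "\<exists>z\<in>S. z \<in> A \<union> B" if "frontier S = \<Gamma>" "S \<inter> \<Gamma> = {}" for S
  proof -
    have "p \<in> closure S" using p that(1) by (auto simp: frontier_def)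
    then obtain z where z: "z \<in> S" "dist z p < r" using r by (auto simp: closure_approachable)
    obtain x y where xy: "z = P x y" "\<bar>x\<bar> < r" "\<bar>y\<bar> < r" using coord[of z] z(2) by force
    then have "x \<in> {-r<..<r}" "y \<in> {-r<..<r}" by auto
    moreover from this have "y \<noteq> F x" using on that(2) z(1) xy(1) by blast
    ultimately have "z \<in> A \<union> B" unfolding xy(1) using above[of x y] below[of x y] by (cases "y < F x") auto
    then show ?thesis using z(1) by blast
  qed
  have "Ins \<inter> \<Gamma> = {}" "Out \<inter> \<Gamma> = {}" using jordan(9) by blast+
  with meets jordan(10,11) have "\<exists>z\<in>Ins. z \<in> A \<union> B" "\<exists>z\<in>Out. z \<in> A \<union> B" by blast+
  with AB jordan(8) have sides: "(A \<subseteq> Out \<and> B \<subseteq> Ins) \<or> (A \<subseteq> Ins \<and> B \<subseteq> Out)" by blast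
  \<comment> \<open>Half the size of the square keeps \<open>z + v\<close> and \<open>z - v\<close>
    in it.\<close>
  have step: "(z \<in> A \<union> \<Gamma> \<longrightarrow> z + v \<in> A) \<and> (z \<in> B \<union> \<Gamma> \<longrightarrow> z - v \<in> B)"
    if z: "dist z p < r/2" and v: "cmod v < r/2" and c: "\<bar>Re (v * cnj u)\<bar> < Im (v * cnj u)" for z v
  proof -
    obtain x y where xy: "z = P x y" "\<bar>x\<bar> < r/2" "\<bar>y\<bar> < r/2" using coord[of z] z by force
    define a b where "a = Re (v * cnj u)" and "b = Im (v * cnj u)"
    have uu: "u * cnj u = 1" using u complex_norm_square[of u] by simp
    have "cmod (v * cnj u) < r/2" using u v by (simp add: norm_mult)
    then have ab: "\<bar>a\<bar> < r/2" "\<bar>b\<bar> < r/2" "\<bar>a\<bar> < b"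
      using abs_Re_le_cmod[of "v * cnj u"] abs_Im_le_cmod[of "v * cnj u"] c unfolding a_def b_def by linarith+
    have v: "v = u * Complex a b"
    proof -
      have "u * (v * cnj u) = v * (u * cnj u)" by (simp add: mult_ac)
      also have "\<dots> = v" by (simp only: uu mult_1_right)
      finally show ?thesis unfolding a_def b_def complex_surj by (rule sym)
    qed
    have pm: "z + v = P (x + a) (y + b)" "z - v = P (x - a) (y - b)"
      unfolding xy v P_def by (simp_all add: complex_eq_iff algebra_simps)
    have rg: "x \<in> {-r<..<r}" "y \<in> {-r<..<r}" "x + a \<in> {-r<..<r}" "y + b \<in> {-r<..<r}" "x - a \<in> {-r<..<r}" "y - b \<in> {-r<..<r}"
      using xy ab by (auto simp: abs_less_iff)
    have L: "\<bar>F (x + a) - F x\<bar> \<le> \<bar>a\<bar>" "\<bar>F (x - a) - F x\<bar> \<le> \<bar>a\<bar>"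
      using F_lip[OF rg(3,1)] F_lip[OF rg(5,1)] by simp_all
    have "F x \<le> y" if "z \<in> A \<union> \<Gamma>"
    proof (rule ccontr)
      assume "\<not> F x \<le> y"
      then have "z \<in> B" "z \<notin> \<Gamma>" using below on rg xy(1) by auto
      then show False using that sides jordan(8) by blast
    qed
    moreover have "y \<le> F x" if "z \<in> B \<union> \<Gamma>"
    proof (rule ccontr)
      assume "\<not> y \<le> F x"
      then have "z \<in> A" "z \<notin> \<Gamma>" using above on rg xy(1) by auto
      then show False using that sides jordan(8) by blast
    qed
    ultimately show ?thesis
      unfolding pm using above[OF rg(3,4)] below[OF rg(5,6)] L ab(3) by auto
  qed
  have AB_loc: "z \<in> A \<union> B \<union> \<Gamma>" if dz: "dist z p < r/2" for z
  proof -
    obtain x y where xy: "z = P x y" "\<bar>x\<bar> < r/2" "\<bar>y\<bar> < r/2" using coord[of z] dz by force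
    then have rg: "x \<in> {-r<..<r}" "y \<in> {-r<..<r}" by (auto simp: abs_less_iff)
    show ?thesis unfolding xy(1) using above[OF rg] below[OF rg] on[OF rg] by (cases "y = F x"; cases "y < F x") auto
  qed
  from sides show ?thesis
  proof
    assume S: "A \<subseteq> Out \<and> B \<subseteq> Ins"
    have "cone p (r/2) u"
      unfolding cone_def fx_def fy_def
    proof (intro conjI allI impI; (elim conjE)?)
      fix z v assume zv: "dist z p < r/2" "cmod v < r/2" "\<bar>Re (v * cnj u)\<bar> < Im (v * cnj u)"
      { assume "z \<in> Out \<union> \<Gamma>"
        then have "z \<in> A \<union> \<Gamma>" using AB_loc[OF zv(1)] S jordan(8,9) by blast
        then show "z + v \<in> Out" using step[OF zv] S by blast }
      { assume "z \<in> Ins \<union> \<Gamma>"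
        then have "z \<in> B \<union> \<Gamma>" using AB_loc[OF zv(1)] S jordan(8,9) by blast
        then show "z - v \<in> Ins" using step[OF zv] S by blast }
    qed (use r u in auto)
    then show ?thesis by blast
  next
    assume S: "A \<subseteq> Ins \<and> B \<subseteq> Out"
    \<comment> \<open>The outside lies below the graph here, so the frame is turned round.\<close>
    have "cone p (r/2) (- u)"
      unfolding cone_def fx_def fy_def
    proof (intro conjI allI impI; (elim conjE)?)
      fix z v assume zv: "dist z p < r/2" "cmod v < r/2" "\<bar>Re (v * cnj (- u))\<bar> < Im (v * cnj (- u))"
      then have zv': "dist z p < r/2" "cmod (- v) < r/2" "\<bar>Re (- v * cnj u)\<bar> < Im (- v * cnj u)" by simp_all
      { assume "z \<in> Out \<union> \<Gamma>"
        then have "z \<in> B \<union> \<Gamma>" using AB_loc[OF zv(1)] S jordan(8,9) by blast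
        then show "z + v \<in> Out" using step[OF zv'] S by auto }
      { assume "z \<in> Ins \<union> \<Gamma>"
        then have "z \<in> A \<union> \<Gamma>" using AB_loc[OF zv(1)] S jordan(8,9) by blast
        then show "z - v \<in> Ins" using step[OF zv'] S by auto }
    qed (use r u in auto)
    then show ?thesis by blast
  qed
qed

end

section \<open>Cone directions and the signed distance\<close>

text \<open>A point of \<open>S\<close> nearly closest to \<open>z + v\<close>, moved by
  \<open>- v\<close> and then by \<eta> towards \<open>z\<close>, stays in \<open>S\<close> and has
  come closer by \<eta>. If this would overshoot \<open>z\<close>, then \<open>z\<close> itself is
  in \<open>S\<close>.\<close>

lemma infdist_shift:
  fixes S :: "complex set"
  assumes p: "p \<in> closure S" and z: "dist z p < r/4" and v: "cmod v < r/8" and \<eta>: "0 < \<eta>" "\<eta> \<le> r/8"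
    and shift: "\<And>i w. i \<in> S \<Longrightarrow> dist i p < r \<Longrightarrow> cmod w \<le> \<eta> \<Longrightarrow> i - (v + w) \<in> S"
  shows "infdist z S = 0 \<or> infdist z S + \<eta> \<le> infdist (z + v) S"
proof (rule disjCI)
  assume n: "\<not> infdist z S + \<eta> \<le> infdist (z + v) S"
  have S: "S \<noteq> {}" using p by auto
  have "infdist z S \<le> infdist p S + dist z p" by (rule infdist_triangle)
  also have "infdist p S = 0" using p in_closure_iff_infdist_zero[OF S] by simp
  finally have zS: "infdist z S \<le> dist z p" by simp
  have "\<exists>i\<in>S. dist (z + v) i < infdist z S + \<eta>"
  proof (rule ccontr)
    assume "\<not> ?thesis"
    then have "infdist z S + \<eta> \<le> infdist (z + v) S"
      unfolding infdist_notempty[OF S, of "z + v"] by (intro cINF_greatest[OF S]) auto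
    then show False using n by simp
  qed
  then obtain i where i: "i \<in> S" "dist (z + v) i < infdist z S + \<eta>" by blast
  have "dist i p \<le> dist i (z + v) + dist (z + v) z + dist z p"
    using dist_triangle[of i p "z + v"] dist_triangle[of "z + v" p z] by linarith
  also have "dist (z + v) z = cmod v" by (simp add: dist_norm)
  finally have ip: "dist i p < r" using i(2) zS z v \<eta> by (simp add: dist_commute)
  define y where "y = z + v - i"
  have y: "cmod y < infdist z S + \<eta>" using i(2) by (simp add: y_def dist_norm)
  show "infdist z S = 0"
  proof (cases "cmod y \<le> \<eta>")
    case True
    then have "i - (v + (- y)) \<in> S" using shift[OF i(1) ip, of "- y"] True by (simp only: norm_minus_cancel)
    moreover have "i - (v + (- y)) = z" by (simp add: y_def)
    ultimately show ?thesis by (simp add: infdist_zero)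
  next
    case False
    then have y0: "0 < cmod y" "y \<noteq> 0" using \<eta> by auto
    define w where "w = - of_real (\<eta> / cmod y) * y"
    have "cmod w = \<eta>" using y0 \<eta> by (simp add: w_def norm_mult norm_divide)
    then have "i - (v + w) \<in> S" by (intro shift[OF i(1) ip]) simp
    then have "infdist z S \<le> dist z (i - (v + w))" by (rule infdist_le)
    also have "\<dots> = cmod (y + w)" by (simp add: dist_norm y_def algebra_simps)
    also have "y + w = of_real (1 - \<eta> / cmod y) * y" by (simp add: w_def algebra_simps)
    also have "cmod \<dots> = cmod y - \<eta>"
    proof -
      have "0 \<le> 1 - \<eta> / cmod y" using False y0 by (simp add: divide_le_eq_1)
      then have "cmod (of_real (1 - \<eta> / cmod y) * y) = (1 - \<eta> / cmod y) * cmod y" by (simp only: norm_mult norm_of_real abs_of_nonneg)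
      also have "\<dots> = cmod y - \<eta>" using y0 by (simp add: left_diff_distrib)
      finally show ?thesis .
    qed
    finally show ?thesis using y by simp
  qed
qed

text \<open>Between the angles - \<pi>/4 and \<pi>/4 the tangents of the unit circle are steeper
  than the diagonals, and so are the chords of this arc.\<close>

lemma right_cone_slope:
  fixes x y x' y' :: real
  assumes "x\<^sup>2 + y\<^sup>2 = 1" "x'\<^sup>2 + y'\<^sup>2 = 1" "\<bar>y\<bar> \<le> x" "\<bar>y'\<bar> \<le> x'" "y < y'"
  shows "\<bar>x' - x\<bar> < y' - y"
proof -
  have x: "0 < x" "0 < x'" using assms by (auto simp: abs_le_iff order.order_iff_strict)
  have eq: "(x' - x) * (x' + x) = - ((y' - y) * (y' + y))"
    using assms(1,2) by (simp add: power2_eq_square algebra_simps)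
  have lt: "\<bar>y' + y\<bar> < x' + x"
  proof (rule ccontr)
    assume "\<not> ?thesis"
    then have "(y' = x' \<and> y = x) \<or> (y' = - x' \<and> y = - x)" using assms(3,4) by linarith
    then have "x\<^sup>2 = x'\<^sup>2" "y = x \<and> y' = x' \<or> y = - x \<and> y' = - x'" using assms(1,2) by auto
    moreover from this(1) have "x = x'" using x by (simp add: power2_eq_iff)
    ultimately show False using assms(5) by auto
  qed
  have "\<bar>x' - x\<bar> * (x' + x) = (y' - y) * \<bar>y' + y\<bar>"
    using arg_cong[OF eq, of abs] x assms(5) by (simp add: abs_mult)
  also have "\<dots> < (y' - y) * (x' + x)" using lt assms(5) by simp
  finally show ?thesis using x by (simp add: mult_less_cancel_right)
qed

lemma frame_simps:
  "fx u (- e) = - fx u e" "fy u (- e) = - fy u e"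
  "fx u (e + e') = fx u e + fx u e'" "fy u (e + e') = fy u e + fy u e'"
  "fx u (e - e') = fx u e - fx u e'" "fy u (e - e') = fy u e - fy u e'"
  "fx u (of_real k * e) = k * fx u e" "fy u (of_real k * e) = k * fy u e"
  "fx u (\<i> * e) = - fy u e" "fy u (\<i> * e) = fx u e"
  by (simp_all add: fx_def fy_def algebra_simps)

lemma frame_bounds: "cmod u = 1 \<Longrightarrow> \<bar>fx u e\<bar> \<le> cmod e" "cmod u = 1 \<Longrightarrow> \<bar>fy u e\<bar> \<le> cmod e"
  using abs_Re_le_cmod[of "e * cnj u"] abs_Im_le_cmod[of "e * cnj u"]
  by (simp_all add: fx_def fy_def norm_mult)

lemma frame_inner: "cmod u = 1 \<Longrightarrow> Re (cnj v * e) = fx u v * fx u e + fy u v * fy u e"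
proof -
  assume u: "cmod u = 1"
  have uu: "u * cnj u = 1" using u complex_norm_square[of u] by simp
  have "cnj (v * cnj u) * (e * cnj u) = cnj v * e * (u * cnj u)" by (simp add: mult_ac)
  also have "\<dots> = cnj v * e" unfolding uu by simp
  finally have "Re (cnj v * e) = Re (cnj (v * cnj u) * (e * cnj u))" by (simp only:)
  then show ?thesis unfolding fx_def fy_def by (simp only: times_complex.sel cnj.sel)
qed

lemma frame_cis: "cmod u = 1 \<Longrightarrow> fx u (cis t * u) = cos t" "cmod u = 1 \<Longrightarrow> fy u (cis t * u) = sin t"
proof -
  assume u: "cmod u = 1"
  have uu: "u * cnj u = 1" using u complex_norm_square[of u] by simp
  show "fx u (cis t * u) = cos t" "fy u (cis t * u) = sin t"
    unfolding fx_def fy_def mult.assoc uu by simp_all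
qed

text \<open>The abstract shape, in the frame \<open>u\<close>, of the direction dependence of a height difference
  across a \<open>1\<close>-Lipschitz graph: such a function vanishes in exactly one direction up to sign.\<close>

definition steep :: "complex \<Rightarrow> (complex \<Rightarrow> real) \<Rightarrow> bool" where
  "steep u B \<longleftrightarrow> (\<forall>e. B (- e) = - B e) \<and>
     (\<forall>e. cmod e = 1 \<and> \<bar>fx u e\<bar> < fy u e \<longrightarrow> 0 < B e) \<and>
     (\<forall>e e'. cmod e = 1 \<and> cmod e' = 1 \<and> \<bar>fy u e\<bar> \<le> fx u e \<and> \<bar>fy u e'\<bar> \<le> fx u e'
        \<and> fy u e < fy u e' \<longrightarrow> B e < B e')"

lemma frame_unit: "cmod u = 1 \<Longrightarrow> cmod e = 1 \<Longrightarrow> (fx u e)\<^sup>2 + (fy u e)\<^sup>2 = 1"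
  using cmod_power2[of "e * cnj u"] by (simp add: fx_def fy_def norm_mult)

lemma frame_eq:
  assumes "cmod u = 1" "fx u e = fx u e'" "fy u e = fy u e'"
  shows "e = e'"
proof -
  have "e * cnj u = e' * cnj u" using assms(2,3) unfolding fx_def fy_def by (simp only: complex_eq_iff)
  then show ?thesis using assms(1) by auto
qed

text \<open>This lets \<open>gap\<close> be deformed linearly into the inner product with the normal
  field while the direction of vanishing stays unique.\<close>

lemma steep_convex:
  assumes "steep u B" "steep u B'" "0 \<le> t" "t \<le> 1"
  shows "steep u (\<lambda>e. (1 - t) * B e + t * B' e)"
proof -
  have pos: "0 < (1 - t) * a + t * b" if "0 < a" "0 < b" for a b
    using that assms(3,4) by (cases "t = 0") (auto intro: add_nonneg_pos)
  have "(1 - t) * a + t * b < (1 - t) * a' + t * b'" if "a < a'" "b < b'" for a a' b b'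
    using pos[of "a' - a" "b' - b"] that by (simp add: algebra_simps)
  with pos show ?thesis
    using assms(1,2) unfolding steep_def by (simp add: right_diff_distrib[symmetric] distrib_left[symmetric])
qed

lemma steep_zero_right:
  assumes B: "steep u B" and e: "cmod e = 1" "B e = 0" "0 \<le> fx u e"
  shows "\<bar>fy u e\<bar> \<le> fx u e"
proof (rule ccontr)
  assume n: "\<not> ?thesis"
  have "B (- e) = 0" using B e(2) unfolding steep_def by simp
  from n have "\<bar>fx u e\<bar> < fy u e \<or> \<bar>fx u (- e)\<bar> < fy u (- e)"
    using e(3) by (auto simp: frame_simps)
  then have "0 < B e \<or> 0 < B (- e)" using B e(1) unfolding steep_def by (metis norm_minus_cancel)
  then show False using e(2) \<open>B (- e) = 0\<close> by simp
qed

text \<open>Positivity and oddness confine the zeros to the quarter arcs around \<open>u\<close> and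
  \<open>- u\<close>; oddness exchanges the two arcs, and on the first one \<open>B\<close> is
  strictly increasing.\<close>

lemma steep_zero_unique:
  assumes u: "cmod u = 1" and B: "steep u B" and e: "cmod e = 1" "B e = 0" and e': "cmod e' = 1" "B e' = 0"
  shows "e' = e \<or> e' = - e"
proof -
  have *: "a' = a" if a: "cmod a = 1" "B a = 0" "0 \<le> fx u a"
    and a': "cmod a' = 1" "B a' = 0" "0 \<le> fx u a'" for a a'
  proof -
    note r = steep_zero_right[OF B a] steep_zero_right[OF B a']
    have i: "fy u a = fy u a'"
    proof (rule ccontr)
      assume "\<not> ?thesis"
      then have "B a < B a' \<or> B a' < B a" using B r a a' unfolding steep_def by (meson linorder_neqE)
      then show False using a a' by simp
    qed
    have "(fx u a)\<^sup>2 = (fx u a')\<^sup>2"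
      using frame_unit[OF u a(1)] frame_unit[OF u a'(1)] i by simp
    then have "fx u a = fx u a'" using a(3) a'(3) by (rule power2_eq_imp_eq)
    then show ?thesis using frame_eq[OF u _ i] by simp
  qed
  have odd: "B (- x) = - B x" for x using B unfolding steep_def by blast
  define a where "a = (if 0 \<le> fx u e then e else - e)"
  define a' where "a' = (if 0 \<le> fx u e' then e' else - e')"
  have "a' = a" by (rule *) (use e e' in \<open>auto simp: a_def a'_def odd frame_simps\<close>)
  then show ?thesis unfolding a_def a'_def by (auto split: if_splits)
qed

text \<open>The intermediate value theorem on the half circle from \<open>- \<i> * u\<close> to
  \<open>\<i> * u\<close> gives a zero, and a quarter turn makes it a normal.\<close>

lemma steep_normal:
  assumes u: "cmod u = 1" and B: "steep u B" and cont: "continuous_on UNIV B"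
  obtains w where "cmod w = 1" "B (- \<i> * w) = 0" "0 < B w" "\<bar>fx u w\<bar> \<le> fy u w"
proof -
  have odd: "B (- x) = - B x" for x using B unfolding steep_def by blast
  define g where "g t = B (cis t * u)" for t
  have "0 < g (pi/2)"
  proof -
    have "cmod (cis (pi/2) * u) = 1" using u by (simp add: norm_mult)
    moreover have "\<bar>fx u (cis (pi/2) * u)\<bar> < fy u (cis (pi/2) * u)" unfolding frame_cis[OF u] by simp
    ultimately show ?thesis using B unfolding steep_def g_def by blast
  qed
  moreover have "g (- (pi/2)) = - g (pi/2)"
    unfolding g_def odd[symmetric] by (intro arg_cong[where f=B]) (simp add: complex_eq_iff)
  moreover have "continuous_on {- (pi/2)..pi/2} g"
    unfolding g_def cis_conv_exp by (intro continuous_on_compose2[OF cont] continuous_intros) auto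
  ultimately obtain t where t: "- (pi/2) \<le> t" "t \<le> pi/2" "g t = 0"
    using IVT'[of g "- (pi/2)" 0 "pi/2"] by auto
  define e where "e = cis t * u"
  have e: "cmod e = 1" "B e = 0" using u t(3) by (simp_all add: e_def g_def norm_mult)
  have eu: "fx u e = cos t" "fy u e = sin t" unfolding e_def frame_cis[OF u] by simp_all
  have r: "\<bar>sin t\<bar> \<le> cos t"
    using steep_zero_right[OF B e] t cos_ge_zero[of t] unfolding eu by simp
  define w where "w = \<i> * e"
  have w: "cmod w = 1" "B (- \<i> * w) = 0" using e by (simp_all add: w_def norm_mult mult.assoc[symmetric])
  have wu: "fx u w = - sin t" "fy u w = cos t"
    using eu by (simp_all add: w_def frame_simps)
  \<comment> \<open>If \<open>w\<close> lies on the boundary of the cone, \<open>w\<close> or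
    \<open>- w\<close> is on the same arc as the zero \<open>e\<close>, and monotonicity replaces
    positivity.\<close>
  have "0 < B w"
  proof -
    consider "\<bar>sin t\<bar> < cos t" | "sin t = cos t" "0 < cos t" | "sin t = - cos t" "0 < cos t"
      using r sin_cos_squared_add[of t] by (cases "cos t = 0") (auto simp: abs_le_iff, linarith)
    then show ?thesis
    proof cases
      case 1
      then have "\<bar>fx u w\<bar> < fy u w" using wu by simp
      then show ?thesis using B w(1) unfolding steep_def by blast
    next
      case 2
      have "\<bar>fy u (- w)\<bar> \<le> fx u (- w)" "\<bar>fy u e\<bar> \<le> fx u e" "fy u (- w) < fy u e" "cmod (- w) = 1"
        using 2 eu wu w(1) by (simp_all add: frame_simps)
      then have "B (- w) < B e" using B e(1) unfolding steep_def by blast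
      then show ?thesis using e(2) odd by simp
    next
      case 3
      have "\<bar>fy u w\<bar> \<le> fx u w" "\<bar>fy u e\<bar> \<le> fx u e" "fy u e < fy u w"
        using 3 eu wu by simp_all
      then have "B e < B w" using B e(1) w(1) unfolding steep_def by blast
      then show ?thesis using e(2) by simp
    qed
  qed
  then show ?thesis using that w r wu by simp
qed

lemma steep_linear:
  assumes \<nu>: "\<nu> \<noteq> 0" "\<bar>fx u \<nu>\<bar> \<le> fy u \<nu>" and u: "cmod u = 1"
  shows "steep u (\<lambda>e. Re (cnj \<nu> * e))"
proof -
  define a b where "a = fx u \<nu>" and "b = fy u \<nu>"
  have B: "Re (cnj \<nu> * e) = a * fx u e + b * fy u e" for e
    unfolding a_def b_def by (rule frame_inner[OF u])
  have ab: "\<bar>a\<bar> \<le> b" using \<nu>(2) by (simp add: a_def b_def)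
  have "b \<noteq> 0"
  proof
    assume "b = 0"
    then have "\<nu> * cnj u = 0" using ab unfolding a_def b_def fx_def fy_def by (simp only: complex_eq_iff) simp
    then show False using \<nu>(1) u by auto
  qed
  then have b: "0 < b" using ab by linarith
  have key: "0 < a * x + b * y" if "\<bar>x\<bar> < y" for x y
  proof -
    have "\<bar>a * x\<bar> \<le> b * \<bar>x\<bar>" unfolding abs_mult using ab by (intro mult_right_mono) auto
    also have "\<dots> < b * y" using that b by simp
    finally show ?thesis by linarith
  qed
  show ?thesis
    unfolding steep_def B
  proof (intro conjI allI impI; (elim conjE)?)
    fix e e' assume h: "cmod e = 1" "cmod e' = 1" "\<bar>fy u e\<bar> \<le> fx u e"
      "\<bar>fy u e'\<bar> \<le> fx u e'" "fy u e < fy u e'"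
    have "\<bar>fx u e' - fx u e\<bar> < fy u e' - fy u e"
      using right_cone_slope[OF frame_unit[OF u h(1)] frame_unit[OF u h(2)] h(3-5)] .
    from key[OF this] show "a * fx u e + b * fy u e < a * fx u e' + b * fy u e'"
      by (simp add: algebra_simps)
  qed (simp_all add: key frame_simps)
qed

context jordan_loop begin

lemma cone_recenter:
  assumes "cone p r u" "dist q p < r/2"
  shows "cone q (r/2) u"
proof -
  have "dist z p < r" if "dist z q < r/2" for z using dist_triangle[of z p q] assms(2) that by linarith
  then show ?thesis using assms(1) unfolding cone_def by auto
qed

lemma cone_smaller: "cone p r u \<Longrightarrow> 0 < s \<Longrightarrow> s \<le> r \<Longrightarrow> cone p s u"
  unfolding cone_def by auto

lemma uniform_cone:
  assumes "locally_1_Lipschitz \<Gamma>"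
  obtains r where "0 < r" "\<And>p. p \<in> \<Gamma> \<Longrightarrow> \<exists>u. cone p r u"
proof -
  obtain R u where R: "\<And>p. p \<in> \<Gamma> \<Longrightarrow> cone p (R p) (u p)"
    using cone_exists[OF assms] by metis
  then have Rpos: "0 < R p" if "p \<in> \<Gamma>" for p using that unfolding cone_def by blast
  have "\<Gamma> \<subseteq> (\<Union>p\<in>\<Gamma>. ball p (R p / 2))" using Rpos by force
  then obtain C where C: "C \<subseteq> \<Gamma>" "finite C" "\<Gamma> \<subseteq> (\<Union>p\<in>C. ball p (R p / 2))"
    using compactE_image[OF compact_\<Gamma>, of \<Gamma> "\<lambda>p. ball p (R p / 2)"] by auto
  have "C \<noteq> {}" using subsetD[OF C(3) c_in[of 0]] by auto
  define r where "r = Min ((\<lambda>p. R p / 2) ` C)"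
  have "r \<in> (\<lambda>p. R p / 2) ` C" unfolding r_def using C(2) \<open>C \<noteq> {}\<close> by (intro Min_in) auto
  then have "0 < r" using Rpos C(1) by auto
  moreover have "r \<le> R p / 2" if "p \<in> C" for p unfolding r_def using C(2) that by (intro Min_le) auto
  ultimately have r: "0 < r" "\<And>p. p \<in> C \<Longrightarrow> r \<le> R p / 2" by auto
  have "\<exists>u. cone q r u" if q: "q \<in> \<Gamma>" for q
  proof -
    obtain p where p: "p \<in> C" "dist q p < R p / 2" using subsetD[OF C(3) q] by (auto simp: dist_commute)
    have "cone q (R p / 2) (u p)" using cone_recenter[OF R p(2)] C(1) p(1) by blast
    then show ?thesis using cone_smaller r(1) r(2)[OF p(1)] by blast
  qed
  then show ?thesis using that r(1) by blast
qed

text \<open>The cone condition on \<open>v\<close> has room to spare, so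
  \<open>infdist_shift\<close> applies to the inside along \<open>v\<close> and to the outside along
  \<open>- v\<close>. One of the two distances changes strictly unless \<open>z\<close> and
  \<open>z + v\<close> lie on different closed sides, where the signs of \<psi> decide.\<close>

lemma \<psi>_mono_cone:
  assumes p: "p \<in> \<Gamma>" and cone: "cone p r u" and z: "dist z p < r/8" and v: "cmod v < r/8"
    and c: "\<bar>fx u v\<bar> < fy u v"
  shows "\<psi> z < \<psi> (z + v)"
proof -
  have u: "cmod u = 1" and r: "0 < r" using cone unfolding cone_def by auto
  have Cn: "(z \<in> Out \<union> \<Gamma> \<longrightarrow> z + v \<in> Out) \<and> (z \<in> Ins \<union> \<Gamma> \<longrightarrow> z - v \<in> Ins)"
    if "dist z p < r" "cmod v < r" "\<bar>fx u v\<bar> < fy u v" for z v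
    using cone that unfolding cone_def by blast
  \<comment> \<open>A perturbation of size \<eta> changes each of the two coordinates by at most
    \<eta>, which uses up at most half of the margin in the cone inequality.\<close>
  define \<eta> where "\<eta> = min (r/8) ((fy u v - \<bar>fx u v\<bar>) / 4)"
  have \<eta>: "0 < \<eta>" "\<eta> \<le> r/8" "4 * \<eta> \<le> fy u v - \<bar>fx u v\<bar>" using r c unfolding \<eta>_def by (auto simp: min_def)
  have vw: "cmod (v + w) < r" "\<bar>fx u (v + w)\<bar> < fy u (v + w)" if "cmod w \<le> \<eta>" for w
  proof -
    show "cmod (v + w) < r" using norm_triangle_ineq[of v w] v that \<eta> r by linarith
    have "\<bar>fx u w\<bar> \<le> \<eta>" "\<bar>fy u w\<bar> \<le> \<eta>"
      using frame_bounds[OF u, of w] that by linarith+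
    then show "\<bar>fx u (v + w)\<bar> < fy u (v + w)"
      unfolding frame_simps using \<eta> by linarith
  qed
  have zv: "dist (z + v) p < r/4"
    using norm_triangle_ineq[of "z - p" v] z v by (simp add: dist_norm algebra_simps)
  have I: "infdist z Ins = 0 \<or> infdist z Ins + \<eta> \<le> infdist (z + v) Ins"
  proof (rule infdist_shift[where p=p and r=r])
    show "i - (v + w) \<in> Ins" if "i \<in> Ins" "dist i p < r" "cmod w \<le> \<eta>" for i w
      using Cn[OF that(2) vw[OF that(3)]] that(1) by blast
  qed (use p z v \<eta> r closure_sides in auto)
  have O: "infdist (z + v) Out = 0 \<or> infdist (z + v) Out + \<eta> \<le> infdist (z + v + - v) Out"
  proof (rule infdist_shift[where p=p and r=r])
    show "i - (- v + w) \<in> Out" if "i \<in> Out" "dist i p < r" "cmod w \<le> \<eta>" for i w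
    proof -
      have "i + (v + - w) \<in> Out" using Cn[OF that(2) vw[of "- w"]] that(1,3) by simp
      moreover have "i - (- v + w) = i + (v + - w)" by simp
      ultimately show ?thesis by (simp only:)
    qed
  qed (use p zv v \<eta> r closure_sides in auto)
  note Cz = Cn[of z v] and Czv = Cn[of "z + v" v]
  have zr: "dist z p < r" "dist (z + v) p < r" "cmod v < r" using z zv v r by linarith+
  show ?thesis
  proof (cases "infdist z Ins = 0")
    case False
    then have "z \<in> Out" using infdist_sides(1)[of z] jordan(9) by blast
    then have "z + v \<in> Out" using Cz zr c by blast
    then have "infdist (z + v) Out = 0" "infdist z Out = 0" using \<open>z \<in> Out\<close> by (simp_all add: infdist_sides)
    then show ?thesis using I False \<eta>(1) by (simp add: \<psi>_def)
  next
    case True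
    show ?thesis
    proof (cases "infdist (z + v) Out = 0")
      case False
      then have "z + v \<in> Ins" using infdist_sides(2)[of "z + v"] jordan(9) by blast
      then have "infdist (z + v) Ins = 0" by (simp add: infdist_sides)
      then show ?thesis using O False \<eta>(1) True by (simp add: \<psi>_def)
    next
      case F: True
      then have "z + v \<in> Out \<union> \<Gamma>" "z \<in> Ins \<union> \<Gamma>" using True infdist_sides by blast+
      moreover have "z + v \<in> Out" if "z \<in> \<Gamma>" using Cz zr c that by blast
      ultimately have "\<psi> z < 0 \<and> 0 \<le> \<psi> (z + v) \<or> \<psi> z \<le> 0 \<and> 0 < \<psi> (z + v)"
        using \<psi>_sign[of z] \<psi>_sign[of "z + v"] by (metis UnE order.order_iff_strict)
      then show ?thesis by linarith
    qed
  qed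
qed

text \<open>Turning \<open>e\<close> into \<open>e'\<close> moves one end point by
  \<open>h * (e' - e)\<close> and the other by the opposite vector. This vector is in the cone by
  \<open>right_cone_slope\<close>, so both moves raise \<open>gap\<close>; the bounds
  \<open>r/16\<close> keep the end points within \<open>r/8\<close> of \<open>p\<close>.\<close>

lemma gap_steep:
  assumes p: "p \<in> \<Gamma>" and cone: "cone p r u" and m: "dist m p < r/16" and h: "0 < h" "h < r/16"
  shows "steep u (gap m h)"
proof -
  have u: "cmod u = 1" using cone unfolding cone_def by auto
  have near: "dist (m + of_real h * e) p < r/8" if "cmod e = 1" for e
    using norm_triangle_ineq[of "m - p" "of_real h * e"] m h that by (simp add: dist_norm norm_mult algebra_simps)
  have mono: "\<psi> z < \<psi> (z + of_real k * w)"
    if z: "dist z p < r/8" and k: "0 < k" "k * cmod w < r/8" and w: "\<bar>fx u w\<bar> < fy u w" for z k w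
    by (rule \<psi>_mono_cone[OF p cone z]) (use k w in \<open>simp_all add: frame_simps abs_mult norm_mult\<close>)
  show ?thesis
    unfolding steep_def
  proof (intro conjI allI impI; (elim conjE)?)
    show "gap m h (- e) = - gap m h e" for e by (simp add: gap_def)
    show "0 < gap m h e" if e: "cmod e = 1" "\<bar>fx u e\<bar> < fy u e" for e
    proof -
      have "\<psi> (m + of_real h * (- e)) < \<psi> (m + of_real h * (- e) + of_real (2 * h) * e)"
        by (rule mono[OF near]) (use e h in auto)
      then show ?thesis by (simp add: gap_def algebra_simps)
    qed
    fix e e' assume e: "cmod e = 1" "cmod e' = 1" "\<bar>fy u e\<bar> \<le> fx u e"
      "\<bar>fy u e'\<bar> \<le> fx u e'" "fy u e < fy u e'"
    have "\<bar>fx u e' - fx u e\<bar> < fy u e' - fy u e"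
      using right_cone_slope[OF frame_unit[OF u e(1)] frame_unit[OF u e(2)] e(3-5)] .
    then have d: "\<bar>fx u (e' - e)\<bar> < fy u (e' - e)"
      by (simp only: frame_simps)
    have "cmod (e' - e) \<le> 2" using norm_triangle_ineq4[of e' e] e by simp
    then have "h * cmod (e' - e) \<le> h * 2" using h by (intro mult_left_mono) auto
    then have k: "h * cmod (e' - e) < r/8" using h by linarith
    have "\<psi> (m + of_real h * e) < \<psi> (m + of_real h * e + of_real h * (e' - e))"
      by (rule mono[OF near h(1) k d]) (rule e)
    moreover have "\<psi> (m + of_real h * (- e')) < \<psi> (m + of_real h * (- e') + of_real h * (e' - e))"
      by (rule mono[OF near h(1) k d]) (simp add: e)
    ultimately show "gap m h e < gap m h e'" by (simp add: gap_def algebra_simps)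
  qed
qed

end

section \<open>The normal field and its turning number\<close>

lemma infdist_less_obtain:
  assumes "A \<noteq> {}" "infdist x A < a"
  obtains y where "y \<in> A" "dist x y < a"
proof -
  have "\<exists>y\<in>A. dist x y < a"
  proof (rule ccontr)
    assume "\<not> ?thesis"
    then have "a \<le> infdist x A"
      unfolding infdist_notempty[OF assms(1)] by (intro cINF_greatest[OF assms(1)]) auto
    then show False using assms(2) by simp
  qed
  then show ?thesis using that by blast
qed

text \<open>A continuous \<open>g\<close> cannot leave its band from \<open>2 * pi * k\<close> to
  \<open>2 * pi * k + pi\<close>, as the sine is negative just beyond it.\<close>

lemma sin_nonneg_variation:
  fixes g :: "'a::topological_space \<Rightarrow> real"
  assumes "connected S" "continuous_on S g" and pos: "\<And>t. t \<in> S \<Longrightarrow> 0 \<le> sin (g t)" and ab: "a \<in> S" "b \<in> S"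
  shows "g b \<le> g a + pi"
proof (rule ccontr)
  assume n: "\<not> ?thesis"
  define k where "k = \<lfloor>g a / (2 * pi)\<rfloor>"
  have "of_int k \<le> g a / (2 * pi)" "g a / (2 * pi) < of_int k + 1" unfolding k_def by linarith+
  then have x: "2 * pi * k \<le> g a" "g a < 2 * pi * k + 2 * pi" by (simp_all add: field_simps)
  have sk: "sin (2 * pi * k + y) = sin y" for y
    by (simp add: sin_add sin_int_2pin cos_int_2pin mult.commute[of "of_int k"])
  have "g a \<le> 2 * pi * k + pi"
  proof (rule ccontr)
    assume h: "\<not> ?thesis"
    have "sin (g a - 2 * pi * k) < 0" by (rule sin_lt_zero) (use h x in linarith)+
    then show False using pos[OF ab(1)] sk[of "g a - 2 * pi * k"] by simp
  qed
  then have b: "2 * pi * k + pi < g b" using n x(1) by linarith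
  define v where "v = min (g b) (2 * pi * k + 3 * pi / 2)"
  have v: "2 * pi * k + pi < v" "v < 2 * pi * k + 2 * pi" "g a \<le> v" "v \<le> g b"
    using b n \<open>g a \<le> 2 * pi * k + pi\<close> pi_gt_zero unfolding v_def by - linarith+
  have "connected (g ` S)" using assms(1,2) by (rule connected_continuous_image[rotated])
  then have "v \<in> g ` S"
    using v(3,4) ab by (meson connectedD_interval imageI)
  then obtain t where "t \<in> S" "g t = v" by blast
  then have "0 \<le> sin v" using pos by blast
  moreover have "sin (v - 2 * pi * k) < 0" by (rule sin_lt_zero) (use v in linarith)+
  ultimately show False using sk[of "v - 2 * pi * k"] by simp
qed

section \<open>Outward normals at a given scale\<close>

locale lipschitz_loop = jordan_loop +
  fixes r :: real
  assumes r: "0 < r" and cones: "\<And>p. p \<in> \<Gamma> \<Longrightarrow> \<exists>u. cone p r u"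
begin

definition "tube = {m. infdist m \<Gamma> < r/16}"

lemma \<Gamma>_ne: "\<Gamma> \<noteq> {}" using c_in by blast

lemma tube_cone:
  assumes "m \<in> tube"
  obtains p u where "p \<in> \<Gamma>" "cone p r u" "dist m p < r/16"
  using infdist_less_obtain[OF \<Gamma>_ne, of m "r/16"] assms cones unfolding tube_def by (metis mem_Collect_eq)

text \<open>A substitute for the normal of a curve that need not have tangents: perpendicular to it,
  \<psi> agrees on both sides of \<open>m\<close> at scale \<open>h\<close>, and the last condition
  orients it outwards.\<close>

definition "is_normal m h w \<longleftrightarrow> cmod w = 1 \<and> gap m h (- \<i> * w) = 0 \<and> 0 < gap m h w"

definition "nf m h = (SOME w. is_normal m h w)"

lemma gap_unique:
  assumes "m \<in> tube" "0 < h" "h < r/16" "cmod e = 1" "gap m h e = 0" "cmod e' = 1" "gap m h e' = 0"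
  shows "e' = e \<or> e' = - e"
proof -
  obtain p u where p: "p \<in> \<Gamma>" "cone p r u" "dist m p < r/16" using tube_cone[OF assms(1)] .
  have "cmod u = 1" using p(2) unfolding cone_def by blast
  from steep_zero_unique[OF this gap_steep[OF p assms(2,3)] assms(4-7)] show ?thesis .
qed

lemma normal_unique:
  assumes m: "m \<in> tube" "0 < h" "h < r/16" and w: "is_normal m h w" and w': "is_normal m h w'"
  shows "w' = w"
proof -
  have ni: "- \<i> \<noteq> 0" by simp
  have "- \<i> * w' = - \<i> * w \<or> - \<i> * w' = - (- \<i> * w)"
    using w w' unfolding is_normal_def by (intro gap_unique[OF m]) (auto simp: norm_mult)
  then have "w' = w \<or> w' = - w"
    unfolding mult_minus_right[symmetric] mult_left_cancel[OF ni] .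
  then show ?thesis using w w' gap_odd unfolding is_normal_def by (metis less_asym neg_0_less_iff_less)
qed

lemma nf:
  assumes "m \<in> tube" "0 < h" "h < r/16"
  shows "is_normal m h (nf m h)"
    and "\<And>p u. p \<in> \<Gamma> \<Longrightarrow> cone p r u \<Longrightarrow> dist m p < r/16 \<Longrightarrow> \<bar>fx u (nf m h)\<bar> \<le> fy u (nf m h)"
proof -
  have cont: "continuous_on UNIV (gap m h)"
    using gap_cont[of "\<lambda>_. m" "\<lambda>_. h" "\<lambda>e. e"] by (simp add: continuous_on_id)
  have ex: "\<exists>w. is_normal m h w \<and> \<bar>fx u w\<bar> \<le> fy u w" if p: "p \<in> \<Gamma>" "cone p r u" "dist m p < r/16" for p u
  proof -
    have "cmod u = 1" using p(2) unfolding cone_def by blast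
    from steep_normal[OF this gap_steep[OF p assms(2,3)] cont] show ?thesis
      unfolding is_normal_def fx_def fy_def by metis
  qed
  obtain p u where "p \<in> \<Gamma>" "cone p r u" "dist m p < r/16" using tube_cone[OF assms(1)] .
  from ex[OF this] have "\<exists>w. is_normal m h w" by blast
  then show n: "is_normal m h (nf m h)" unfolding nf_def by (rule someI_ex)
  fix p u assume "p \<in> \<Gamma>" "cone p r u" "dist m p < r/16"
  from ex[OF this] obtain w where w: "is_normal m h w" "\<bar>fx u w\<bar> \<le> fy u w" by blast
  then show "\<bar>fx u (nf m h)\<bar> \<le> fy u (nf m h)" using normal_unique[OF assms w(1) n] by simp
qed

lemma nf_unit: "m \<in> tube \<Longrightarrow> 0 < h \<Longrightarrow> h < r/16 \<Longrightarrow> cmod (nf m h) = 1"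
  using nf(1) unfolding is_normal_def by blast

text \<open>A map with closed graph into the compact circle is continuous. The strict inequality of
  \<open>is_normal\<close> is relaxed to a closed one; equality cannot occur, since \<open>w\<close>
  and \<open>- \<i> * w\<close> would be two independent zero directions.\<close>

lemma nf_cont: "continuous_on (tube \<times> {0<..<r/16}) (\<lambda>x. nf (fst x) (snd x))"
proof -
  let ?D = "tube \<times> {0<..<r/16}" and ?S = "sphere (0::complex) 1"
  have im: "(\<lambda>x. nf (fst x) (snd x)) \<in> ?D \<rightarrow> ?S" using nf_unit by auto
  define G where "G = {y :: (complex \<times> real) \<times> complex. gap (fst (fst y)) (snd (fst y)) (- \<i> * snd y) = 0}
    \<inter> {y. 0 \<le> gap (fst (fst y)) (snd (fst y)) (snd y)}"
  have "closed G"
    unfolding G_def by (intro closed_Int closed_Collect_eq closed_Collect_le gap_cont continuous_intros)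
  moreover have "(\<lambda>x. (x, nf (fst x) (snd x))) ` ?D = (?D \<times> ?S) \<inter> G"
  proof (intro equalityI subsetI)
    fix y assume "y \<in> (\<lambda>x. (x, nf (fst x) (snd x))) ` ?D"
    then obtain m h where y: "y = ((m, h), nf m h)" and m: "m \<in> tube" "0 < h" "h < r/16" by auto
    then show "y \<in> (?D \<times> ?S) \<inter> G"
      using nf(1)[OF m] unfolding is_normal_def G_def by auto
  next
    fix y assume yG: "y \<in> (?D \<times> ?S) \<inter> G"
    obtain m h w where y: "y = ((m, h), w)" by (metis surj_pair)
    from yG have m: "m \<in> tube" "0 < h" "h < r/16" and w: "cmod w = 1" "gap m h (- \<i> * w) = 0" "0 \<le> gap m h w"
      by (auto simp: y G_def)
    have "gap m h w \<noteq> 0"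
    proof
      assume "gap m h w = 0"
      then have "- \<i> * w = w \<or> - \<i> * w = - w"
        using gap_unique[OF m w(1) _ _ w(2)] w(1) by (simp add: norm_mult)
      then have "- \<i> = 1 \<or> - \<i> = - 1" using w(1) by (metis mult_cancel_right1 mult_minus1 mult_right_cancel norm_zero zero_neq_one)
      then show False by (simp add: complex_eq_iff)
    qed
    then have "is_normal m h w" using w unfolding is_normal_def by simp
    then have "w = nf m h" using normal_unique[OF m nf(1)[OF m]] by simp
    then show "y \<in> (\<lambda>x. (x, nf (fst x) (snd x))) ` ?D" using m by (auto simp: y)
  qed
  ultimately have "closedin (top_of_set (?D \<times> ?S)) ((\<lambda>x. (x, nf (fst x) (snd x))) ` ?D)"
    by (simp add: closedin_closed_Int)
  then show ?thesis
    using continuous_closed_graph_eq[OF compact_sphere im] by simp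
qed

text \<open>A short chord is perpendicular to the normal at its midpoint, taken at the scale of the chord.\<close>

lemma chord_normal:
  assumes xy: "x \<in> \<Gamma>" "y \<in> \<Gamma>" "x \<noteq> y" and m: "(x + y)/2 \<in> tube" and h: "dist x y / 2 < r/16"
  shows "(nf ((x + y)/2) (dist x y / 2))\<^sup>2 = - ((x - y) / cmod (x - y))\<^sup>2"
proof -
  let ?m = "(x + y)/2" and ?h = "dist x y / 2" and ?e = "(x - y) / of_real (cmod (x - y))"
  have h0: "0 < ?h" using xy by simp
  have d: "of_real ?h * ?e = (x - y)/2" using xy(3) by (simp add: dist_norm)
  have "?m + (x - y)/2 = x" "?m - (x - y)/2 = y" by (simp_all add: field_simps)
  moreover have "\<psi> x = 0" "\<psi> y = 0" using xy \<psi>_sign(3) by blast+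
  ultimately have "gap ?m ?h ?e = 0" unfolding gap_def d by (simp only:)
  moreover have "cmod ?e = 1" using xy(3) by (simp add: norm_divide)
  moreover note n = nf(1)[OF m h0 h, unfolded is_normal_def]
  ultimately have "?e = - \<i> * nf ?m ?h \<or> ?e = - (- \<i> * nf ?m ?h)"
    by (intro gap_unique[OF m h0 h]) (auto simp: norm_mult)
  then have "?e\<^sup>2 = (- \<i> * nf ?m ?h)\<^sup>2" by (metis power2_minus)
  then show ?thesis by (simp add: power_mult_distrib)
qed

text \<open>A chord inside the open cone would lead from the curve into the outside.\<close>

lemma short_chord_cone:
  assumes p: "p \<in> \<Gamma>" "cone p r u" and x: "x \<in> \<Gamma>" "dist x p < r/2" and y: "y \<in> \<Gamma>" "dist y p < r/2"
  shows "\<bar>fy u (y - x)\<bar> \<le> \<bar>fx u (y - x)\<bar>"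
proof (rule ccontr)
  assume n: "\<not> ?thesis"
  have *: False if "x \<in> \<Gamma>" "dist x p < r/2" "y \<in> \<Gamma>" "dist y p < r/2" "\<bar>fx u (y - x)\<bar> < fy u (y - x)" for x y
  proof -
    have "cmod (y - x) < r" using dist_triangle2[of y x p] that by (simp add: dist_norm)
    then have "x + (y - x) \<in> Out" using p(2) that r unfolding cone_def by (metis UnI2 dual_order.strict_trans field_less_half_sum half_gt_zero_iff less_add_same_cancel2 field_sum_of_halves)
    then have "y \<in> Out" by simp
    then show False using that(3) jordan(9) by blast
  qed
  have "\<bar>fx u (y - x)\<bar> < fy u (y - x) \<or> \<bar>fx u (x - y)\<bar> < fy u (x - y)"
    using n by (auto simp: frame_simps)
  then show False using *[OF x y] *[OF y x] by blast
qed

end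

lemma nonzero_same_sign:
  fixes q :: "'a::topological_space \<Rightarrow> real"
  assumes "connected S" "continuous_on S q" and nz: "\<And>t. t \<in> S \<Longrightarrow> q t \<noteq> 0" and ab: "a \<in> S" "b \<in> S"
  shows "0 < q a * q b"
proof (rule ccontr)
  assume "\<not> ?thesis"
  then have "q a * q b < 0" using nz[OF ab(1)] nz[OF ab(2)] by (simp add: order.order_iff_strict not_less)
  then have "q a \<le> 0 \<and> 0 \<le> q b \<or> q b \<le> 0 \<and> 0 \<le> q a" by (auto simp: mult_less_0_iff)
  moreover have "connected (q ` S)" using assms(1,2) by (rule connected_continuous_image[rotated])
  ultimately have "0 \<in> q ` S" using ab by (meson connectedD_interval imageI)
  then show False using nz by auto
qed

context lipschitz_loop begin

text \<open>Hopf's Umlaufsatz. The secants through a lowest point stay in a half plane, and all secants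
  close to that point are nearly parallel; so the secant direction cannot turn by \<open>3\<pi>\<close>.\<close>

lemma secant_turning:
  obtains \<Omega> :: "real \<times> real \<Rightarrow> real" and d :: int
  where "continuous_on {(s, t). s < t \<and> t < s + (1::real)} \<Omega>"
    "\<And>s t. s < t \<Longrightarrow> t < s + 1 \<Longrightarrow> c t - c s = of_real (cmod (c t - c s)) * cis (\<Omega> (s, t))"
    "\<And>s t. s < t \<Longrightarrow> t < s + 1 \<Longrightarrow> \<Omega> (s + 1, t + 1) = \<Omega> (s, t) + 2 * pi * d" "\<bar>d\<bar> = 1"
proof -
  define S where "S = {(s, t). s < t \<and> t < s + (1::real)}"
  define F where "F x = c (snd x) - c (fst x)" for x :: "real \<times> real"
  have F_cont: "continuous_on X F" for X
    unfolding F_def by (intro continuous_intros continuous_on_compose2[OF c_cont]) auto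
  have F_nz: "F x \<noteq> 0" if "x \<in> S" for x
    using that c_neq[of "fst x" "snd x"] by (auto simp: S_def F_def)
  obtain \<Omega> where \<Omega>: "continuous_on S \<Omega>" "\<And>x. x \<in> S \<Longrightarrow> F x = of_real (cmod (F x)) * cis (\<Omega> x)"
    using polar_lift[OF strip_convex[folded S_def] F_cont F_nz] by blast
  define J where "J x = (snd x, fst x + 1)" for x :: "real \<times> real"
  have J_S: "J x \<in> S" if "x \<in> S" for x using that by (auto simp: S_def J_def)
  have J_cont: "continuous_on X J" for X unfolding J_def by (intro continuous_intros)
  have FJ: "F (J x) = - F x" for x by (simp add: F_def J_def c_per)
  obtain k :: int where k: "\<And>x. x \<in> S \<Longrightarrow> \<Omega> (J x) - \<Omega> x - pi = 2 * pi * k"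
  proof (rule continuous_2pi_int_constant)
    show "connected S" unfolding S_def by (rule convex_connected[OF strip_convex])
    show "continuous_on S (\<lambda>x. \<Omega> (J x) - \<Omega> x - pi)"
      by (intro continuous_intros continuous_on_compose2[OF \<Omega>(1) J_cont] \<Omega>) (auto intro: J_S)
    fix x assume x: "x \<in> S"
    have "of_real (cmod (F x)) * cis (\<Omega> (J x)) = - (of_real (cmod (F x)) * cis (\<Omega> x))"
      using \<Omega>(2)[OF J_S[OF x]] \<Omega>(2)[OF x] by (simp add: FJ)
    then have "of_real (cmod (F x)) * cis (\<Omega> (J x)) = of_real (cmod (F x)) * (- cis (\<Omega> x))" by simp
    moreover have nz: "complex_of_real (cmod (F x)) \<noteq> 0" using F_nz[OF x] by simp
    ultimately have J: "cis (\<Omega> (J x)) = - cis (\<Omega> x)" unfolding mult_left_cancel[OF nz] by blast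
    have "cis (\<Omega> (J x) - \<Omega> x - pi) = cis (\<Omega> (J x)) * cis (- \<Omega> x) * cis (- pi)"
      unfolding cis_mult by simp
    also have "\<dots> = 1" unfolding J by (simp add: cis_mult) (simp add: complex_eq_iff)
    finally show "cis (\<Omega> (J x) - \<Omega> x - pi) = 1" .
  qed blast
  \<comment> \<open>\<open>J\<close> reverses the secant, so its argument changes by an odd multiple
    of \<pi>; parity later turns the bound 2 into absolute value 1.\<close>
  define d where "d = 2 * k + 1"
  have d: "\<Omega> (J x) = \<Omega> x + pi * d" if "x \<in> S" for x
    using k[OF that] by (simp add: d_def algebra_simps)
  have "\<exists>s\<in>{0..1}. \<forall>t\<in>{0..1}. Im (c s) \<le> Im (c t)"
    by (intro continuous_attains_inf continuous_intros continuous_on_subset[OF c_cont]) auto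
  then obtain s0 where low: "\<And>t. t \<in> {0..1} \<Longrightarrow> Im (c s0) \<le> Im (c t)" by blast
  have lowest: "Im (c s0) \<le> Im (c t)" for t
  proof -
    have "c t \<in> c ` {0..1}" using c_in[of t] unfolding \<Gamma>_eq .
    then show ?thesis using low by auto
  qed
  obtain \<delta>0 where \<delta>0: "0 < \<delta>0" "\<And>t. dist t s0 < \<delta>0 \<Longrightarrow> dist (c t) (c s0) < r/2"
    using c_cont r unfolding continuous_on_iff by (metis UNIV_I half_gt_zero)
  define \<delta> where "\<delta> = min (1/4) (\<delta>0/2)"
  have \<delta>: "0 < \<delta>" "\<delta> \<le> 1/4" "\<delta> < \<delta>0" using \<delta>0(1) by (auto simp: \<delta>_def)
  have sinp: "0 \<le> sin (\<Omega> (s0, t))" if "t \<in> {s0<..<s0+1}" for t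
  proof -
    have x: "(s0, t) \<in> S" using that by (simp add: S_def)
    have "0 \<le> Im (F (s0, t))" using lowest[of t] by (simp add: F_def)
    then have "0 \<le> cmod (F (s0, t)) * sin (\<Omega> (s0, t))" by (subst (asm) \<Omega>(2)[OF x]) simp
    then show ?thesis using F_nz[OF x] by (simp add: zero_le_mult_iff)
  qed
  have cont1: "continuous_on {s0<..<s0+1} (\<lambda>t. \<Omega> (s0, t))"
    by (intro continuous_on_compose2[OF \<Omega>(1)] continuous_intros) (auto simp: S_def)
  have v1: "\<bar>\<Omega> (s0, s0 + 1 - \<delta>) - \<Omega> (s0, s0 + \<delta>)\<bar> \<le> pi"
    using sin_nonneg_variation[OF connected_Ioo cont1 sinp, of "s0 + \<delta>" "s0 + 1 - \<delta>"]
      sin_nonneg_variation[OF connected_Ioo cont1 sinp, of "s0 + 1 - \<delta>" "s0 + \<delta>"] \<delta> by auto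
  \<comment> \<open>These secants complete a path from \<open>(s0, s0 + \<delta>)\<close> to its
    image under \<open>J\<close>; modulo the period both their end points stay near
    \<open>c s0\<close>.\<close>
  define x where "x \<tau> = (s0 + \<tau>, s0 + \<tau> + 1 - \<delta>)" for \<tau>
  have xS: "x \<tau> \<in> S" for \<tau> using \<delta> by (simp add: S_def x_def)
  have x_cont: "continuous_on X x" for X unfolding x_def by (intro continuous_intros)
  obtain u where u: "cone (c s0) r u" using cones c_in by blast
  then have u1: "cmod u = 1" unfolding cone_def by blast
  have Fx: "\<bar>fy u (F (x \<tau>))\<bar> \<le> \<bar>fx u (F (x \<tau>))\<bar>" "fx u (F (x \<tau>)) \<noteq> 0" if "\<tau> \<in> {0..\<delta>}" for \<tau>
  proof -
    have eq: "F (x \<tau>) = c (s0 + \<tau> - \<delta>) - c (s0 + \<tau>)"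
      using c_per[of "s0 + \<tau> - \<delta>"] by (simp add: F_def x_def algebra_simps)
    have "dist (s0 + \<tau> - \<delta>) s0 < \<delta>0" "dist (s0 + \<tau>) s0 < \<delta>0"
      using that \<delta> by (auto simp: dist_real_def)
    from \<delta>0(2)[OF this(1)] \<delta>0(2)[OF this(2)]
    show 1: "\<bar>fy u (F (x \<tau>))\<bar> \<le> \<bar>fx u (F (x \<tau>))\<bar>"
      unfolding eq by (intro short_chord_cone[OF c_in u]) auto
    show "fx u (F (x \<tau>)) \<noteq> 0"
    proof
      assume 0: "fx u (F (x \<tau>)) = 0"
      then have "fy u (F (x \<tau>)) = 0" using 1 by simp
      then have "F (x \<tau>) = 0" using frame_eq[OF u1, of "F (x \<tau>)" 0] 0 by (simp add: fx_def fy_def)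
      then show False using F_nz[OF xS] by simp
    qed
  qed
  have sgn: "0 < fx u (F (x \<tau>)) * fx u (F (x \<tau>'))" if "\<tau> \<in> {0..\<delta>}" "\<tau>' \<in> {0..\<delta>}" for \<tau> \<tau>'
  proof (rule nonzero_same_sign[OF _ _ Fx(2) that])
    show "continuous_on {0..\<delta>} (\<lambda>\<tau>. fx u (F (x \<tau>)))"
      unfolding fx_def by (intro continuous_intros continuous_on_compose2[OF F_cont x_cont]) auto
  qed auto
  \<comment> \<open>The shift by \<open>pi/2\<close> turns a nonnegative cosine into a nonnegative
    sine.\<close>
  define g where "g \<tau> = \<Omega> (x \<tau>) - \<Omega> (x 0) + pi/2" for \<tau>
  have cosp: "0 \<le> sin (g \<tau>)" if \<tau>: "\<tau> \<in> {0..\<delta>}" for \<tau>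
  proof -
    have 0: "0 \<in> {0..\<delta>}" using \<delta> by simp
    have "\<bar>fy u (F (x 0)) * fy u (F (x \<tau>))\<bar> \<le> \<bar>fx u (F (x 0)) * fx u (F (x \<tau>))\<bar>"
      unfolding abs_mult by (intro mult_mono Fx(1) 0 \<tau>) auto
    then have "0 \<le> Re (cnj (F (x 0)) * F (x \<tau>))"
      unfolding frame_inner[OF u1] using sgn[OF 0 \<tau>] by linarith
    also have "cnj (F (x 0)) * F (x \<tau>) = of_real (cmod (F (x 0)) * cmod (F (x \<tau>))) * (cis (- \<Omega> (x 0)) * cis (\<Omega> (x \<tau>)))"
      by (subst (1) \<Omega>(2)[OF xS], subst (2) \<Omega>(2)[OF xS]) (simp add: cis_cnj mult_ac)
    also have "cis (- \<Omega> (x 0)) * cis (\<Omega> (x \<tau>)) = cis (\<Omega> (x \<tau>) - \<Omega> (x 0))" by (simp add: cis_mult)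
    finally have "0 \<le> cmod (F (x 0)) * cmod (F (x \<tau>)) * cos (\<Omega> (x \<tau>) - \<Omega> (x 0))"
      by (simp only: Re_complex_of_real times_complex.sel Im_complex_of_real cis.sel)
    moreover have "0 < cmod (F (x 0)) * cmod (F (x \<tau>))" using F_nz[OF xS] by simp
    ultimately have "0 \<le> cos (\<Omega> (x \<tau>) - \<Omega> (x 0))" by (simp add: zero_le_mult_iff)
    then show ?thesis unfolding g_def by (simp add: sin_add)
  qed
  have g_cont: "continuous_on {0..\<delta>} g"
    unfolding g_def by (intro continuous_intros continuous_on_compose2[OF \<Omega>(1) x_cont]) (auto intro: xS)
  have "\<bar>g \<delta> - g 0\<bar> \<le> pi"
    using sin_nonneg_variation[OF connected_Icc g_cont cosp, of 0 \<delta>]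
      sin_nonneg_variation[OF connected_Icc g_cont cosp, of \<delta> 0] \<delta> by auto
  then have v2: "\<bar>\<Omega> (s0 + \<delta>, s0 + 1) - \<Omega> (s0, s0 + 1 - \<delta>)\<bar> \<le> pi"
    by (simp add: g_def x_def)
  have "\<Omega> (s0 + \<delta>, s0 + 1) = \<Omega> (s0, s0 + \<delta>) + pi * d"
    using d[of "(s0, s0 + \<delta>)"] \<delta> by (simp add: S_def J_def)
  with v1 v2 have "\<bar>pi * real_of_int d\<bar> \<le> pi * 2" by linarith
  then have "\<bar>real_of_int d\<bar> \<le> 2" unfolding abs_mult by simp
  then have "\<bar>d\<bar> \<le> 2" by linarith
  then have d1: "\<bar>d\<bar> = 1" unfolding d_def by presburger
  show ?thesis
  proof (rule that[of \<Omega> d])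
    show "continuous_on {(s, t). s < t \<and> t < s + (1::real)} \<Omega>" using \<Omega>(1) unfolding S_def .
    fix s t :: real assume "s < t" "t < s + 1"
    then have st: "(s, t) \<in> S" by (simp add: S_def)
    show "c t - c s = of_real (cmod (c t - c s)) * cis (\<Omega> (s, t))" using \<Omega>(2)[OF st] by (simp add: F_def)
    show "\<Omega> (s + 1, t + 1) = \<Omega> (s, t) + 2 * pi * d"
      using d[OF st] d[OF J_S[OF st]] by (simp add: J_def)
  qed (rule d1)
qed

end

context lipschitz_loop begin

text \<open>The normal at a curve point is joined to the normal at the midpoint of a short chord, so it
  turns as often as the secant.\<close>

lemma normal_turning:
  obtains L :: "real \<Rightarrow> real" and d :: int where "continuous_on {0..1} L"
    "\<And>t. t \<in> {0..1} \<Longrightarrow> nf (c t) (r/32) = cis (L t)" "L 1 - L 0 = 2 * pi * d" "\<bar>d\<bar> = 1"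
proof -
  obtain \<Omega> d where \<Omega>: "continuous_on {(s, t). s < t \<and> t < s + (1::real)} \<Omega>"
    "\<And>s t. s < t \<Longrightarrow> t < s + 1 \<Longrightarrow> c t - c s = of_real (cmod (c t - c s)) * cis (\<Omega> (s, t))"
    "\<And>s t. s < t \<Longrightarrow> t < s + 1 \<Longrightarrow> \<Omega> (s + 1, t + 1) = \<Omega> (s, t) + 2 * pi * of_int d" and d: "\<bar>d\<bar> = (1::int)"
    by (rule secant_turning) (rule that; assumption)
  have "uniformly_continuous_on {0..2} c"
    by (intro compact_uniformly_continuous continuous_on_subset[OF c_cont]) auto
  moreover have "0 < r/16" using r by simp
  ultimately obtain \<delta>0 where \<delta>0: "0 < \<delta>0"
    "\<And>s t. s \<in> {0..2} \<Longrightarrow> t \<in> {0..2} \<Longrightarrow> dist t s < \<delta>0 \<Longrightarrow> dist (c t) (c s) < r/16"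
    unfolding uniformly_continuous_on_def by metis
  define \<delta> where "\<delta> = min (1/2) (\<delta>0/2)"
  have \<delta>: "0 < \<delta>" "\<delta> \<le> 1/2" "\<delta> < \<delta>0" using \<delta>0(1) by (auto simp: \<delta>_def)
  define l where "l t = cmod (c (t + \<delta>) - c t)" for t
  have l: "0 < l t" "l t < r/16" if "t \<in> {0..1}" for t
    using \<delta>0(2)[of t "t + \<delta>"] c_neq[of t "t + \<delta>"] \<delta> that
    by (auto simp: l_def dist_norm norm_minus_commute)
  \<comment> \<open>With \<open>h\<close>, a homotopy within the domain of \<open>nf\<close>, from
    the midpoint of a short secant at its own scale to the curve point at scale
    \<open>r/32\<close>.\<close>
  define M where "M x = c (fst x) + of_real ((1 - snd x) / 2) * (c (fst x + \<delta>) - c (fst x))" for x :: "real \<times> real"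
  define h where "h x = (1 - snd x) * (l (fst x) / 2) + snd x * (r/32)" for x :: "real \<times> real"
  define D where "D = {0..1::real} \<times> {0..1::real}"
  have M_tube: "M x \<in> tube" if "x \<in> D" for x
  proof -
    have "infdist (M x) \<Gamma> \<le> dist (M x) (c (fst x))" by (intro infdist_le c_in)
    also have "\<dots> = \<bar>(1 - snd x) / 2\<bar> * l (fst x)"
      by (simp only: M_def l_def dist_norm add_diff_cancel_left' norm_mult norm_of_real)
    also have "\<dots> \<le> 1 * l (fst x)"
      using that l(1)[of "fst x"] by (intro mult_right_mono) (auto simp: D_def)
    also have "\<dots> < r/16" using l(2)[of "fst x"] that by (auto simp: D_def)
    finally show ?thesis by (simp add: tube_def)
  qed
  have h: "0 < h x" "h x < r/16" if "x \<in> D" for x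
  proof -
    have x: "fst x \<in> {0..1}" "0 \<le> snd x" "snd x \<le> 1" using that by (auto simp: D_def)
    note l = l[OF x(1)]
    have "(1 - snd x) * 0 + snd x * 0 < h x"
    proof (cases "snd x = 0")
      case False
      then have "0 < snd x * (r/32)" using x r by simp
      moreover have "0 \<le> (1 - snd x) * (l (fst x) / 2)" using x l by simp
      ultimately show ?thesis unfolding h_def by simp
    qed (use l in \<open>simp add: h_def\<close>)
    then show "0 < h x" by simp
    have "(1 - snd x) * (l (fst x) / 2) \<le> (1 - snd x) * (r/32)" using x l by (intro mult_left_mono) auto
    then have "h x \<le> r/32" unfolding h_def by (simp add: algebra_simps)
    then show "h x < r/16" using r by simp
  qed
  define H where "H x = nf (M x) (h x)" for x
  have c_fst: "continuous_on X (\<lambda>x. c (fst x))" "continuous_on X (\<lambda>x. c (fst x + \<delta>))" for X :: "(real \<times> real) set"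
    by (intro continuous_on_compose2[OF c_cont] continuous_intros; simp)+
  have H_cont: "continuous_on D H"
  proof -
    have "continuous_on D (\<lambda>x. (M x, h x))"
      unfolding M_def h_def l_def by (intro continuous_intros c_fst) auto
    moreover have "(\<lambda>x. (M x, h x)) ` D \<subseteq> tube \<times> {0<..<r/16}" using M_tube h by (intro image_subsetI SigmaI) (simp_all only: greaterThanLessThan_iff)
    ultimately show ?thesis
      unfolding H_def using continuous_on_compose2[OF nf_cont, of D "\<lambda>x. (M x, h x)"] by simp
  qed
  have H_unit: "cmod (H x) = 1" if "x \<in> D" for x
    unfolding H_def by (rule nf_unit[OF M_tube[OF that] h[OF that]])
  then have H0: "H x \<noteq> 0" if "x \<in> D" for x using that by fastforce
  have "convex D" unfolding D_def by (intro convex_Times) auto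
  then obtain \<Lambda> where \<Lambda>: "continuous_on D \<Lambda>" "\<And>x. x \<in> D \<Longrightarrow> H x = of_real (cmod (H x)) * cis (\<Lambda> x)"
    by (rule polar_lift[OF _ H_cont H0]) (assumption, (rule that; assumption))
  have H\<Lambda>: "H x = cis (\<Lambda> x)" if "x \<in> D" for x using \<Lambda>(2)[OF that] H_unit[OF that] by simp
  have \<Lambda>_line: "continuous_on {0..1} (\<lambda>t. \<Lambda> (t, b))" "continuous_on {0..1} (\<lambda>t. \<Lambda> (b, t))"
    if "b \<in> {0..1}" for b
    using that by (auto intro!: continuous_on_compose2[OF \<Lambda>(1)] continuous_intros simp: D_def)
  obtain k :: int where k: "\<And>b. b \<in> {0..1} \<Longrightarrow> \<Lambda> (1, b) - \<Lambda> (0, b) = 2 * pi * k"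
  proof (rule continuous_2pi_int_constant)
    show "continuous_on {0..1} (\<lambda>b. \<Lambda> (1, b) - \<Lambda> (0, b))" by (intro continuous_intros \<Lambda>_line) auto
    fix b :: real assume b: "b \<in> {0..1}"
    have c1: "c 1 = c 0" "c (1 + \<delta>) = c \<delta>" using c_per[of 0] c_per[of \<delta>] by (simp_all add: add.commute)
    have "H (1, b) = H (0, b)" by (simp add: H_def M_def h_def l_def c1)
    then have eq: "cis (\<Lambda> (1, b)) = cis (\<Lambda> (0, b))" using H\<Lambda> b by (simp add: D_def)
    have "cis (\<Lambda> (1, b) - \<Lambda> (0, b)) = cis (\<Lambda> (1, b)) / cis (\<Lambda> (0, b))" by (rule cis_divide[symmetric])
    then show "cis (\<Lambda> (1, b) - \<Lambda> (0, b)) = 1" unfolding eq by simp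
  qed auto
  \<comment> \<open>Angles are doubled because \<open>chord_normal\<close> determines the normal up
    to sign only.\<close>
  obtain j :: int where j: "\<And>t. t \<in> {0..1} \<Longrightarrow> 2 * \<Lambda> (t, 0) - 2 * \<Omega> (t, t + \<delta>) - pi = 2 * pi * j"
  proof (rule continuous_2pi_int_constant)
    show "continuous_on {0..1} (\<lambda>t. 2 * \<Lambda> (t, 0) - 2 * \<Omega> (t, t + \<delta>) - pi)"
      using \<delta> by (auto intro!: continuous_intros \<Lambda>_line continuous_on_compose2[OF \<Omega>(1)])
    fix t :: real assume t: "t \<in> {0..1}"
    then have tD: "(t, 0) \<in> D" by (simp add: D_def)
    have lt: "t < t + \<delta>" "t + \<delta> < t + 1" using \<delta> by auto
    have m: "(c (t + \<delta>) + c t) / 2 = M (t, 0)" by (simp add: M_def field_simps)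
    have hh: "dist (c (t + \<delta>)) (c t) / 2 = h (t, 0)" by (simp add: h_def l_def dist_norm)
    have "(H (t, 0))\<^sup>2 = - ((c (t + \<delta>) - c t) / of_real (l t))\<^sup>2"
      using chord_normal[of "c (t + \<delta>)" "c t", unfolded m hh] M_tube[OF tD] h[OF tD] c_neq[OF lt]
      by (simp add: H_def l_def)
    also have "(c (t + \<delta>) - c t) / of_real (l t) = cis (\<Omega> (t, t + \<delta>))"
      using \<Omega>(2)[OF lt] l(1)[OF t] by (simp add: l_def field_simps)
    finally have eq: "cis (2 * \<Lambda> (t, 0)) = - cis (2 * \<Omega> (t, t + \<delta>))"
      unfolding H\<Lambda>[OF tD] Complex.DeMoivre by simp
    have "cis (2 * \<Lambda> (t, 0) - 2 * \<Omega> (t, t + \<delta>) - pi) = cis (2 * \<Lambda> (t, 0)) / cis (2 * \<Omega> (t, t + \<delta>)) / cis pi"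
      by (simp only: cis_divide)
    then show "cis (2 * \<Lambda> (t, 0) - 2 * \<Omega> (t, t + \<delta>) - pi) = 1" unfolding eq by simp
  qed auto
  have "\<Omega> (1, 1 + \<delta>) = \<Omega> (0, 0 + \<delta>) + 2 * pi * d" using \<Omega>(3)[of 0 \<delta>] \<delta> by (simp add: add.commute)
  moreover have "2 * \<Lambda> (0, 0) - 2 * \<Omega> (0, 0 + \<delta>) - pi = 2 * pi * j" "2 * \<Lambda> (1, 0) - 2 * \<Omega> (1, 1 + \<delta>) - pi = 2 * pi * j"
    by (rule j, simp)+
  moreover have "\<Lambda> (1, 0) - \<Lambda> (0, 0) = 2 * pi * k" by (rule k) simp
  ultimately have "pi * k = pi * d" by linarith
  then have kd: "k = d" by simp
  show ?thesis
  proof (rule that[of "\<lambda>t. \<Lambda> (t, 1)" d])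
    show "nf (c t) (r/32) = cis (\<Lambda> (t, 1))" if "t \<in> {0..1}" for t
      using H\<Lambda>[of "(t, 1)"] that by (simp add: H_def M_def h_def D_def)
    show "\<Lambda> (1, 1) - \<Lambda> (0, 1) = 2 * pi * d" using k[of 1] kd by simp
  qed (use \<Lambda>_line d in auto)
qed

text \<open>Hence along the curve the normal is homotopic to the radial field, or to its mirror image if
  the two turn in opposite senses.\<close>

lemma normal_phase:
  obtains z0 :: complex and N :: "complex \<Rightarrow> complex" and K :: "complex \<Rightarrow> real"
  where "z0 \<in> Ins" "(\<forall>m. N m = m - z0) \<or> (\<forall>m. N m = cnj (m - z0))" "continuous_on \<Gamma> K"
    "\<And>p. p \<in> \<Gamma> \<Longrightarrow> of_real (cmod (N p)) * nf p (r/32) = cis (K p) * N p"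
proof -
  obtain L :: "real \<Rightarrow> real" and d :: int where L: "continuous_on {0..1} L"
    "\<And>t. t \<in> {0..1} \<Longrightarrow> nf (c t) (r/32) = cis (L t)" "L 1 - L 0 = 2 * pi * d" "\<bar>d\<bar> = 1"
    by (rule normal_turning) (rule that; assumption)
  obtain z0 where z0: "z0 \<in> Ins" using jordan(1) by blast
  then have z0p: "z0 \<notin> path_image c" using jordan(9) unfolding path_image_c by blast
  have "path c" using simple_path_c by (rule simple_path_imp_path)
  then obtain q where q: "path q"
    "pathfinish q - pathstart q = 2 * of_real pi * \<i> * winding_number c z0"
    "\<And>t. t \<in> {0..1} \<Longrightarrow> c t = z0 + exp (q t)"
    by (rule winding_number_as_continuous_log[OF _ z0p]) (rule that; assumption)
  obtain w :: int where w: "winding_number c z0 = of_int w" "\<bar>w\<bar> = 1"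
    using simple_closed_path_winding_number_inside[OF simple_path_c] z0 unfolding path_image_c
    by (metis abs_1 abs_minus_cancel of_int_1 of_int_minus)
  define s where "s = d * w"
  have s: "s = 1 \<or> s = - 1" and ds: "d = s * w" using L(4) w(2) by (auto simp: s_def abs_if split: if_splits)
  define N where "N m = (if s = 1 then m - z0 else cnj (m - z0))" for m
  \<comment> \<open>Both angles change by \<open>2 * pi * d\<close> over a period, so their
    difference closes up and descends to the curve.\<close>
  define \<kappa> where "\<kappa> t = L t - s * Im (q t)" for t
  have N_eq: "N (c t) = of_real (cmod (N (c t))) * cis (s * Im (q t))" if "t \<in> {0..1}" for t
  proof -
    have e: "c t - z0 = of_real (cmod (c t - z0)) * cis (Im (q t))"
      using q(3)[OF that] exp_eq_polar[of "q t"] by (simp add: norm_mult)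
    have e': "cnj (c t - z0) = of_real (cmod (c t - z0)) * cis (- Im (q t))"
      by (subst e) (simp only: complex_cnj_mult complex_cnj_complex_of_real cis_cnj)
    from s show ?thesis
    proof
      assume s: "s = 1"
      then have "N (c t) = c t - z0" by (simp add: N_def)
      then show ?thesis unfolding s of_int_1 mult_1 by (simp only:) (rule e)
    next
      assume s: "s = - 1"
      then have "N (c t) = cnj (c t - z0)" by (simp add: N_def)
      then show ?thesis unfolding s of_int_minus of_int_1 mult_minus1 by (simp only: complex_mod_cnj) (rule e')
    qed
  qed
  have "Im (q 1) - Im (q 0) = 2 * pi * w"
    using arg_cong[OF q(2), of Im] w(1) by (simp add: pathfinish_def pathstart_def)
  then have \<kappa>1: "\<kappa> 1 = \<kappa> 0" using L(3) unfolding ds \<kappa>_def by (simp add: algebra_simps)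
  define K where "K p = \<kappa> (SOME t. t \<in> {0..1} \<and> c t = p)" for p
  have Kc: "K (c t) = \<kappa> t" if t: "t \<in> {0..1}" for t
  proof -
    define t' where "t' = (SOME t'. t' \<in> {0..1} \<and> c t' = c t)"
    have t': "t' \<in> {0..1} \<and> c t' = c t" unfolding t'_def by (rule someI[of _ t]) (use t in auto)
    have "t' = t \<or> t' = 0 \<and> t = 1 \<or> t' = 1 \<and> t = 0"
      using c_neq[of t t'] c_neq[of t' t] t t' by force
    then show ?thesis using \<kappa>1 unfolding K_def t'_def[symmetric] by auto
  qed
  have \<kappa>_cont: "continuous_on {0..1} \<kappa>"
    unfolding \<kappa>_def by (intro continuous_intros L(1) q(1)[unfolded path_def])
  have "continuous_on \<Gamma> K"
    unfolding \<Gamma>_eq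
  proof (rule continuous_on_compact_quotient)
    show "continuous_on {0..1} (\<lambda>t. K (c t))" using \<kappa>_cont by (rule continuous_on_eq) (simp add: Kc)
  qed (simp, rule continuous_on_subset[OF c_cont subset_UNIV])
  moreover have "of_real (cmod (N p)) * nf p (r/32) = cis (K p) * N p" if p: "p \<in> \<Gamma>" for p
  proof -
    obtain t where t: "t \<in> {0..1}" "p = c t" using p unfolding \<Gamma>_eq by blast
    have "cis (K p) * N p = cis (K p) * (of_real (cmod (N p)) * cis (s * Im (q t)))"
      using N_eq[OF t(1)] unfolding t(2) by (rule arg_cong)
    also have "\<dots> = of_real (cmod (N p)) * (cis (K p) * cis (s * Im (q t)))" by (simp only: mult_ac)
    also have "cis (K p) * cis (s * Im (q t)) = nf p (r/32)"
      unfolding cis_mult t(2) Kc[OF t(1)] L(2)[OF t(1)] \<kappa>_def by simp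
    finally show ?thesis by (rule sym)
  qed
  moreover have "(\<forall>m. N m = m - z0) \<or> (\<forall>m. N m = cnj (m - z0))" unfolding N_def by auto
  ultimately show ?thesis using that z0 by blast
qed

text \<open>The field is kept in the form of a unit phase times \<open>N\<close>. So only a real
  function has to be extended, and the sole zero is that of \<open>N\<close>.\<close>

lemma normal_extends:
  obtains z0 :: complex and N \<nu> :: "complex \<Rightarrow> complex" and \<eta> R0 :: real
  where "z0 \<in> Ins" "(\<forall>m. N m = m - z0) \<or> (\<forall>m. N m = cnj (m - z0))" "continuous_on UNIV \<nu>" "0 < \<eta>"
    "{m. infdist m \<Gamma> \<le> \<eta>} \<subseteq> tube" "\<And>m. R0 \<le> cmod (m - z0) \<Longrightarrow> \<nu> m = N m" "\<And>m. m \<noteq> z0 \<Longrightarrow> \<nu> m \<noteq> 0" "\<eta> < infdist z0 \<Gamma>"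
    "\<And>m. infdist m \<Gamma> \<le> \<eta> \<Longrightarrow> \<nu> m = of_real (cmod (N m)) * nf m (r/32)"
proof -
  obtain z0 N K where z0: "z0 \<in> Ins" and N: "(\<forall>m. N m = m - z0) \<or> (\<forall>m. N m = cnj (m - z0))"
    and K: "continuous_on \<Gamma> K" "\<And>p. p \<in> \<Gamma> \<Longrightarrow> of_real (cmod (N p)) * nf p (r/32) = cis (K p) * N p"
    by (rule normal_phase) (rule that; assumption)
  have N0: "N m = 0 \<longleftrightarrow> m = z0" for m using N by auto
  have N_cont: "continuous_on X N" for X
    using N
  proof
    assume "\<forall>m. N m = m - z0"
    then have "N = (\<lambda>m. m - z0)" by blast
    then show ?thesis by (simp only:) (intro continuous_intros)
  next
    assume "\<forall>m. N m = cnj (m - z0)"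
    then have "N = (\<lambda>m. cnj (m - z0))" by blast
    then show ?thesis by (simp only:) (intro continuous_intros)
  qed
  have "closed \<Gamma>" using compact_\<Gamma> by (rule compact_imp_closed)
  then obtain K1 where K1: "continuous_on UNIV K1" "\<And>p. p \<in> \<Gamma> \<Longrightarrow> K1 p = K p"
    using Tietze_unbounded[OF K(1), of UNIV] by auto
  define W where "W m = cis (K1 m) * N m" for m
  have cis_cont: "continuous_on X (\<lambda>m. cis (f m))" if "continuous_on X f" for X :: "complex set" and f
    unfolding cis_conv_exp by (intro continuous_intros that)
  have W_cont: "continuous_on X W" for X
    unfolding W_def by (intro continuous_intros cis_cont N_cont continuous_on_subset[OF K1(1)]) auto
  have normW: "cmod (W m) = cmod (N m)" for m by (simp add: W_def norm_mult)
  \<comment> \<open>\<open>W\<close> has the right direction on the curve only. Nearby,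
    \<open>q\<close> compares the normal with it and has positive real part, so the principal
    logarithm corrects the phase throughout a collar.\<close>
  define q where "q m = nf m (r/32) * cnj (W m)" for m
  have nf1: "cmod (nf m (r/32)) = 1" if "m \<in> tube" for m using nf_unit[OF that, of "r/32"] r by simp
  have q_cont: "continuous_on tube q"
  proof -
    have "continuous_on tube (\<lambda>m. (m, r/32))" by (intro continuous_intros)
    moreover have "(\<lambda>m. (m, r/32)) ` tube \<subseteq> tube \<times> {0<..<r/16}" using r by auto
    ultimately have "continuous_on tube (\<lambda>m. nf m (r/32))"
      using continuous_on_compose2[OF nf_cont, of tube "\<lambda>m. (m, r/32)"] by simp
    then show ?thesis unfolding q_def by (intro continuous_intros W_cont)
  qed
  have open_tube: "open tube" unfolding tube_def by (intro open_Collect_less continuous_intros)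
  define B where "B = tube \<inter> q -` {z. 0 < Re z}"
  have B: "open B" unfolding B_def by (intro continuous_open_preimage q_cont open_tube open_halfspace_Re_gt)
  have "\<Gamma> \<subseteq> B"
  proof
    fix p assume p: "p \<in> \<Gamma>"
    then have pt: "p \<in> tube" using r by (simp add: tube_def)
    have "p \<noteq> z0" using p z0 jordan(9) by blast
    have "W p = of_real (cmod (N p)) * nf p (r/32)" unfolding W_def K1(2)[OF p] K(2)[OF p] by (rule refl)
    then have "q p = of_real (cmod (N p)) * (nf p (r/32) * cnj (nf p (r/32)))" by (simp add: q_def)
    also have "\<dots> = of_real (cmod (N p))" unfolding complex_norm_square[symmetric] nf1[OF pt] by simp
    finally show "p \<in> B" using pt N0 \<open>p \<noteq> z0\<close> by (simp add: B_def)
  qed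
  then obtain \<eta> where \<eta>: "0 < \<eta>" "{m. infdist m \<Gamma> \<le> \<eta>} \<subseteq> B"
    using compact_in_open_separated[OF \<Gamma>_ne compact_\<Gamma> B] by blast
  define U where "U = {m. infdist m \<Gamma> \<le> \<eta>}"
  have U_comp: "compact U" unfolding U_def by (rule compact_infdist_le[OF \<Gamma>_ne compact_\<Gamma> \<eta>(1)])
  have U: "m \<in> tube" "0 < Re (q m)" if "m \<in> U" for m using \<eta>(2) that by (auto simp: U_def B_def)
  define K2 where "K2 m = K1 m + Im (Ln (q m))" for m
  have K2_cont: "continuous_on U K2"
    unfolding K2_def using U(2)
    by (intro continuous_intros continuous_on_subset[OF K1(1)] continuous_on_subset[OF q_cont] subsetI U(1))
      (auto simp: complex_nonpos_Reals_iff, force)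
  have K2: "cis (K2 m) * N m = of_real (cmod (N m)) * nf m (r/32)" if m: "m \<in> U" for m
  proof -
    have q0: "q m \<noteq> 0" using U(2)[OF m] by auto
    have nq: "cmod (q m) = cmod (N m)" using nf1[OF U(1)[OF m]] by (simp add: q_def norm_mult normW)
    have "exp (Ln (q m)) = of_real (exp (Re (Ln (q m)))) * cis (Im (Ln (q m)))" by (rule exp_eq_polar)
    moreover have "exp (Re (Ln (q m))) = cmod (q m)" using q0 by simp
    ultimately have qp: "of_real (cmod (q m)) * cis (Im (Ln (q m))) = q m" unfolding exp_Ln[OF q0] by simp
    have "of_real (cmod (N m)) * (cis (K2 m) * N m) = (of_real (cmod (q m)) * cis (Im (Ln (q m)))) * W m"
      unfolding K2_def cis_mult[symmetric] W_def nq by (simp only: mult_ac)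
    also have "\<dots> = q m * W m" unfolding qp by (rule refl)
    also have "q m * W m = nf m (r/32) * (W m * cnj (W m))" by (simp add: q_def mult_ac)
    also have "\<dots> = of_real (cmod (N m)) * (of_real (cmod (N m)) * nf m (r/32))"
      unfolding complex_norm_square[symmetric] normW by (simp add: power2_eq_square mult_ac)
    finally have "of_real (cmod (N m)) * (cis (K2 m) * N m) = of_real (cmod (N m)) * (of_real (cmod (N m)) * nf m (r/32))" .
    moreover have nz: "complex_of_real (cmod (N m)) \<noteq> 0" using q0 nq by auto
    ultimately show ?thesis unfolding mult_left_cancel[OF nz] by blast
  qed
  obtain R0 where R0: "U \<subseteq> ball z0 R0" using bounded_subset_ballD[OF compact_imp_bounded[OF U_comp]] by blast
  \<comment> \<open>Here the phase will be prescribed as 0, which makes the field equal to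
    \<open>N\<close>.\<close>
  define E where "E = {m. R0 \<le> cmod (m - z0)}"
  have E: "closed E" unfolding E_def by (intro closed_Collect_le continuous_intros)
  have disj: "m \<notin> E" if "m \<in> U" for m using R0 that by (auto simp: E_def dist_norm norm_minus_commute)
  have "continuous_on (U \<union> E) (\<lambda>m. if m \<in> U then K2 m else 0)"
    by (rule continuous_on_cases) (use compact_imp_closed[OF U_comp] E K2_cont disj in auto)
  then obtain K3 where K3: "continuous_on UNIV K3" "\<And>m. m \<in> U \<union> E \<Longrightarrow> K3 m = (if m \<in> U then K2 m else 0)"
    using Tietze_unbounded[of "U \<union> E" "\<lambda>m. if m \<in> U then K2 m else 0" UNIV]
      closed_Un[OF compact_imp_closed[OF U_comp] E] by auto
  show ?thesis
  proof (rule that[OF z0 N _ \<eta>(1), of "\<lambda>m. cis (K3 m) * N m" R0])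
    show "continuous_on UNIV (\<lambda>m. cis (K3 m) * N m)" by (intro continuous_intros cis_cont K3(1) N_cont)
    show "{m. infdist m \<Gamma> \<le> \<eta>} \<subseteq> tube" using U(1) by (auto simp: U_def)
    show "cis (K3 m) * N m = N m" if "R0 \<le> cmod (m - z0)" for m
      using K3(2)[of m] disj[of m] that by (auto simp: E_def)
    show "cis (K3 m) * N m \<noteq> 0" if "m \<noteq> z0" for m using that N0 by simp
    show "\<eta> < infdist z0 \<Gamma>"
    proof (rule ccontr)
      assume "\<not> ?thesis"
      then have "0 < Re (q z0)" by (intro U(2)) (simp add: U_def)
      moreover have "N z0 = 0" using N0 by simp
      ultimately show False by (simp add: q_def W_def)
    qed
    show "cis (K3 m) * N m = of_real (cmod (N m)) * nf m (r/32)" if "infdist m \<Gamma> \<le> \<eta>" for m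
      using K3(2)[of m] K2[of m] that by (simp add: U_def)
  qed
qed

lemma far_ball_side:
  assumes "\<eta> < infdist m \<Gamma>"
  shows "m \<in> Ins \<Longrightarrow> ball m \<eta> \<subseteq> Ins" "m \<in> Out \<Longrightarrow> ball m \<eta> \<subseteq> Out"
proof -
  have "ball m \<eta> \<inter> \<Gamma> = {}"
    using assms infdist_le[of _ \<Gamma> m] by (force simp: dist_commute)
  then have "ball m \<eta> \<subseteq> Ins \<or> ball m \<eta> \<subseteq> Out" by (intro connected_side connected_ball)
  moreover have "m \<in> ball m \<eta> \<or> ball m \<eta> = {}" by auto
  ultimately show "m \<in> Ins \<Longrightarrow> ball m \<eta> \<subseteq> Ins" "m \<in> Out \<Longrightarrow> ball m \<eta> \<subseteq> Out" using jordan(8) by blast+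
qed

lemma collar_exists:
  obtains \<epsilon> \<nu> N U z0 R0 where "collared_loop c \<epsilon> \<nu> N U z0 R0"
proof -
  obtain z0 N \<nu> \<eta> R0 where z0: "z0 \<in> Ins" and N: "(\<forall>m. N m = m - z0) \<or> (\<forall>m. N m = cnj (m - z0))"
    and \<nu>: "continuous_on UNIV \<nu>" and \<eta>: "0 < \<eta>" and tube: "{m. infdist m \<Gamma> \<le> \<eta>} \<subseteq> tube"
    and far: "\<And>m. R0 \<le> cmod (m - z0) \<Longrightarrow> \<nu> m = N m" and nz: "\<And>m. m \<noteq> z0 \<Longrightarrow> \<nu> m \<noteq> 0"
    and z0_far: "\<eta> < infdist z0 \<Gamma>"
    and near: "\<And>m. infdist m \<Gamma> \<le> \<eta> \<Longrightarrow> \<nu> m = of_real (cmod (N m)) * nf m (r/32)"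
    by (rule normal_extends) (rule that; assumption)
  \<comment> \<open>Below \<eta>, so that end points do not cross the curve when the midpoint is
    outside the collar; below \<open>r/16\<close> for \<open>gap_steep\<close>.\<close>
  define \<epsilon> where "\<epsilon> = min (\<eta>/2) (r/32)"
  have \<epsilon>: "0 < \<epsilon>" "\<epsilon> < \<eta>" "\<epsilon> < r/16" using \<eta> r by (auto simp: \<epsilon>_def)
  have "collared_loop c \<epsilon> \<nu> N {m. infdist m \<Gamma> \<le> \<eta>} z0 R0"
  proof unfold_locales
    fix m e e' and t :: real
    assume m: "m \<in> {m. infdist m \<Gamma> \<le> \<eta>}" and e: "cmod e = 1" "cmod e' = 1" and t: "0 \<le> t" "t \<le> 1"
      and 0: "(1 - t) * gap m \<epsilon> e + t * Re (cnj (\<nu> m) * e) = 0"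
      "(1 - t) * gap m \<epsilon> e' + t * Re (cnj (\<nu> m) * e') = 0"
    have mt: "m \<in> tube" using m tube by blast
    obtain p u where p: "p \<in> \<Gamma>" "cone p r u" "dist m p < r/16" using tube_cone[OF mt] .
    have u: "cmod u = 1" using p(2) unfolding cone_def by blast
    \<comment> \<open>The bound on \<open>nf\<close> holds for every cone near \<open>m\<close>, so
      the normal at scale \<open>r/32\<close> and the gap at scale \<epsilon> are steep in one
      common frame.\<close>
    have "\<bar>fx u (nf m (r/32))\<bar> \<le> fy u (nf m (r/32))" using nf(2)[OF mt _ _ p] r by simp
    then have "\<bar>fx u (\<nu> m)\<bar> \<le> fy u (\<nu> m)"
      using near[of m] m by (simp add: frame_simps abs_mult mult_left_mono)
    moreover have "\<nu> m \<noteq> 0" using nz[of m] m z0_far by force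
    ultimately have "steep u (\<lambda>e. (1 - t) * gap m \<epsilon> e + t * Re (cnj (\<nu> m) * e))"
      using steep_convex[OF gap_steep[OF p \<epsilon>(1,3)] steep_linear[OF _ _ u] t] by blast
    from steep_zero_unique[OF u this e(1) _ e(2)] 0 show "e' = e \<or> e' = - e" by blast
  next
    fix m e :: complex
    have in_ball: "m + of_real \<epsilon> * e \<in> ball m \<eta>" if "cmod e = 1"
      using \<epsilon> that by (simp add: dist_norm norm_mult)
    assume m: "m \<notin> {m. infdist m \<Gamma> \<le> \<eta>}" and e: "cmod e = 1"
    then have far: "\<eta> < infdist m \<Gamma>" by simp
    { assume "m \<in> Ins"
      then show "\<psi> (m + of_real \<epsilon> * e) < 0"
        using far_ball_side(1)[OF far] in_ball[OF e] unfolding \<psi>_sign by blast }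
    { assume "m \<in> Out"
      then show "0 < \<psi> (m + of_real \<epsilon> * e)"
        using far_ball_side(2)[OF far] in_ball[OF e] unfolding \<psi>_sign by blast }
  next
    show "\<nu> m \<noteq> 0" if "m \<in> Out" for m using nz[of m] that z0 jordan(8) by blast
    show "\<Gamma> \<subseteq> {m. infdist m \<Gamma> \<le> \<eta>}" using \<eta> z0 jordan(9) by auto
  qed (use \<epsilon> N \<nu> far in auto)
  then show ?thesis using that by blast
qed

end

lemma jordan_loop_of_curve:
  assumes "Jordan_curve \<Gamma>"
  obtains c where "jordan_loop c" "range c = \<Gamma>"
proof -
  obtain \<gamma> where \<gamma>: "continuous_on (sphere (0::complex) 1) \<gamma>" "inj_on \<gamma> (sphere 0 1)" "\<Gamma> = \<gamma> ` sphere 0 1"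
    using assms unfolding Jordan_curve_def by blast
  define c where "c t = \<gamma> (cis (2 * pi * t))" for t
  have "jordan_loop c"
  proof
    have "continuous_on UNIV (\<lambda>t. cis (2 * pi * t))" unfolding cis_conv_exp by (intro continuous_intros)
    then show "continuous_on UNIV c"
      unfolding c_def by (intro continuous_on_compose2[OF \<gamma>(1)]) auto
    show "c (t + 1) = c t" for t
      by (simp add: c_def distrib_left cis_mult[symmetric])
    fix s t assume "c s = c t"
    then have "cis (2 * pi * s) = cis (2 * pi * t)"
      unfolding c_def by (rule inj_onD[OF \<gamma>(2)]) auto
    then have "cis (2 * pi * s) / cis (2 * pi * t) = 1" by simp
    then have "cis (2 * pi * (s - t)) = 1" by (simp add: cis_divide right_diff_distrib)
    then have "cos (2 * pi * (s - t)) = 1" by (simp add: complex_eq_iff)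
    then obtain k :: int where "2 * pi * (s - t) = real_of_int k * 2 * pi" using cos_one_2pi_int by blast
    then have "s - t = k" by simp
    then show "s - t \<in> \<int>" by simp
  qed
  moreover have "range c = \<Gamma>"
  proof -
    have "z \<in> range (\<lambda>t. cis (2 * pi * t))" if z: "z \<in> sphere 0 1" for z
    proof (rule image_eqI)
      show "z = cis (2 * pi * (Arg z / (2 * pi)))"
        using z cis_Arg[of z] by (cases "z = 0") (auto simp: sgn_eq)
    qed simp
    then have "range (\<lambda>t. cis (2 * pi * t)) = sphere 0 1" by auto
    then show ?thesis unfolding \<gamma>(3) c_def by (metis image_image)
  qed
  ultimately show ?thesis by (rule that)
qed

theorem theorem1p1:
  fixes \<Gamma> :: "complex set"
  assumes "Jordan_curve \<Gamma>" and "locally_1_Lipschitz \<Gamma>"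
  shows "(\<forall>n::nat. n \<ge> 2 \<longrightarrow>
            (\<exists>k::nat. 1 \<le> k \<and> k \<le> n - 1 \<and>
               has_inscribed_rectangle_of_ratio \<Gamma> (tan (real k * pi / (2 * real n))))) \<and>
         has_inscribed_square \<Gamma> \<and>
         has_inscribed_rectangle_of_ratio \<Gamma> (sqrt 3)"
proof -
  obtain c where c: "jordan_loop c" "range c = \<Gamma>" using jordan_loop_of_curve[OF assms(1)] .
  interpret jordan_loop c by (rule c(1))
  have \<Gamma>: "\<Gamma> = jordan_loop.\<Gamma> c" using c(2) by (simp add: \<Gamma>_def)
  obtain r where r: "0 < r" "\<And>p. p \<in> jordan_loop.\<Gamma> c \<Longrightarrow> \<exists>u. cone p r u"
    using uniform_cone[OF assms(2)[unfolded \<Gamma>]] by blast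
  interpret lipschitz_loop c r by unfold_locales (use r in auto)
  obtain \<epsilon> \<nu> N U z0 R0 where "collared_loop c \<epsilon> \<nu> N U z0 R0" by (rule collar_exists)
  then interpret collared_loop c \<epsilon> \<nu> N U z0 R0 .
  have rect: "\<exists>k a b c d. 1 \<le> k \<and> k \<le> n - 1 \<and> inscribed_rectangle \<Gamma> a b c d \<and>
      dist a b / dist b c = tan (real k * pi / (2 * real n))" if "2 \<le> n" for n
    using rectangle_exists[OF that] unfolding \<Gamma> .
  have "has_inscribed_square \<Gamma>"
  proof -
    obtain k a b c d where k: "1 \<le> k" "k \<le> 2 - (1::nat)" and R: "inscribed_rectangle \<Gamma> a b c d"
      "dist a b / dist b c = tan (real k * pi / (2 * real 2))" using rect[of 2] by auto
    have "real k * pi / (2 * real 2) = pi / 4" using k by (simp add: le_antisym)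
    then have "dist a b / dist b c = 1" using R(2) by (simp only: tan_45)
    \<comment> \<open>A zero denominator would make the quotient 0.\<close>
    then have "dist a b = dist b c" by (metis div_by_0 right_inverse_eq zero_neq_one)
    then show ?thesis using R(1) unfolding has_inscribed_square_def by blast
  qed
  moreover have "has_inscribed_rectangle_of_ratio \<Gamma> (sqrt 3)"
  proof -
    obtain k a b c d where k: "1 \<le> k" "k \<le> 3 - (1::nat)" and R: "inscribed_rectangle \<Gamma> a b c d"
      "dist a b / dist b c = tan (real k * pi / (2 * real 3))" using rect[of 3] by auto
    \<comment> \<open>The tangents of \<pi>/6 and \<pi>/3 are reciprocal, so both values give the
      same aspect ratio.\<close>
    have "k = 1 \<or> k = 2" using k by auto
    then have "has_aspect_ratio a b c d (sqrt 3)"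
    proof
      assume "k = 1"
      then have "dist a b / dist b c = 1 / sqrt 3" using R(2) tan_30 by simp
      then have "dist b c / dist a b = sqrt 3" by (metis inverse_divide div_by_1)
      then show ?thesis unfolding has_aspect_ratio_def by blast
    next
      assume "k = 2"
      then have "dist a b / dist b c = sqrt 3" using R(2) tan_60 by simp
      then show ?thesis unfolding has_aspect_ratio_def by blast
    qed
    then show ?thesis using R(1) unfolding has_inscribed_rectangle_of_ratio_def by blast
  qed
  ultimately show ?thesis
    using rect unfolding has_inscribed_rectangle_of_ratio_def has_aspect_ratio_def by blast
qed

end
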